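(* Let $\mathcal M$ be a finite module category over a finite tensor category $\mathcal C$. Then the algebra $\underline{\mathrm{Nat}}(\mathrm{Id}_{\mathcal M},\mathrm{Id}_{\mathcal M})$ in the Drinfeld center $\mathcal Z(\mathcal C)$ is braided commutative.
   Context: Let $\Bbbk$ be an algebraically closed field. A finite $\Bbbk$-linear category is one equivalent to the category of finite-dimensional modules over a finite-dimensional $\Bbbk$-algebra. A finite tensor category is a finite $\Bbbk$-linear rigid monoidal category with bilinear tensor product and simple unit (associators suppressed). A finite $\mathcal C$-module is a finite $\Bbbk$-linear left module category with bilinear action $(c,m)\mapsto c.m$, exact in the first variable and right exact in both. $\mathrm{Rex}_{\mathcal C}(\mathcal M,\mathcal M)$ is the category of right exact $\mathcal C$-module endofunctors (constraint $\phi^F_{c,m}\colon F(c.m)\xrightarrow{\cong}c.F(m)$) and module natural transformations. Objects of $\mathcal Z(\mathcal C)$ are pairs $(c_0,\sigma)$ with half-braiding $\sigma_c\colon c\otimes c_0\to c_0\otimes c$, natural and satisfying $\sigma_{c\otimes c'}=(\sigma_c\otimes\mathrm{id})\circ(\mathrm{id}\otimes\sigma_{c'})$, $\sigma_{\mathbf 1}=\mathrm{id}$. The braiding of $\mathcal Z(\mathcal C)$ is $\beta_{(a,\sigma),(b,\tau)}=\tau_a\colon a\otimes b\to b\otimes a$. $\mathrm{Rex}_{\mathcal C}(\mathcal M,\mathcal M)$ is a $\mathcal Z(\mathcal C)$-module: $((c_0,\sigma).F)(m)=c_0.F(m)$, with constraint $c_0.F(c.m)\cong(c_0\otimes c).F(m)\xrightarrow{\sigma_c^{-1}.\mathrm{id}}(c\otimes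 c_0).F(m)\cong c.(c_0.F(m))$. The internal natural transformations $\underline{\mathrm{Nat}}(F,G)\in\mathcal Z(\mathcal C)$ are the internal Hom of this module: there are isomorphisms, natural in $z\in\mathcal Z(\mathcal C)$, $\mathrm{Hom}_{\mathcal Z(\mathcal C)}(z,\underline{\mathrm{Nat}}(F,G))\cong\mathrm{Hom}_{\mathrm{Rex}_{\mathcal C}(\mathcal M,\mathcal M)}(z.F,G)$. Let $\underline{\mathrm{ev}}_{F,G}\colon\underline{\mathrm{Nat}}(F,G).F\to G$ correspond to the identity of $\underline{\mathrm{Nat}}(F,G)$. The multiplication on $A=\underline{\mathrm{Nat}}(F,F)$ is the morphism $\mu\colon A\otimes A\to A$ corresponding to $(A\otimes A).F\cong A.(A.F)\xrightarrow{\mathrm{id}.\underline{\mathrm{ev}}}A.F\xrightarrow{\underline{\mathrm{ev}}}F$, and the unit $\mathbf 1\to A$ corresponds to $\mathrm{id}_F$. An algebra $A$ is braided commutative if $\mu\circ\beta_{A,A}=\mu$. *)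

theory Defs
  imports
    "HOL-Library.FuncSet"
    "HOL-Computational_Algebra.Polynomial"
    "Jordan_Normal_Form.Matrix"
begin

no_notation monoid.mult (infixl \<open>\<otimes>\<index>\<close> 70)

section \<open>Linear categories\<close>

record ('o, 'a, 'k) lincat =
  Obj :: "'o set"
  Arr :: "'a set"
  Dom :: "'a \<Rightarrow> 'o"
  Cod :: "'a \<Rightarrow> 'o"
  Idn :: "'o \<Rightarrow> 'a"
  Comp :: "'a \<Rightarrow> 'a \<Rightarrow> 'a"  (infixr \<open>\<cdot>\<index>\<close> 65)
  Plus :: "'a \<Rightarrow> 'a \<Rightarrow> 'a"
  Scal :: "'k \<Rightarrow> 'a \<Rightarrow> 'a"
  Zero :: "'o \<Rightarrow> 'o \<Rightarrow> 'a"

definition Hom :: "('o, 'a, 'k, 'z) lincat_scheme \<Rightarrow> 'o \<Rightarrow> 'o \<Rightarrow> 'a set" where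
  "Hom C x y = {f \<in> Arr C. Dom C f = x \<and> Cod C f = y}"

text \<open>The operations are only relevant on composable, respectively parallel, arrows; their
  values elsewhere are arbitrary.\<close>

locale linear_category =
  fixes C :: "('o, 'a, 'k::field, 'z) lincat_scheme" (structure)
  assumes Dom_in: "f \<in> Arr C \<Longrightarrow> Dom C f \<in> Obj C"
    and Cod_in: "f \<in> Arr C \<Longrightarrow> Cod C f \<in> Obj C"
    and Idn_in: "x \<in> Obj C \<Longrightarrow> Idn C x \<in> Hom C x x"
    and Comp_in: "f \<in> Hom C x y \<Longrightarrow> g \<in> Hom C y z \<Longrightarrow> g \<cdot> f \<in> Hom C x z"
    and Comp_assoc: "f \<in> Hom C w x \<Longrightarrow> g \<in> Hom C x y \<Longrightarrow> h \<in> Hom C y z \<Longrightarrow>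
      (h \<cdot> g) \<cdot> f = h \<cdot> (g \<cdot> f)"
    and Idn_left: "f \<in> Hom C x y \<Longrightarrow> Idn C y \<cdot> f = f"
    and Idn_right: "f \<in> Hom C x y \<Longrightarrow> f \<cdot> Idn C x = f"
    and Plus_in: "f \<in> Hom C x y \<Longrightarrow> g \<in> Hom C x y \<Longrightarrow> Plus C f g \<in> Hom C x y"
    and Scal_in: "f \<in> Hom C x y \<Longrightarrow> Scal C a f \<in> Hom C x y"
    and Zero_in: "x \<in> Obj C \<Longrightarrow> y \<in> Obj C \<Longrightarrow> Zero C x y \<in> Hom C x y"
    and Plus_assoc: "f \<in> Hom C x y \<Longrightarrow> g \<in> Hom C x y \<Longrightarrow> h \<in> Hom C x y \<Longrightarrow>
      Plus C (Plus C f g) h = Plus C f (Plus C g h)"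
    and Plus_commute: "f \<in> Hom C x y \<Longrightarrow> g \<in> Hom C x y \<Longrightarrow> Plus C f g = Plus C g f"
    and Plus_Zero: "f \<in> Hom C x y \<Longrightarrow> Plus C f (Zero C x y) = f"
    and Plus_minus: "f \<in> Hom C x y \<Longrightarrow> Plus C f (Scal C (- 1) f) = Zero C x y"
    and Scal_Plus: "f \<in> Hom C x y \<Longrightarrow> g \<in> Hom C x y \<Longrightarrow>
      Scal C a (Plus C f g) = Plus C (Scal C a f) (Scal C a g)"
    and Scal_add: "f \<in> Hom C x y \<Longrightarrow> Scal C (a + b) f = Plus C (Scal C a f) (Scal C b f)"
    and Scal_mult: "f \<in> Hom C x y \<Longrightarrow> Scal C (a * b) f = Scal C a (Scal C b f)"
    and Scal_one: "f \<in> Hom C x y \<Longrightarrow> Scal C 1 f = f"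
    and Comp_Plus_left: "f \<in> Hom C x y \<Longrightarrow> g \<in> Hom C y z \<Longrightarrow> h \<in> Hom C y z \<Longrightarrow>
      Plus C g h \<cdot> f = Plus C (g \<cdot> f) (h \<cdot> f)"
    and Comp_Plus_right: "f \<in> Hom C x y \<Longrightarrow> g \<in> Hom C x y \<Longrightarrow> h \<in> Hom C y z \<Longrightarrow>
      h \<cdot> Plus C f g = Plus C (h \<cdot> f) (h \<cdot> g)"
    and Comp_Scal_left: "f \<in> Hom C x y \<Longrightarrow> g \<in> Hom C y z \<Longrightarrow>
      Scal C a g \<cdot> f = Scal C a (g \<cdot> f)"
    and Comp_Scal_right: "f \<in> Hom C x y \<Longrightarrow> g \<in> Hom C y z \<Longrightarrow>
      g \<cdot> Scal C a f = Scal C a (g \<cdot> f)"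

definition is_inverse :: "('o, 'a, 'k, 'z) lincat_scheme \<Rightarrow> 'a \<Rightarrow> 'a \<Rightarrow> bool" where
  "is_inverse C f g \<longleftrightarrow> g \<in> Hom C (Cod C f) (Dom C f) \<and>
     g \<cdot>\<^bsub>C\<^esub> f = Idn C (Dom C f) \<and> f \<cdot>\<^bsub>C\<^esub> g = Idn C (Cod C f)"

definition is_iso :: "('o, 'a, 'k, 'z) lincat_scheme \<Rightarrow> 'a \<Rightarrow> bool" where
  "is_iso C f \<longleftrightarrow> f \<in> Arr C \<and> (\<exists>g. is_inverse C f g)"

definition inv_arr :: "('o, 'a, 'k, 'z) lincat_scheme \<Rightarrow> 'a \<Rightarrow> 'a" where
  "inv_arr C f = (THE g. is_inverse C f g)"

definition is_mono :: "('o, 'a, 'k, 'z) lincat_scheme \<Rightarrow> 'a \<Rightarrow> bool" where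
  "is_mono C f \<longleftrightarrow> f \<in> Arr C \<and>
     (\<forall>x\<in>Obj C. \<forall>g\<in>Hom C x (Dom C f). \<forall>h\<in>Hom C x (Dom C f). f \<cdot>\<^bsub>C\<^esub> g = f \<cdot>\<^bsub>C\<^esub> h \<longrightarrow> g = h)"

definition is_zero_object :: "('o, 'a, 'k, 'z) lincat_scheme \<Rightarrow> 'o \<Rightarrow> bool" where
  "is_zero_object C x \<longleftrightarrow> x \<in> Obj C \<and>
     (\<forall>y\<in>Obj C. (\<exists>!f. f \<in> Hom C x y) \<and> (\<exists>!f. f \<in> Hom C y x))"

definition is_simple :: "('o, 'a, 'k, 'z) lincat_scheme \<Rightarrow> 'o \<Rightarrow> bool" where
  "is_simple C x \<longleftrightarrow> x \<in> Obj C \<and> \<not> is_zero_object C x \<and>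
     (\<forall>f. is_mono C f \<and> Cod C f = x \<longrightarrow> is_zero_object C (Dom C f) \<or> is_iso C f)"

definition is_kernel :: "('o, 'a, 'k, 'z) lincat_scheme \<Rightarrow> 'a \<Rightarrow> 'a \<Rightarrow> bool" where
  "is_kernel C f k \<longleftrightarrow> f \<in> Arr C \<and> k \<in> Arr C \<and> Cod C k = Dom C f \<and>
     f \<cdot>\<^bsub>C\<^esub> k = Zero C (Dom C k) (Cod C f) \<and>
     (\<forall>x\<in>Obj C. \<forall>h\<in>Hom C x (Dom C f). f \<cdot>\<^bsub>C\<^esub> h = Zero C x (Cod C f) \<longrightarrow>
        (\<exists>!u. u \<in> Hom C x (Dom C k) \<and> k \<cdot>\<^bsub>C\<^esub> u = h))"

definition is_cokernel :: "('o, 'a, 'k, 'z) lincat_scheme \<Rightarrow> 'a \<Rightarrow> 'a \<Rightarrow> bool" where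
  "is_cokernel C f p \<longleftrightarrow> f \<in> Arr C \<and> p \<in> Arr C \<and> Dom C p = Cod C f \<and>
     p \<cdot>\<^bsub>C\<^esub> f = Zero C (Dom C f) (Cod C p) \<and>
     (\<forall>x\<in>Obj C. \<forall>h\<in>Hom C (Cod C f) x. h \<cdot>\<^bsub>C\<^esub> f = Zero C (Dom C f) x \<longrightarrow>
        (\<exists>!u. u \<in> Hom C (Cod C p) x \<and> u \<cdot>\<^bsub>C\<^esub> p = h))"

section \<open>Functors, exactness, finiteness\<close>

text \<open>A functor is given by its object map and its arrow map.\<close>

definition linear_functor ::
  "('o, 'a, 'k, 'y) lincat_scheme \<Rightarrow> ('p, 'b, 'k, 'z) lincat_scheme \<Rightarrow> ('o \<Rightarrow> 'p) \<Rightarrow> ('a \<Rightarrow> 'b) \<Rightarrow> bool"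
where
  "linear_functor C D Fo Fa \<longleftrightarrow>
     (\<forall>x\<in>Obj C. Fo x \<in> Obj D) \<and>
     (\<forall>x y. \<forall>f\<in>Hom C x y. Fa f \<in> Hom D (Fo x) (Fo y)) \<and>
     (\<forall>x\<in>Obj C. Fa (Idn C x) = Idn D (Fo x)) \<and>
     (\<forall>x y z. \<forall>f\<in>Hom C x y. \<forall>g\<in>Hom C y z. Fa (g \<cdot>\<^bsub>C\<^esub> f) = Fa g \<cdot>\<^bsub>D\<^esub> Fa f) \<and>
     (\<forall>x y. \<forall>f\<in>Hom C x y. \<forall>g\<in>Hom C x y. Fa (Plus C f g) = Plus D (Fa f) (Fa g)) \<and>
     (\<forall>a. \<forall>f\<in>Arr C. Fa (Scal C a f) = Scal D a (Fa f))"

definition nat_iso ::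
  "('o, 'a, 'k, 'y) lincat_scheme \<Rightarrow> ('p, 'b, 'k, 'z) lincat_scheme \<Rightarrow>
   ('o \<Rightarrow> 'p) \<Rightarrow> ('a \<Rightarrow> 'b) \<Rightarrow> ('o \<Rightarrow> 'p) \<Rightarrow> ('a \<Rightarrow> 'b) \<Rightarrow> ('o \<Rightarrow> 'b) \<Rightarrow> bool"
where
  "nat_iso C D Fo Fa Go Ga \<eta> \<longleftrightarrow>
     (\<forall>x\<in>Obj C. \<eta> x \<in> Hom D (Fo x) (Go x) \<and> is_iso D (\<eta> x)) \<and>
     (\<forall>x y. \<forall>f\<in>Hom C x y. \<eta> y \<cdot>\<^bsub>D\<^esub> Fa f = Ga f \<cdot>\<^bsub>D\<^esub> \<eta> x)"

definition equivalent_linear ::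
  "('o, 'a, 'k, 'y) lincat_scheme \<Rightarrow> ('p, 'b, 'k, 'z) lincat_scheme \<Rightarrow> bool"
where
  "equivalent_linear C D \<longleftrightarrow>
     (\<exists>Fo Fa Go Ga \<eta> \<epsilon>. linear_functor C D Fo Fa \<and> linear_functor D C Go Ga \<and>
        nat_iso C C (\<lambda>x. x) (\<lambda>f. f) (\<lambda>x. Go (Fo x)) (\<lambda>f. Ga (Fa f)) \<eta> \<and>
        nat_iso D D (\<lambda>x. Fo (Go x)) (\<lambda>f. Fa (Ga f)) (\<lambda>x. x) (\<lambda>f. f) \<epsilon>)"

text \<open>A (linear) functor is right exact if it preserves right exact sequences
  \<open>x \<rightarrow> y \<rightarrow> z \<rightarrow> 0\<close>, that is, cokernels; dually for left exactness.\<close>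

definition right_exact ::
  "('o, 'a, 'k, 'y) lincat_scheme \<Rightarrow> ('p, 'b, 'k, 'z) lincat_scheme \<Rightarrow> ('o \<Rightarrow> 'p) \<Rightarrow> ('a \<Rightarrow> 'b) \<Rightarrow> bool"
where
  "right_exact C D Fo Fa \<longleftrightarrow> linear_functor C D Fo Fa \<and>
     (\<forall>f p. is_cokernel C f p \<longrightarrow> is_cokernel D (Fa f) (Fa p))"

definition left_exact ::
  "('o, 'a, 'k, 'y) lincat_scheme \<Rightarrow> ('p, 'b, 'k, 'z) lincat_scheme \<Rightarrow> ('o \<Rightarrow> 'p) \<Rightarrow> ('a \<Rightarrow> 'b) \<Rightarrow> bool"
where
  "left_exact C D Fo Fa \<longleftrightarrow> linear_functor C D Fo Fa \<and>
     (\<forall>f k. is_kernel C f k \<longrightarrow> is_kernel D (Fa f) (Fa k))"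

text \<open>A finite-dimensional algebra is presented, after a choice of basis, on the space of
  \<open>n\<close>-vectors, and a finite-dimensional module on the space of \<open>d\<close>-vectors, with
  \<open>\<rho> a\<close> the matrix by which the algebra element \<open>a\<close> acts. Since a type cannot be quantified
  over, this takes the place of the category of all finite-dimensional modules, of which it is
  an equivalent full subcategory.\<close>

definition fd_algebra ::
  "nat \<Rightarrow> ('k::field vec \<Rightarrow> 'k vec \<Rightarrow> 'k vec) \<Rightarrow> 'k vec \<Rightarrow> bool"
where
  "fd_algebra n mul e \<longleftrightarrow> e \<in> carrier_vec n \<and>
     (\<forall>a\<in>carrier_vec n. \<forall>b\<in>carrier_vec n. mul a b \<in> carrier_vec n) \<and>
     (\<forall>a\<in>carrier_vec n. \<forall>b\<in>carrier_vec n. \<forall>c\<in>carrier_vec n.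
        mul (a + b) c = mul a c + mul b c \<and> mul a (b + c) = mul a b + mul a c \<and>
        mul (mul a b) c = mul a (mul b c)) \<and>
     (\<forall>s. \<forall>a\<in>carrier_vec n. \<forall>b\<in>carrier_vec n.
        mul (s \<cdot>\<^sub>v a) b = s \<cdot>\<^sub>v mul a b \<and> mul a (s \<cdot>\<^sub>v b) = s \<cdot>\<^sub>v mul a b) \<and>
     (\<forall>a\<in>carrier_vec n. mul e a = a \<and> mul a e = a)"

definition fd_module ::
  "nat \<Rightarrow> ('k::field vec \<Rightarrow> 'k vec \<Rightarrow> 'k vec) \<Rightarrow> 'k vec \<Rightarrow> nat \<times> ('k vec \<Rightarrow> 'k mat) \<Rightarrow> bool"
where
  "fd_module n mul e = (\<lambda>(d, \<rho>). \<rho> \<in> carrier_vec n \<rightarrow>\<^sub>E carrier_mat d d \<and>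
     (\<forall>a\<in>carrier_vec n. \<forall>b\<in>carrier_vec n.
        \<rho> (a + b) = \<rho> a + \<rho> b \<and> \<rho> (mul a b) = \<rho> a * \<rho> b) \<and>
     (\<forall>s. \<forall>a\<in>carrier_vec n. \<rho> (s \<cdot>\<^sub>v a) = s \<cdot>\<^sub>m \<rho> a) \<and>
     \<rho> e = 1\<^sub>m d)"

type_synonym 'k fd_mod = "nat \<times> ('k vec \<Rightarrow> 'k mat)"

text \<open>Here and below, arrows of a constructed category carry their domain and codomain.\<close>

definition fd_modules ::
  "nat \<Rightarrow> ('k::field vec \<Rightarrow> 'k vec \<Rightarrow> 'k vec) \<Rightarrow> 'k vec \<Rightarrow>
   ('k fd_mod, 'k fd_mod \<times> 'k mat \<times> 'k fd_mod, 'k) lincat"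
where
  "fd_modules n mul e = \<lparr>
     Obj = {X. fd_module n mul e X},
     Arr = {(X, f, Y). fd_module n mul e X \<and> fd_module n mul e Y \<and>
              f \<in> carrier_mat (fst Y) (fst X) \<and>
              (\<forall>a\<in>carrier_vec n. f * snd X a = snd Y a * f)},
     Dom = (\<lambda>(X, f, Y). X),
     Cod = (\<lambda>(X, f, Y). Y),
     Idn = (\<lambda>X. (X, 1\<^sub>m (fst X), X)),
     Comp = (\<lambda>(Y', g, Z) (X, f, Y). (X, g * f, Z)),
     Plus = (\<lambda>(X, f, Y) (X', g, Y'). (X, f + g, Y)),
     Scal = (\<lambda>s (X, f, Y). (X, s \<cdot>\<^sub>m f, Y)),
     Zero = (\<lambda>X Y. (X, 0\<^sub>m (fst Y) (fst X), Y)) \<rparr>"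

definition finite_linear_category :: "('o, 'a, 'k::field, 'z) lincat_scheme \<Rightarrow> bool" where
  "finite_linear_category C \<longleftrightarrow> linear_category C \<and>
     (\<exists>n mul e. fd_algebra n mul e \<and> equivalent_linear C (fd_modules n mul e))"

section \<open>Finite tensor categories\<close>

text \<open>\<open>\<otimes>\<close> and \<open>\<boxtimes>\<close> are the tensor product on objects and on arrows;
  \<open>Assoc C x y z : (x \<otimes> y) \<otimes> z \<rightarrow> x \<otimes> (y \<otimes> z)\<close>,
  \<open>LUnit C x : 1 \<otimes> x \<rightarrow> x\<close> and \<open>RUnit C x : x \<otimes> 1 \<rightarrow> x\<close>.\<close>

record ('o, 'a, 'k) moncat = "('o, 'a, 'k) lincat" +
  TObj :: "'o \<Rightarrow> 'o \<Rightarrow> 'o"  (infixr \<open>\<otimes>\<index>\<close> 70)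
  TArr :: "'a \<Rightarrow> 'a \<Rightarrow> 'a"  (infixr \<open>\<boxtimes>\<index>\<close> 70)
  Unit :: "'o"
  Assoc :: "'o \<Rightarrow> 'o \<Rightarrow> 'o \<Rightarrow> 'a"
  LUnit :: "'o \<Rightarrow> 'a"
  RUnit :: "'o \<Rightarrow> 'a"

locale linear_monoidal_category = linear_category C
  for C :: "('o, 'a, 'k::field, 'z) moncat_scheme" (structure) +
  assumes TObj_in: "x \<in> Obj C \<Longrightarrow> y \<in> Obj C \<Longrightarrow> x \<otimes> y \<in> Obj C"
    and TArr_in: "f \<in> Hom C x x' \<Longrightarrow> g \<in> Hom C y y' \<Longrightarrow> f \<boxtimes> g \<in> Hom C (x \<otimes> y) (x' \<otimes> y')"
    and TArr_Idn: "x \<in> Obj C \<Longrightarrow> y \<in> Obj C \<Longrightarrow> Idn C x \<boxtimes> Idn C y = Idn C (x \<otimes> y)"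
    and TArr_Comp: "f \<in> Hom C x y \<Longrightarrow> g \<in> Hom C y z \<Longrightarrow> f' \<in> Hom C x' y' \<Longrightarrow> g' \<in> Hom C y' z' \<Longrightarrow>
      (g \<cdot> f) \<boxtimes> (g' \<cdot> f') = (g \<boxtimes> g') \<cdot> (f \<boxtimes> f')"
    and TArr_Plus_left: "f \<in> Hom C x y \<Longrightarrow> g \<in> Hom C x y \<Longrightarrow> h \<in> Hom C x' y' \<Longrightarrow>
      Plus C f g \<boxtimes> h = Plus C (f \<boxtimes> h) (g \<boxtimes> h)"
    and TArr_Plus_right: "f \<in> Hom C x y \<Longrightarrow> g \<in> Hom C x' y' \<Longrightarrow> h \<in> Hom C x' y' \<Longrightarrow>
      f \<boxtimes> Plus C g h = Plus C (f \<boxtimes> g) (f \<boxtimes> h)"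
    and TArr_Scal_left: "f \<in> Arr C \<Longrightarrow> g \<in> Arr C \<Longrightarrow> Scal C a f \<boxtimes> g = Scal C a (f \<boxtimes> g)"
    and TArr_Scal_right: "f \<in> Arr C \<Longrightarrow> g \<in> Arr C \<Longrightarrow> f \<boxtimes> Scal C a g = Scal C a (f \<boxtimes> g)"
    and Unit_in: "Unit C \<in> Obj C"
    and Assoc_in: "x \<in> Obj C \<Longrightarrow> y \<in> Obj C \<Longrightarrow> z \<in> Obj C \<Longrightarrow>
      Assoc C x y z \<in> Hom C ((x \<otimes> y) \<otimes> z) (x \<otimes> (y \<otimes> z))"
    and Assoc_iso: "x \<in> Obj C \<Longrightarrow> y \<in> Obj C \<Longrightarrow> z \<in> Obj C \<Longrightarrow> is_iso C (Assoc C x y z)"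
    and Assoc_nat: "f \<in> Hom C x x' \<Longrightarrow> g \<in> Hom C y y' \<Longrightarrow> h \<in> Hom C z z' \<Longrightarrow>
      Assoc C x' y' z' \<cdot> ((f \<boxtimes> g) \<boxtimes> h) = (f \<boxtimes> (g \<boxtimes> h)) \<cdot> Assoc C x y z"
    and LUnit_in: "x \<in> Obj C \<Longrightarrow> LUnit C x \<in> Hom C (Unit C \<otimes> x) x"
    and LUnit_iso: "x \<in> Obj C \<Longrightarrow> is_iso C (LUnit C x)"
    and LUnit_nat: "f \<in> Hom C x y \<Longrightarrow> LUnit C y \<cdot> (Idn C (Unit C) \<boxtimes> f) = f \<cdot> LUnit C x"
    and RUnit_in: "x \<in> Obj C \<Longrightarrow> RUnit C x \<in> Hom C (x \<otimes> Unit C) x"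
    and RUnit_iso: "x \<in> Obj C \<Longrightarrow> is_iso C (RUnit C x)"
    and RUnit_nat: "f \<in> Hom C x y \<Longrightarrow> RUnit C y \<cdot> (f \<boxtimes> Idn C (Unit C)) = f \<cdot> RUnit C x"
    and pentagon: "w \<in> Obj C \<Longrightarrow> x \<in> Obj C \<Longrightarrow> y \<in> Obj C \<Longrightarrow> z \<in> Obj C \<Longrightarrow>
      (Idn C w \<boxtimes> Assoc C x y z) \<cdot> Assoc C w (x \<otimes> y) z \<cdot> (Assoc C w x y \<boxtimes> Idn C z) =
      Assoc C w x (y \<otimes> z) \<cdot> Assoc C (w \<otimes> x) y z"
    and triangle: "x \<in> Obj C \<Longrightarrow> y \<in> Obj C \<Longrightarrow>
      (Idn C x \<boxtimes> LUnit C y) \<cdot> Assoc C x (Unit C) y = RUnit C x \<boxtimes> Idn C y"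

definition is_dual_pair :: "('o, 'a, 'k, 'z) moncat_scheme \<Rightarrow> 'o \<Rightarrow> 'o \<Rightarrow> bool" where
  "is_dual_pair C d x \<longleftrightarrow> d \<in> Obj C \<and> x \<in> Obj C \<and>
     (\<exists>ev\<in>Hom C (d \<otimes>\<^bsub>C\<^esub> x) (Unit C). \<exists>coev\<in>Hom C (Unit C) (x \<otimes>\<^bsub>C\<^esub> d).
        RUnit C x \<cdot>\<^bsub>C\<^esub> (Idn C x \<boxtimes>\<^bsub>C\<^esub> ev) \<cdot>\<^bsub>C\<^esub> Assoc C x d x \<cdot>\<^bsub>C\<^esub> (coev \<boxtimes>\<^bsub>C\<^esub> Idn C x) = LUnit C x \<and>
        LUnit C d \<cdot>\<^bsub>C\<^esub> (ev \<boxtimes>\<^bsub>C\<^esub> Idn C d) \<cdot>\<^bsub>C\<^esub> inv_arr C (Assoc C d x d) \<cdot>\<^bsub>C\<^esub> (Idn C d \<boxtimes>\<^bsub>C\<^esub> coev)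
          = RUnit C d)"

locale finite_tensor_category = linear_monoidal_category C
  for C :: "('o, 'a, 'k::field, 'z) moncat_scheme" (structure) +
  assumes finite_category: "finite_linear_category C"
    and rigid: "x \<in> Obj C \<Longrightarrow> (\<exists>d. is_dual_pair C d x) \<and> (\<exists>d. is_dual_pair C x d)"
    and simple_unit: "is_simple C (Unit C)"

section \<open>Module categories\<close>

text \<open>\<open>\<rhd>\<close> and \<open>\<unrhd>\<close> are the action on objects and on arrows;
  \<open>MAssoc M c d m : (c \<otimes> d) \<rhd> m \<rightarrow> c \<rhd> (d \<rhd> m)\<close> and \<open>MUnit M m : 1 \<rhd> m \<rightarrow> m\<close>.\<close>

record ('p, 'b, 'k, 'o, 'a) actcat = "('p, 'b, 'k) lincat" +
  AObj :: "'o \<Rightarrow> 'p \<Rightarrow> 'p"  (infixr \<open>\<rhd>\<index>\<close> 68)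
  AArr :: "'a \<Rightarrow> 'b \<Rightarrow> 'b"  (infixr \<open>\<unrhd>\<index>\<close> 68)
  MAssoc :: "'o \<Rightarrow> 'o \<Rightarrow> 'p \<Rightarrow> 'b"
  MUnit :: "'p \<Rightarrow> 'b"

locale module_category = C: linear_monoidal_category C + M: linear_category M
  for C :: "('o, 'a, 'k::field, 'z) moncat_scheme" (structure)
    and M :: "('p, 'b, 'k, 'o, 'a, 'y) actcat_scheme" (structure) +
  assumes AObj_in: "c \<in> Obj C \<Longrightarrow> m \<in> Obj M \<Longrightarrow> c \<rhd>\<^bsub>M\<^esub> m \<in> Obj M"
    and AArr_in: "f \<in> Hom C c c' \<Longrightarrow> u \<in> Hom M m m' \<Longrightarrow> f \<unrhd>\<^bsub>M\<^esub> u \<in> Hom M (c \<rhd>\<^bsub>M\<^esub> m) (c' \<rhd>\<^bsub>M\<^esub> m')"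
    and AArr_Idn: "c \<in> Obj C \<Longrightarrow> m \<in> Obj M \<Longrightarrow> Idn C c \<unrhd>\<^bsub>M\<^esub> Idn M m = Idn M (c \<rhd>\<^bsub>M\<^esub> m)"
    and AArr_Comp: "f \<in> Hom C c d \<Longrightarrow> g \<in> Hom C d e \<Longrightarrow> u \<in> Hom M m n \<Longrightarrow> v \<in> Hom M n p \<Longrightarrow>
      (g \<cdot>\<^bsub>C\<^esub> f) \<unrhd>\<^bsub>M\<^esub> (v \<cdot>\<^bsub>M\<^esub> u) = (g \<unrhd>\<^bsub>M\<^esub> v) \<cdot>\<^bsub>M\<^esub> (f \<unrhd>\<^bsub>M\<^esub> u)"
    and AArr_Plus_left: "f \<in> Hom C c d \<Longrightarrow> g \<in> Hom C c d \<Longrightarrow> u \<in> Hom M m n \<Longrightarrow>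
      Plus C f g \<unrhd>\<^bsub>M\<^esub> u = Plus M (f \<unrhd>\<^bsub>M\<^esub> u) (g \<unrhd>\<^bsub>M\<^esub> u)"
    and AArr_Plus_right: "f \<in> Hom C c d \<Longrightarrow> u \<in> Hom M m n \<Longrightarrow> v \<in> Hom M m n \<Longrightarrow>
      f \<unrhd>\<^bsub>M\<^esub> Plus M u v = Plus M (f \<unrhd>\<^bsub>M\<^esub> u) (f \<unrhd>\<^bsub>M\<^esub> v)"
    and AArr_Scal_left: "f \<in> Arr C \<Longrightarrow> u \<in> Arr M \<Longrightarrow> Scal C a f \<unrhd>\<^bsub>M\<^esub> u = Scal M a (f \<unrhd>\<^bsub>M\<^esub> u)"
    and AArr_Scal_right: "f \<in> Arr C \<Longrightarrow> u \<in> Arr M \<Longrightarrow> f \<unrhd>\<^bsub>M\<^esub> Scal M a u = Scal M a (f \<unrhd>\<^bsub>M\<^esub> u)"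
    and MAssoc_in: "c \<in> Obj C \<Longrightarrow> d \<in> Obj C \<Longrightarrow> m \<in> Obj M \<Longrightarrow>
      MAssoc M c d m \<in> Hom M ((c \<otimes>\<^bsub>C\<^esub> d) \<rhd>\<^bsub>M\<^esub> m) (c \<rhd>\<^bsub>M\<^esub> (d \<rhd>\<^bsub>M\<^esub> m))"
    and MAssoc_iso: "c \<in> Obj C \<Longrightarrow> d \<in> Obj C \<Longrightarrow> m \<in> Obj M \<Longrightarrow> is_iso M (MAssoc M c d m)"
    and MAssoc_nat: "f \<in> Hom C c c' \<Longrightarrow> g \<in> Hom C d d' \<Longrightarrow> u \<in> Hom M m m' \<Longrightarrow>
      MAssoc M c' d' m' \<cdot>\<^bsub>M\<^esub> ((f \<boxtimes>\<^bsub>C\<^esub> g) \<unrhd>\<^bsub>M\<^esub> u) = (f \<unrhd>\<^bsub>M\<^esub> (g \<unrhd>\<^bsub>M\<^esub> u)) \<cdot>\<^bsub>M\<^esub> MAssoc M c d m"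
    and MUnit_in: "m \<in> Obj M \<Longrightarrow> MUnit M m \<in> Hom M (Unit C \<rhd>\<^bsub>M\<^esub> m) m"
    and MUnit_iso: "m \<in> Obj M \<Longrightarrow> is_iso M (MUnit M m)"
    and MUnit_nat: "u \<in> Hom M m n \<Longrightarrow>
      MUnit M n \<cdot>\<^bsub>M\<^esub> (Idn C (Unit C) \<unrhd>\<^bsub>M\<^esub> u) = u \<cdot>\<^bsub>M\<^esub> MUnit M m"
    and module_pentagon: "b \<in> Obj C \<Longrightarrow> c \<in> Obj C \<Longrightarrow> d \<in> Obj C \<Longrightarrow> m \<in> Obj M \<Longrightarrow>
      (Idn C b \<unrhd>\<^bsub>M\<^esub> MAssoc M c d m) \<cdot>\<^bsub>M\<^esub> MAssoc M b (c \<otimes>\<^bsub>C\<^esub> d) m \<cdot>\<^bsub>M\<^esub> (Assoc C b c d \<unrhd>\<^bsub>M\<^esub> Idn M m) =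
      MAssoc M b c (d \<rhd>\<^bsub>M\<^esub> m) \<cdot>\<^bsub>M\<^esub> MAssoc M (b \<otimes>\<^bsub>C\<^esub> c) d m"
    and module_triangle: "c \<in> Obj C \<Longrightarrow> m \<in> Obj M \<Longrightarrow>
      (Idn C c \<unrhd>\<^bsub>M\<^esub> MUnit M m) \<cdot>\<^bsub>M\<^esub> MAssoc M c (Unit C) m = RUnit C c \<unrhd>\<^bsub>M\<^esub> Idn M m"

locale finite_module_category = module_category C M
  for C :: "('o, 'a, 'k::field, 'z) moncat_scheme" (structure)
    and M :: "('p, 'b, 'k, 'o, 'a, 'y) actcat_scheme" (structure) +
  assumes finite_category: "finite_linear_category M"
    and left_exact_fst: "m \<in> Obj M \<Longrightarrow>
      left_exact C M (\<lambda>c. c \<rhd>\<^bsub>M\<^esub> m) (\<lambda>f. f \<unrhd>\<^bsub>M\<^esub> Idn M m)"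
    and right_exact_fst: "m \<in> Obj M \<Longrightarrow>
      right_exact C M (\<lambda>c. c \<rhd>\<^bsub>M\<^esub> m) (\<lambda>f. f \<unrhd>\<^bsub>M\<^esub> Idn M m)"
    and right_exact_snd: "c \<in> Obj C \<Longrightarrow>
      right_exact M M (\<lambda>m. c \<rhd>\<^bsub>M\<^esub> m) (\<lambda>g. Idn C c \<unrhd>\<^bsub>M\<^esub> g)"

section \<open>The Drinfeld center\<close>

text \<open>Half-braidings are taken extensional on the objects, so that distinct functions are
  distinct half-braidings. Invertibility is required explicitly. The two coherence conditions are those of the strict case with
  associators and unitors restored.\<close>

definition half_braiding :: "('o, 'a, 'k, 'z) moncat_scheme \<Rightarrow> 'o \<Rightarrow> ('o \<Rightarrow> 'a) \<Rightarrow> bool" where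
  "half_braiding C z \<sigma> \<longleftrightarrow> \<sigma> \<in> extensional (Obj C) \<and>
     (\<forall>c\<in>Obj C. \<sigma> c \<in> Hom C (c \<otimes>\<^bsub>C\<^esub> z) (z \<otimes>\<^bsub>C\<^esub> c) \<and> is_iso C (\<sigma> c)) \<and>
     (\<forall>c d. \<forall>f\<in>Hom C c d. \<sigma> d \<cdot>\<^bsub>C\<^esub> (f \<boxtimes>\<^bsub>C\<^esub> Idn C z) = (Idn C z \<boxtimes>\<^bsub>C\<^esub> f) \<cdot>\<^bsub>C\<^esub> \<sigma> c) \<and>
     (\<forall>c\<in>Obj C. \<forall>d\<in>Obj C. \<sigma> (c \<otimes>\<^bsub>C\<^esub> d) =
        Assoc C z c d \<cdot>\<^bsub>C\<^esub> (\<sigma> c \<boxtimes>\<^bsub>C\<^esub> Idn C d) \<cdot>\<^bsub>C\<^esub> inv_arr C (Assoc C c z d) \<cdot>\<^bsub>C\<^esub>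
        (Idn C c \<boxtimes>\<^bsub>C\<^esub> \<sigma> d) \<cdot>\<^bsub>C\<^esub> Assoc C c d z) \<and>
     RUnit C z \<cdot>\<^bsub>C\<^esub> \<sigma> (Unit C) = LUnit C z"

type_synonym ('o, 'a) cobj = "'o \<times> ('o \<Rightarrow> 'a)"
type_synonym ('o, 'a) carr = "('o, 'a) cobj \<times> 'a \<times> ('o, 'a) cobj"

definition center_obj :: "('o, 'a, 'k, 'z) moncat_scheme \<Rightarrow> ('o, 'a) cobj set" where
  "center_obj C = {(z, \<sigma>). z \<in> Obj C \<and> half_braiding C z \<sigma>}"

definition center_arr :: "('o, 'a, 'k, 'z) moncat_scheme \<Rightarrow> ('o, 'a) carr set" where
  "center_arr C = {(x, f, y). x \<in> center_obj C \<and> y \<in> center_obj C \<and> f \<in> Hom C (fst x) (fst y) \<and>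
     (\<forall>c\<in>Obj C. (f \<boxtimes>\<^bsub>C\<^esub> Idn C c) \<cdot>\<^bsub>C\<^esub> snd x c = snd y c \<cdot>\<^bsub>C\<^esub> (Idn C c \<boxtimes>\<^bsub>C\<^esub> f))}"

text \<open>The half-braiding of \<open>(x, \<sigma>) \<otimes> (y, \<tau>)\<close> at \<open>c\<close> is \<open>(id \<otimes> \<tau> c) \<circ> (\<sigma> c \<otimes> id)\<close> up to
  associators. This is the order for which both the braiding \<open>\<tau> x : x \<otimes> y \<rightarrow> y \<otimes> x\<close> and the
  associativity constraint of the action on module functors below are morphisms.\<close>

definition center_tensor ::
  "('o, 'a, 'k, 'z) moncat_scheme \<Rightarrow> ('o, 'a) cobj \<Rightarrow> ('o, 'a) cobj \<Rightarrow> ('o, 'a) cobj"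
where
  "center_tensor C = (\<lambda>(x, \<sigma>) (y, \<tau>). (x \<otimes>\<^bsub>C\<^esub> y, \<lambda>c\<in>Obj C.
     inv_arr C (Assoc C x y c) \<cdot>\<^bsub>C\<^esub> (Idn C x \<boxtimes>\<^bsub>C\<^esub> \<tau> c) \<cdot>\<^bsub>C\<^esub> Assoc C x c y \<cdot>\<^bsub>C\<^esub>
     (\<sigma> c \<boxtimes>\<^bsub>C\<^esub> Idn C y) \<cdot>\<^bsub>C\<^esub> inv_arr C (Assoc C c x y)))"

definition center_unit :: "('o, 'a, 'k, 'z) moncat_scheme \<Rightarrow> ('o, 'a) cobj" where
  "center_unit C = (Unit C, \<lambda>c\<in>Obj C. inv_arr C (LUnit C c) \<cdot>\<^bsub>C\<^esub> RUnit C c)"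

record ('o, 'a, 'k) brcat = "('o, 'a, 'k) moncat" +
  Braid :: "'o \<Rightarrow> 'o \<Rightarrow> 'a"

definition center ::
  "('o, 'a, 'k, 'z) moncat_scheme \<Rightarrow> (('o, 'a) cobj, ('o, 'a) carr, 'k) brcat"
where
  "center C = \<lparr>
     Obj = center_obj C,
     Arr = center_arr C,
     Dom = (\<lambda>(x, f, y). x),
     Cod = (\<lambda>(x, f, y). y),
     Idn = (\<lambda>x. (x, Idn C (fst x), x)),
     Comp = (\<lambda>(y', g, z) (x, f, y). (x, g \<cdot>\<^bsub>C\<^esub> f, z)),
     Plus = (\<lambda>(x, f, y) (x', g, y'). (x, Plus C f g, y)),
     Scal = (\<lambda>a (x, f, y). (x, Scal C a f, y)),
     Zero = (\<lambda>x y. (x, Zero C (fst x) (fst y), y)),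
     TObj = center_tensor C,
     TArr = (\<lambda>(x, f, y) (x', g, y'). (center_tensor C x x', f \<boxtimes>\<^bsub>C\<^esub> g, center_tensor C y y')),
     Unit = center_unit C,
     Assoc = (\<lambda>x y z. (center_tensor C (center_tensor C x y) z,
       Assoc C (fst x) (fst y) (fst z), center_tensor C x (center_tensor C y z))),
     LUnit = (\<lambda>x. (center_tensor C (center_unit C) x, LUnit C (fst x), x)),
     RUnit = (\<lambda>x. (center_tensor C x (center_unit C), RUnit C (fst x), x)),
     Braid = (\<lambda>x y. (center_tensor C x y, snd y (fst x), center_tensor C y x)) \<rparr>"

section \<open>Right exact module endofunctors\<close>

text \<open>\<open>MConstr F (c, m) : F (c \<rhd> m) \<rightarrow> c \<rhd> F m\<close>. All components of a functor and all
  families of arrows are taken extensional.\<close>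

record ('p, 'b, 'o) modfun =
  FObj :: "'p \<Rightarrow> 'p"
  FArr :: "'b \<Rightarrow> 'b"
  MConstr :: "'o \<times> 'p \<Rightarrow> 'b"

definition module_endofunctor ::
  "('o, 'a, 'k, 'z) moncat_scheme \<Rightarrow> ('p, 'b, 'k, 'o, 'a, 'y) actcat_scheme \<Rightarrow>
   ('p, 'b, 'o) modfun \<Rightarrow> bool"
where
  "module_endofunctor C M F \<longleftrightarrow>
     FObj F \<in> extensional (Obj M) \<and> FArr F \<in> extensional (Arr M) \<and>
     MConstr F \<in> extensional (Obj C \<times> Obj M) \<and>
     linear_functor M M (FObj F) (FArr F) \<and>
     (\<forall>c\<in>Obj C. \<forall>m\<in>Obj M. MConstr F (c, m) \<in> Hom M (FObj F (c \<rhd>\<^bsub>M\<^esub> m)) (c \<rhd>\<^bsub>M\<^esub> FObj F m) \<and>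
        is_iso M (MConstr F (c, m))) \<and>
     (\<forall>c c' m m'. \<forall>f\<in>Hom C c c'. \<forall>g\<in>Hom M m m'.
        MConstr F (c', m') \<cdot>\<^bsub>M\<^esub> FArr F (f \<unrhd>\<^bsub>M\<^esub> g) = (f \<unrhd>\<^bsub>M\<^esub> FArr F g) \<cdot>\<^bsub>M\<^esub> MConstr F (c, m)) \<and>
     (\<forall>c\<in>Obj C. \<forall>d\<in>Obj C. \<forall>m\<in>Obj M.
        MAssoc M c d (FObj F m) \<cdot>\<^bsub>M\<^esub> MConstr F (c \<otimes>\<^bsub>C\<^esub> d, m) =
        (Idn C c \<unrhd>\<^bsub>M\<^esub> MConstr F (d, m)) \<cdot>\<^bsub>M\<^esub> MConstr F (c, d \<rhd>\<^bsub>M\<^esub> m) \<cdot>\<^bsub>M\<^esub> FArr F (MAssoc M c d m)) \<and>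
     (\<forall>m\<in>Obj M. MUnit M (FObj F m) \<cdot>\<^bsub>M\<^esub> MConstr F (Unit C, m) = FArr F (MUnit M m))"

definition module_nat ::
  "('o, 'a, 'k, 'z) moncat_scheme \<Rightarrow> ('p, 'b, 'k, 'o, 'a, 'y) actcat_scheme \<Rightarrow>
   ('p, 'b, 'o) modfun \<Rightarrow> ('p, 'b, 'o) modfun \<Rightarrow> ('p \<Rightarrow> 'b) \<Rightarrow> bool"
where
  "module_nat C M F G \<eta> \<longleftrightarrow> \<eta> \<in> extensional (Obj M) \<and>
     (\<forall>m\<in>Obj M. \<eta> m \<in> Hom M (FObj F m) (FObj G m)) \<and>
     (\<forall>m m'. \<forall>g\<in>Hom M m m'. \<eta> m' \<cdot>\<^bsub>M\<^esub> FArr F g = FArr G g \<cdot>\<^bsub>M\<^esub> \<eta> m) \<and>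
     (\<forall>c\<in>Obj C. \<forall>m\<in>Obj M.
        (Idn C c \<unrhd>\<^bsub>M\<^esub> \<eta> m) \<cdot>\<^bsub>M\<^esub> MConstr F (c, m) = MConstr G (c, m) \<cdot>\<^bsub>M\<^esub> \<eta> (c \<rhd>\<^bsub>M\<^esub> m))"

definition id_modfun ::
  "('o, 'a, 'k, 'z) moncat_scheme \<Rightarrow> ('p, 'b, 'k, 'o, 'a, 'y) actcat_scheme \<Rightarrow> ('p, 'b, 'o) modfun"
where
  "id_modfun C M = \<lparr>
     FObj = (\<lambda>m\<in>Obj M. m),
     FArr = (\<lambda>g\<in>Arr M. g),
     MConstr = (\<lambda>(c, m)\<in>Obj C \<times> Obj M. Idn M (c \<rhd>\<^bsub>M\<^esub> m)) \<rparr>"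

text \<open>The constraint is
  \<open>z \<rhd> F (c \<rhd> m) \<rightarrow> z \<rhd> (c \<rhd> F m) \<rightarrow> (z \<otimes> c) \<rhd> F m \<rightarrow> (c \<otimes> z) \<rhd> F m \<rightarrow> c \<rhd> (z \<rhd> F m)\<close>,
  with the inverse of \<open>\<sigma> c\<close> in the third step.\<close>

definition act_modfun ::
  "('o, 'a, 'k, 'z) moncat_scheme \<Rightarrow> ('p, 'b, 'k, 'o, 'a, 'y) actcat_scheme \<Rightarrow>
   ('o, 'a) cobj \<Rightarrow> ('p, 'b, 'o) modfun \<Rightarrow> ('p, 'b, 'o) modfun"
where
  "act_modfun C M = (\<lambda>(z, \<sigma>) F. \<lparr>
     FObj = (\<lambda>m\<in>Obj M. z \<rhd>\<^bsub>M\<^esub> FObj F m),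
     FArr = (\<lambda>g\<in>Arr M. Idn C z \<unrhd>\<^bsub>M\<^esub> FArr F g),
     MConstr = (\<lambda>(c, m)\<in>Obj C \<times> Obj M.
       MAssoc M c z (FObj F m) \<cdot>\<^bsub>M\<^esub> (inv_arr C (\<sigma> c) \<unrhd>\<^bsub>M\<^esub> Idn M (FObj F m)) \<cdot>\<^bsub>M\<^esub>
       inv_arr M (MAssoc M z c (FObj F m)) \<cdot>\<^bsub>M\<^esub> (Idn C z \<unrhd>\<^bsub>M\<^esub> MConstr F (c, m))) \<rparr>)"

type_synonym ('p, 'b, 'o) marr = "('p, 'b, 'o) modfun \<times> ('p \<Rightarrow> 'b) \<times> ('p, 'b, 'o) modfun"

definition rex_obj ::
  "('o, 'a, 'k, 'z) moncat_scheme \<Rightarrow> ('p, 'b, 'k, 'o, 'a, 'y) actcat_scheme \<Rightarrow>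
   ('p, 'b, 'o) modfun set"
where
  "rex_obj C M = {F. module_endofunctor C M F \<and> right_exact M M (FObj F) (FArr F)}"

text \<open>The category of right exact module endofunctors, with its action of the Drinfeld center.\<close>

definition Rex ::
  "('o, 'a, 'k, 'z) moncat_scheme \<Rightarrow> ('p, 'b, 'k, 'o, 'a, 'y) actcat_scheme \<Rightarrow>
   (('p, 'b, 'o) modfun, ('p, 'b, 'o) marr, 'k, ('o, 'a) cobj, ('o, 'a) carr) actcat"
where
  "Rex C M = \<lparr>
     Obj = rex_obj C M,
     Arr = {(F, \<eta>, G). F \<in> rex_obj C M \<and> G \<in> rex_obj C M \<and> module_nat C M F G \<eta>},
     Dom = (\<lambda>(F, \<eta>, G). F),
     Cod = (\<lambda>(F, \<eta>, G). G),
     Idn = (\<lambda>F. (F, \<lambda>m\<in>Obj M. Idn M (FObj F m), F)),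
     Comp = (\<lambda>(G', \<theta>, H) (F, \<eta>, G). (F, \<lambda>m\<in>Obj M. \<theta> m \<cdot>\<^bsub>M\<^esub> \<eta> m, H)),
     Plus = (\<lambda>(F, \<eta>, G) (F', \<theta>, G'). (F, \<lambda>m\<in>Obj M. Plus M (\<eta> m) (\<theta> m), G)),
     Scal = (\<lambda>a (F, \<eta>, G). (F, \<lambda>m\<in>Obj M. Scal M a (\<eta> m), G)),
     Zero = (\<lambda>F G. (F, \<lambda>m\<in>Obj M. Zero M (FObj F m) (FObj G m), G)),
     AObj = act_modfun C M,
     AArr = (\<lambda>(x, f, y) (F, \<eta>, G).
       (act_modfun C M x F, \<lambda>m\<in>Obj M. f \<unrhd>\<^bsub>M\<^esub> \<eta> m, act_modfun C M y G)),
     MAssoc = (\<lambda>x y F. (act_modfun C M (center_tensor C x y) F,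
       \<lambda>m\<in>Obj M. MAssoc M (fst x) (fst y) (FObj F m),
       act_modfun C M x (act_modfun C M y F))),
     MUnit = (\<lambda>F. (act_modfun C M (center_unit C) F, \<lambda>m\<in>Obj M. MUnit M (FObj F m), F)) \<rparr>"

section \<open>Internal Homs and algebras\<close>

text \<open>\<open>\<Phi> z\<close> is the bijection from \<open>Hom(z, h)\<close> to \<open>Hom(z \<rhd> m, n)\<close>. Naturality in \<open>z\<close> already
  forces it to be linear.\<close>

definition is_internal_hom ::
  "('o, 'a, 'k, 'z) moncat_scheme \<Rightarrow> ('p, 'b, 'k, 'o, 'a, 'y) actcat_scheme \<Rightarrow> 'p \<Rightarrow> 'p \<Rightarrow>
   'o \<Rightarrow> ('o \<Rightarrow> 'a \<Rightarrow> 'b) \<Rightarrow> bool"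
where
  "is_internal_hom Z R m n h \<Phi> \<longleftrightarrow> h \<in> Obj Z \<and>
     (\<forall>z\<in>Obj Z. bij_betw (\<Phi> z) (Hom Z z h) (Hom R (z \<rhd>\<^bsub>R\<^esub> m) n)) \<and>
     (\<forall>x y. \<forall>f\<in>Hom Z x y. \<forall>g\<in>Hom Z y h. \<Phi> x (g \<cdot>\<^bsub>Z\<^esub> f) = \<Phi> y g \<cdot>\<^bsub>R\<^esub> (f \<unrhd>\<^bsub>R\<^esub> Idn R m))"

definition internal_ev ::
  "('o, 'a, 'k, 'z) moncat_scheme \<Rightarrow> 'o \<Rightarrow> ('o \<Rightarrow> 'a \<Rightarrow> 'b) \<Rightarrow> 'b"
where
  "internal_ev Z h \<Phi> = \<Phi> h (Idn Z h)"

definition internal_mult ::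
  "('o, 'a, 'k, 'z) moncat_scheme \<Rightarrow> ('p, 'b, 'k, 'o, 'a, 'y) actcat_scheme \<Rightarrow> 'p \<Rightarrow>
   'o \<Rightarrow> ('o \<Rightarrow> 'a \<Rightarrow> 'b) \<Rightarrow> 'a"
where
  "internal_mult Z R m A \<Phi> = inv_into (Hom Z (A \<otimes>\<^bsub>Z\<^esub> A) A) (\<Phi> (A \<otimes>\<^bsub>Z\<^esub> A))
     (internal_ev Z A \<Phi> \<cdot>\<^bsub>R\<^esub> (Idn Z A \<unrhd>\<^bsub>R\<^esub> internal_ev Z A \<Phi>) \<cdot>\<^bsub>R\<^esub> MAssoc R A A m)"

definition internal_unit ::
  "('o, 'a, 'k, 'z) moncat_scheme \<Rightarrow> ('p, 'b, 'k, 'o, 'a, 'y) actcat_scheme \<Rightarrow> 'p \<Rightarrow>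
   'o \<Rightarrow> ('o \<Rightarrow> 'a \<Rightarrow> 'b) \<Rightarrow> 'a"
where
  "internal_unit Z R m A \<Phi> = inv_into (Hom Z (Unit Z) A) (\<Phi> (Unit Z)) (MUnit R m)"

definition is_algebra :: "('o, 'a, 'k, 'z) moncat_scheme \<Rightarrow> 'o \<Rightarrow> 'a \<Rightarrow> 'a \<Rightarrow> bool" where
  "is_algebra Z A \<mu> \<eta> \<longleftrightarrow> A \<in> Obj Z \<and>
     \<mu> \<in> Hom Z (A \<otimes>\<^bsub>Z\<^esub> A) A \<and> \<eta> \<in> Hom Z (Unit Z) A \<and>
     \<mu> \<cdot>\<^bsub>Z\<^esub> (\<mu> \<boxtimes>\<^bsub>Z\<^esub> Idn Z A) = \<mu> \<cdot>\<^bsub>Z\<^esub> (Idn Z A \<boxtimes>\<^bsub>Z\<^esub> \<mu>) \<cdot>\<^bsub>Z\<^esub> Assoc Z A A A \<and>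
     \<mu> \<cdot>\<^bsub>Z\<^esub> (\<eta> \<boxtimes>\<^bsub>Z\<^esub> Idn Z A) = LUnit Z A \<and>
     \<mu> \<cdot>\<^bsub>Z\<^esub> (Idn Z A \<boxtimes>\<^bsub>Z\<^esub> \<eta>) = RUnit Z A"

definition braided_commutative_algebra ::
  "('o, 'a, 'k, 'z) brcat_scheme \<Rightarrow> 'o \<Rightarrow> 'a \<Rightarrow> 'a \<Rightarrow> bool"
where
  "braided_commutative_algebra Z A \<mu> \<eta> \<longleftrightarrow> is_algebra Z A \<mu> \<eta> \<and> \<mu> \<cdot>\<^bsub>Z\<^esub> Braid Z A A = \<mu>"

end

theory Submission
  imports Defs
begin

text \<open>A half-braiding on \<open>Z\<close> amounts to isomorphisms \<open>c \<rhd> Z \<rhd> m \<rightarrow> Z \<rhd> c \<rhd> m\<close> in every module category,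
  and identities in the center can be tested on the regular module, since tensoring with the unit
  is faithful. The evaluation \<open>e : A \<rhd> Id \<rightarrow> Id\<close> is a module transformation, so \<open>e (A \<rhd> m)\<close> and
  \<open>A \<rhd> e m\<close> differ by the half-braiding of \<open>A\<close>. Naturality of \<open>e\<close> with respect to \<open>e m\<close> equates
  them after composition with \<open>e m\<close>. Hence both multiplications \<open>\<mu>\<close> and \<open>\<mu> \<circ> \<beta>\<close> correspond to the
  transformation \<open>e \<circ> (A \<rhd> e)\<close>.\<close>

subsection \<open>Calculating with arrows\<close>

text \<open>Braided commutativity includes the algebra axioms, which make sense only once the center
  is known to be a monoidal category acting on right exact module endofunctors. Neither fact is part
  of the definitions, so both are established here, with all associators and unitors present. The
  half-braiding of a tensor product is a composite of five arrows, and diagram chases with it would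
  be dominated by pentagons. Acting on a module category avoids this:
  \<open>c \<rhd> d \<rhd> m\<close> needs no brackets, and associators of \<open>C\<close> are
  absorbed by the module pentagon. The same calculations serve twice: with the regular module they
  give the monoidal structure of the center, with \<open>M\<close> they give its action on module
  functors. The algebra structure is a general fact about internal endomorphisms in a module
  category, because arrows into an internal Hom are determined by their composite with the
  evaluation; it is applied to the center acting on \<open>Rex C M\<close>.\<close>

lemma in_Hom: "f \<in> Hom C x y \<longleftrightarrow> f \<in> Arr C \<and> Dom C f = x \<and> Cod C f = y"
  by (simp add: Hom_def)

context linear_category
begin

declare Dom_in [simp] Cod_in [simp]

text \<open>Membership in \<open>Hom\<close> is split into \<open>Arr\<close>, \<open>Dom\<close>
  and \<open>Cod\<close>, because then the endpoints of a composite are computed by rewriting and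
  composability is checked without guessing intermediate objects.\<close>

lemma Idn_arr [simp]:
  assumes "x \<in> Obj C"
  shows "Idn C x \<in> Arr C" "Dom C (Idn C x) = x" "Cod C (Idn C x) = x"
  using Idn_in[OF assms] by (simp_all add: in_Hom)

lemma Comp_arr [simp]:
  assumes "f \<in> Arr C" "g \<in> Arr C" "Cod C f = Dom C g"
  shows "g \<cdot> f \<in> Arr C" "Dom C (g \<cdot> f) = Dom C f" "Cod C (g \<cdot> f) = Cod C g"
  using Comp_in[of f "Dom C f" "Cod C f" g "Cod C g"] assms by (simp_all add: in_Hom)

lemma Comp_assoc_arr [simp]:
  "f \<in> Arr C \<Longrightarrow> g \<in> Arr C \<Longrightarrow> h \<in> Arr C \<Longrightarrow> Cod C f = Dom C g \<Longrightarrow> Cod C g = Dom C h \<Longrightarrow>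
    (h \<cdot> g) \<cdot> f = h \<cdot> (g \<cdot> f)"
  by (rule Comp_assoc) (auto simp: in_Hom)

lemma Comp_Idn [simp]:
  "f \<in> Arr C \<Longrightarrow> Cod C f = x \<Longrightarrow> Idn C x \<cdot> f = f"
  "f \<in> Arr C \<Longrightarrow> Dom C f = x \<Longrightarrow> f \<cdot> Idn C x = f"
  by (auto intro: Idn_left Idn_right simp: in_Hom)

text \<open>Composites are normalised to right-nested form, which hides a factor
  \<open>g \<cdot> f\<close> whenever a further arrow stands to its right. This form lets an
  equation for \<open>g \<cdot> f\<close> be applied there.\<close>

lemma Comp_reassoc:
  assumes "g \<cdot> f = r" "f \<in> Arr C" "g \<in> Arr C" "Cod C f = Dom C g" "q \<in> Arr C" "Cod C q = Dom C f"
  shows "g \<cdot> (f \<cdot> q) = r \<cdot> q"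
  using Comp_assoc_arr[of q f g] assms by simp

text \<open>\<open>inv_arr\<close> is a definite description, so it denotes an inverse only because
  inverses are unique.\<close>

lemma is_inverse_inv_arr:
  assumes "is_iso C f"
  shows "is_inverse C f (inv_arr C f)"
proof -
  have f: "f \<in> Arr C" and "\<exists>g. is_inverse C f g"
    using assms by (auto simp: is_iso_def)
  moreover have "g = h" if "is_inverse C f g" "is_inverse C f h" for g h
  proof -
    have "g = g \<cdot> (f \<cdot> h)"
      using f that by (simp add: is_inverse_def in_Hom)
    also have "\<dots> = (g \<cdot> f) \<cdot> h"
      using f that by (intro Comp_assoc_arr[symmetric]) (simp_all add: is_inverse_def in_Hom)
    also have "\<dots> = h"
      using f that by (simp add: is_inverse_def in_Hom)
    finally show ?thesis .
  qed
  ultimately show ?thesis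
    unfolding inv_arr_def by (metis theI)
qed

lemma inv_arr [simp]:
  assumes "is_iso C f"
  shows "f \<in> Arr C" "inv_arr C f \<in> Arr C" "Dom C (inv_arr C f) = Cod C f"
    "Cod C (inv_arr C f) = Dom C f"
    "inv_arr C f \<cdot> f = Idn C (Dom C f)" "f \<cdot> inv_arr C f = Idn C (Cod C f)"
  using is_inverse_inv_arr[OF assms] assms by (simp_all add: is_inverse_def in_Hom is_iso_def)

lemma inv_arr_reassoc [simp]:
  assumes "is_iso C f" "g \<in> Arr C"
  shows "Cod C g = Dom C f \<Longrightarrow> inv_arr C f \<cdot> (f \<cdot> g) = g"
    "Cod C g = Cod C f \<Longrightarrow> f \<cdot> (inv_arr C f \<cdot> g) = g"
proof -
  assume "Cod C g = Dom C f"
  with assms show "inv_arr C f \<cdot> (f \<cdot> g) = g"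
    by (subst Comp_assoc_arr[symmetric]) simp_all
next
  assume "Cod C g = Cod C f"
  with assms show "f \<cdot> (inv_arr C f \<cdot> g) = g"
    by (subst Comp_assoc_arr[symmetric]) simp_all
qed

lemma is_isoI:
  assumes "f \<in> Hom C x y" "g \<in> Hom C y x" "g \<cdot> f = Idn C x" "f \<cdot> g = Idn C y"
  shows "is_iso C f"
proof -
  have "is_inverse C f g"
    using assms by (simp add: is_inverse_def in_Hom)
  then show ?thesis
    using assms(1) unfolding is_iso_def in_Hom by blast
qed

lemma is_iso_Idn [simp]: "x \<in> Obj C \<Longrightarrow> is_iso C (Idn C x)"
  by (rule is_isoI[of _ x x "Idn C x"]) (simp_all add: in_Hom)

lemma is_iso_inv_arr [simp]: "is_iso C f \<Longrightarrow> is_iso C (inv_arr C f)"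
  by (rule is_isoI[of _ "Cod C f" "Dom C f" f]) (simp_all add: in_Hom)

lemma is_iso_Comp [simp]:
  "is_iso C f \<Longrightarrow> is_iso C g \<Longrightarrow> Cod C f = Dom C g \<Longrightarrow> is_iso C (g \<cdot> f)"
  by (rule is_isoI[of _ "Dom C f" "Cod C g" "inv_arr C f \<cdot> inv_arr C g"]) (simp_all add: in_Hom)

lemma iso_cancel_left:
  assumes "f \<cdot> g = f \<cdot> h" "is_iso C f" "g \<in> Arr C" "h \<in> Arr C" "Cod C g = Dom C f" "Cod C h = Dom C f"
  shows "g = h"
proof -
  have "inv_arr C f \<cdot> (f \<cdot> g) = inv_arr C f \<cdot> (f \<cdot> h)"
    using assms(1) by simp
  then show "g = h"
    using assms(2-) by simp
qed

lemma iso_cancel_right: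
  assumes "g \<cdot> f = h \<cdot> f" "is_iso C f" "g \<in> Arr C" "h \<in> Arr C" "Dom C g = Cod C f" "Dom C h = Cod C f"
  shows "g = h"
proof -
  have "(g \<cdot> f) \<cdot> inv_arr C f = (h \<cdot> f) \<cdot> inv_arr C f"
    using assms(1) by simp
  then show "g = h"
    using assms(2-) by simp
qed

text \<open>Each implication cancels one of the two isomorphisms. With \<open>k\<close> and
  \<open>h\<close> built from module associators, this translates identities between arrows on
  \<open>(x \<otimes> y) \<rhd> m\<close> into identities between arrows on
  \<open>x \<rhd> y \<rhd> m\<close> and back.\<close>

lemma iso_square_iff:
  assumes "k \<cdot> f = p \<cdot> h" "k \<cdot> g = q \<cdot> h" "is_iso C k" "is_iso C h"
    "f \<in> Arr C" "g \<in> Arr C" "Cod C f = Dom C k" "Cod C g = Dom C k"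
    "p \<in> Arr C" "q \<in> Arr C" "Dom C p = Cod C h" "Dom C q = Cod C h"
  shows "f = g \<longleftrightarrow> p = q"
proof
  assume "f = g"
  with assms show "p = q"
    by (intro iso_cancel_right[of p h q]) simp_all
next
  assume "p = q"
  with assms show "f = g"
    by (intro iso_cancel_left[of k f g]) simp_all
qed

lemma iso_square_inv:
  assumes "g \<cdot> s = t \<cdot> f" "is_iso C s" "is_iso C t" "f \<in> Arr C" "g \<in> Arr C"
    "Dom C f = Dom C s" "Cod C f = Dom C t" "Dom C g = Cod C s" "Cod C g = Cod C t"
  shows "inv_arr C t \<cdot> g = f \<cdot> inv_arr C s"
proof -
  have "inv_arr C t \<cdot> g = inv_arr C t \<cdot> (g \<cdot> s) \<cdot> inv_arr C s"
    using assms(2-) by simp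
  also have "\<dots> = f \<cdot> inv_arr C s"
    unfolding assms(1) using assms(2-) by simp
  finally show ?thesis .
qed

end

section \<open>Tensor products of arrows\<close>

context linear_monoidal_category
begin

declare TObj_in [simp] Unit_in [simp] Assoc_iso [simp] LUnit_iso [simp] RUnit_iso [simp]
  TArr_Idn [simp]

lemma TArr_arr [simp]:
  assumes "f \<in> Arr C" "g \<in> Arr C"
  shows "f \<boxtimes> g \<in> Arr C" "Dom C (f \<boxtimes> g) = Dom C f \<otimes> Dom C g" "Cod C (f \<boxtimes> g) = Cod C f \<otimes> Cod C g"
  using TArr_in[of f "Dom C f" "Cod C f" g "Dom C g" "Cod C g"] assms by (simp_all add: in_Hom)

lemma Assoc_arr [simp]:
  assumes "x \<in> Obj C" "y \<in> Obj C" "z \<in> Obj C"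
  shows "Assoc C x y z \<in> Arr C" "Dom C (Assoc C x y z) = (x \<otimes> y) \<otimes> z"
    "Cod C (Assoc C x y z) = x \<otimes> (y \<otimes> z)"
  using Assoc_in[OF assms] by (simp_all add: in_Hom)

lemma LUnit_arr [simp]:
  assumes "x \<in> Obj C"
  shows "LUnit C x \<in> Arr C" "Dom C (LUnit C x) = Unit C \<otimes> x" "Cod C (LUnit C x) = x"
  using LUnit_in[OF assms] by (simp_all add: in_Hom)

lemma RUnit_arr [simp]:
  assumes "x \<in> Obj C"
  shows "RUnit C x \<in> Arr C" "Dom C (RUnit C x) = x \<otimes> Unit C" "Cod C (RUnit C x) = x"
  using RUnit_in[OF assms] by (simp_all add: in_Hom)

lemma TArr_Comp_arr:
  assumes "f \<in> Arr C" "g \<in> Arr C" "f' \<in> Arr C" "g' \<in> Arr C" "Cod C f = Dom C g" "Cod C f' = Dom C g'"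
  shows "(g \<cdot> f) \<boxtimes> (g' \<cdot> f') = (g \<boxtimes> g') \<cdot> (f \<boxtimes> f')"
  using assms by (intro TArr_Comp) (auto simp: in_Hom)

lemma TArr_iso [simp]:
  assumes "is_iso C f" "is_iso C g"
  shows "is_iso C (f \<boxtimes> g)"
  using assms TArr_Comp_arr[of f "inv_arr C f" g "inv_arr C g"]
    TArr_Comp_arr[of "inv_arr C f" f "inv_arr C g" g]
  by (intro is_isoI[of _ "Dom C f \<otimes> Dom C g" "Cod C f \<otimes> Cod C g" "inv_arr C f \<boxtimes> inv_arr C g"])
    (simp_all add: in_Hom)

text \<open>Naturality of \<open>RUnit\<close> writes \<open>f\<close> as
  \<open>f \<boxtimes> Idn C (Unit C)\<close> conjugated by isomorphisms. Hence an identity in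
  \<open>C\<close> can be recovered from its action on the single object \<open>Unit C\<close> of
  the regular module.\<close>

lemma TArr_Unit_faithful:
  assumes "f \<in> Hom C x y" "g \<in> Hom C x y" "f \<boxtimes> Idn C (Unit C) = g \<boxtimes> Idn C (Unit C)"
  shows "f = g"
proof -
  have x: "x \<in> Obj C"
    using assms(1) Dom_in by (auto simp: in_Hom)
  have "f \<cdot> RUnit C x = g \<cdot> RUnit C x"
    using RUnit_nat[OF assms(1)] RUnit_nat[OF assms(2)] assms(3) by simp
  then show ?thesis
    by (rule iso_cancel_right) (use assms(1,2) x in \<open>simp_all add: in_Hom\<close>)
qed

end

text \<open>With \<open>Assoc\<close> as module associator and \<open>LUnit\<close> as module unit,
  the module pentagon and the module triangle are literally the pentagon and the triangle of
  \<open>C\<close>.\<close>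

definition regular :: "('o, 'a, 'k, 'z) moncat_scheme \<Rightarrow> ('o, 'a, 'k, 'o, 'a) actcat" where
  "regular C = \<lparr>Obj = Obj C, Arr = Arr C, Dom = Dom C, Cod = Cod C, Idn = Idn C, Comp = Comp C,
     Plus = Plus C, Scal = Scal C, Zero = Zero C, AObj = TObj C, AArr = TArr C,
     MAssoc = Assoc C, MUnit = LUnit C\<rparr>"

lemma regular_simps [simp]:
  "Obj (regular C) = Obj C" "Arr (regular C) = Arr C" "Dom (regular C) = Dom C"
  "Cod (regular C) = Cod C" "Idn (regular C) = Idn C" "Comp (regular C) = Comp C"
  "Plus (regular C) = Plus C" "Scal (regular C) = Scal C" "Zero (regular C) = Zero C"
  "AObj (regular C) = TObj C" "AArr (regular C) = TArr C" "MAssoc (regular C) = Assoc C"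
  "MUnit (regular C) = LUnit C"
  by (simp_all add: regular_def)

lemma regular_Hom [simp]: "Hom (regular C) = Hom C"
  by (simp add: Hom_def fun_eq_iff)

lemma regular_is_iso [simp]: "is_iso (regular C) = is_iso C"
  by (simp add: is_iso_def is_inverse_def fun_eq_iff)

lemma (in linear_monoidal_category) module_category_regular: "module_category C (regular C)"
proof -
  have "linear_category (regular C)"
    by (unfold_locales; simp only: regular_simps regular_Hom)
      (rule Dom_in Cod_in Idn_in Comp_in Comp_assoc Idn_left Idn_right Plus_in Scal_in Zero_in
        Plus_assoc Plus_commute Plus_Zero Plus_minus Scal_Plus Scal_add Scal_mult Scal_one
        Comp_Plus_left Comp_Plus_right Comp_Scal_left Comp_Scal_right; assumption)+
  then show ?thesis
    by (intro module_category.intro module_category_axioms.intro linear_monoidal_category_axioms;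
        simp only: regular_simps regular_Hom regular_is_iso)
      (rule TObj_in TArr_in TArr_Idn TArr_Comp TArr_Plus_left TArr_Plus_right TArr_Scal_left
        TArr_Scal_right Assoc_in Assoc_iso Assoc_nat LUnit_in LUnit_iso LUnit_nat pentagon
        triangle; assumption)+
qed

subsection \<open>Iterated actions\<close>

context module_category
begin

abbreviation Mcomp (infixr "\<star>" 65) where "v \<star> u \<equiv> Comp M v u"
abbreviation Mobj (infixr "\<diamondop>" 68) where "c \<diamondop> m \<equiv> AObj M c m"
abbreviation Lwhisk (infixr "\<triangleright>" 68) where "c \<triangleright> u \<equiv> AArr M (Idn C c) u"
abbreviation Rwhisk (infixr "\<triangleleft>" 68) where "f \<triangleleft> m \<equiv> AArr M f (Idn M m)"

declare AObj_in [simp] MAssoc_iso [simp] MUnit_iso [simp] AArr_Idn [simp]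

lemma AArr_arr [simp]:
  assumes "f \<in> Arr C" "u \<in> Arr M"
  shows "AArr M f u \<in> Arr M" "Dom M (AArr M f u) = Dom C f \<diamondop> Dom M u"
    "Cod M (AArr M f u) = Cod C f \<diamondop> Cod M u"
  using AArr_in[of f "Dom C f" "Cod C f" u "Dom M u" "Cod M u"] assms by (simp_all add: in_Hom)

lemma MAssoc_arr [simp]:
  assumes "c \<in> Obj C" "d \<in> Obj C" "m \<in> Obj M"
  shows "MAssoc M c d m \<in> Arr M" "Dom M (MAssoc M c d m) = (c \<otimes> d) \<diamondop> m"
    "Cod M (MAssoc M c d m) = c \<diamondop> d \<diamondop> m"
  using MAssoc_in[OF assms] by (simp_all add: in_Hom)

lemma MUnit_arr [simp]:
  assumes "m \<in> Obj M"
  shows "MUnit M m \<in> Arr M" "Dom M (MUnit M m) = Unit C \<diamondop> m" "Cod M (MUnit M m) = m"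
  using MUnit_in[OF assms] by (simp_all add: in_Hom)

lemma AArr_Comp_arr:
  assumes "f \<in> Arr C" "g \<in> Arr C" "u \<in> Arr M" "v \<in> Arr M" "Cod C f = Dom C g" "Cod M u = Dom M v"
  shows "AArr M (g \<cdot> f) (v \<star> u) = AArr M g v \<star> AArr M f u"
  using assms by (intro AArr_Comp) (auto simp: in_Hom)

lemma AArr_iso [simp]:
  assumes "is_iso C f" "is_iso M u"
  shows "is_iso M (AArr M f u)"
  using assms AArr_Comp_arr[of f "inv_arr C f" u "inv_arr M u"]
    AArr_Comp_arr[of "inv_arr C f" f "inv_arr M u" u]
  by (intro M.is_isoI[of _ "Dom C f \<diamondop> Dom M u" "Cod C f \<diamondop> Cod M u" "AArr M (inv_arr C f) (inv_arr M u)"])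
    (simp_all add: in_Hom)

lemma Lwhisk_Comp:
  "c \<in> Obj C \<Longrightarrow> u \<in> Arr M \<Longrightarrow> v \<in> Arr M \<Longrightarrow> Cod M u = Dom M v \<Longrightarrow>
    c \<triangleright> (v \<star> u) = (c \<triangleright> v) \<star> (c \<triangleright> u)"
  using AArr_Comp_arr[of "Idn C c" "Idn C c" u v] by simp

lemma Rwhisk_Comp:
  "m \<in> Obj M \<Longrightarrow> f \<in> Arr C \<Longrightarrow> g \<in> Arr C \<Longrightarrow> Cod C f = Dom C g \<Longrightarrow>
    (g \<cdot> f) \<triangleleft> m = (g \<triangleleft> m) \<star> (f \<triangleleft> m)"
  using AArr_Comp_arr[of f g "Idn M m" "Idn M m"] by simp

lemma whisk_eq_AArr:
  assumes "f \<in> Hom C c d" "u \<in> Hom M m n"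
  shows "(f \<triangleleft> n) \<star> (c \<triangleright> u) = AArr M f u" "(d \<triangleright> u) \<star> (f \<triangleleft> m) = AArr M f u"
  using assms AArr_Comp_arr[of "Idn C c" f u "Idn M n"] AArr_Comp_arr[of f "Idn C d" "Idn M m" u]
  by (auto simp: in_Hom)

lemma whisk_swap:
  assumes "f \<in> Hom C c d" "u \<in> Hom M m n"
  shows "(f \<triangleleft> n) \<star> (c \<triangleright> u) = (d \<triangleright> u) \<star> (f \<triangleleft> m)"
  using whisk_eq_AArr[OF assms] by simp

lemma MAssoc_nat1:
  "f \<in> Hom C c c' \<Longrightarrow> d \<in> Obj C \<Longrightarrow> m \<in> Obj M \<Longrightarrow>
    MAssoc M c' d m \<star> ((f \<boxtimes> Idn C d) \<triangleleft> m) = (f \<triangleleft> (d \<diamondop> m)) \<star> MAssoc M c d m"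
  using MAssoc_nat[of f c c' "Idn C d" d d "Idn M m" m m] by (simp add: in_Hom)

lemma MAssoc_nat2:
  "g \<in> Hom C d d' \<Longrightarrow> c \<in> Obj C \<Longrightarrow> m \<in> Obj M \<Longrightarrow>
    MAssoc M c d' m \<star> ((Idn C c \<boxtimes> g) \<triangleleft> m) = (c \<triangleright> g \<triangleleft> m) \<star> MAssoc M c d m"
  using MAssoc_nat[of "Idn C c" c c g d d' "Idn M m" m m] by (simp add: in_Hom)

lemma MAssoc_nat3:
  "u \<in> Hom M m m' \<Longrightarrow> c \<in> Obj C \<Longrightarrow> d \<in> Obj C \<Longrightarrow>
    MAssoc M c d m' \<star> ((c \<otimes> d) \<triangleright> u) = (c \<triangleright> d \<triangleright> u) \<star> MAssoc M c d m"
  using MAssoc_nat[of "Idn C c" c c "Idn C d" d d u m m'] by (simp add: in_Hom)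

text \<open>Kelly's argument for the left unit.\<close>

lemma MUnit_MAssoc:
  assumes [simp]: "x \<in> Obj C" "m \<in> Obj M"
  shows "MUnit M (x \<diamondop> m) \<star> MAssoc M (Unit C) x m = LUnit C x \<triangleleft> m"
proof -
  let ?e = "Unit C"
  let ?p = "MUnit M (x \<diamondop> m) \<star> MAssoc M ?e x m" and ?q = "LUnit C x \<triangleleft> m"
  \<comment> \<open>These are the last two factors on the left of the module pentagon at
    \<open>?e\<close>, \<open>?e\<close>, \<open>x\<close>. They are invertible, so
    \<open>?p\<close> and \<open>?q\<close> may be compared after acting with the unit and
    precomposing with \<open>?k\<close>.\<close>
  let ?k = "MAssoc M ?e (?e \<otimes> x) m \<star> (Assoc C ?e ?e x \<triangleleft> m)"
  have "(?e \<triangleright> ?q) \<star> ?k = ((?e \<triangleright> ?q) \<star> MAssoc M ?e (?e \<otimes> x) m) \<star> (Assoc C ?e ?e x \<triangleleft> m)"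
    by simp
  also have "\<dots> = (MAssoc M ?e x m \<star> ((Idn C ?e \<boxtimes> LUnit C x) \<triangleleft> m)) \<star> (Assoc C ?e ?e x \<triangleleft> m)"
    by (subst MAssoc_nat2[of _ "?e \<otimes> x"]) (simp_all add: in_Hom)
  also have "\<dots> = MAssoc M ?e x m \<star> (((Idn C ?e \<boxtimes> LUnit C x) \<cdot> Assoc C ?e ?e x) \<triangleleft> m)"
    by (simp add: Rwhisk_Comp)
  also have "\<dots> = (RUnit C ?e \<triangleleft> (x \<diamondop> m)) \<star> MAssoc M (?e \<otimes> ?e) x m"
    by (simp add: C.triangle MAssoc_nat1[of _ "?e \<otimes> ?e"] in_Hom)
  also have "\<dots> = (?e \<triangleright> MUnit M (x \<diamondop> m)) \<star> (MAssoc M ?e ?e (x \<diamondop> m) \<star> MAssoc M (?e \<otimes> ?e) x m)"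
    by (simp flip: module_triangle)
  also have "\<dots> = (?e \<triangleright> ?p) \<star> ?k"
    by (simp add: Lwhisk_Comp flip: module_pentagon)
  finally have "?e \<triangleright> ?q = ?e \<triangleright> ?p"
    by (rule M.iso_cancel_right) simp_all
  \<comment> \<open>Naturality of \<open>MUnit\<close> makes the action of the unit object faithful,
    which removes the whiskering by \<open>?e\<close>.\<close>
  then have "?p \<star> MUnit M ((?e \<otimes> x) \<diamondop> m) = ?q \<star> MUnit M ((?e \<otimes> x) \<diamondop> m)"
    using MUnit_nat[of ?q "(?e \<otimes> x) \<diamondop> m" "x \<diamondop> m"] MUnit_nat[of ?p "(?e \<otimes> x) \<diamondop> m" "x \<diamondop> m"]
    by (simp add: in_Hom)
  then show ?thesis
    by (rule M.iso_cancel_right) simp_all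
qed

end

subsection \<open>Half-braidings acting on a module category\<close>

text \<open>Half-braidings are studied through the isomorphisms they induce between right-nested
  iterated actions. For these all associators disappear, so that the coherence conditions take
  their strict form.\<close>

definition pre_half_braiding :: "('o, 'a, 'k, 'z) moncat_scheme \<Rightarrow> ('o, 'a) cobj \<Rightarrow> bool" where
  "pre_half_braiding C Z \<longleftrightarrow> fst Z \<in> Obj C \<and>
     (\<forall>c\<in>Obj C. snd Z c \<in> Hom C (c \<otimes>\<^bsub>C\<^esub> fst Z) (fst Z \<otimes>\<^bsub>C\<^esub> c) \<and> is_iso C (snd Z c))"

lemma pre_half_braidingD [simp]:
  assumes "pre_half_braiding C Z"
  shows "fst Z \<in> Obj C" "c \<in> Obj C \<Longrightarrow> is_iso C (snd Z c)"
    "c \<in> Obj C \<Longrightarrow> Dom C (snd Z c) = c \<otimes>\<^bsub>C\<^esub> fst Z"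
    "c \<in> Obj C \<Longrightarrow> Cod C (snd Z c) = fst Z \<otimes>\<^bsub>C\<^esub> c"
    "c \<in> Obj C \<Longrightarrow> snd Z c \<in> Arr C"
  using assms by (auto simp: pre_half_braiding_def in_Hom)

lemma center_obj_iff: "Z \<in> center_obj C \<longleftrightarrow> fst Z \<in> Obj C \<and> half_braiding C (fst Z) (snd Z)"
  by (cases Z) (simp add: center_obj_def)

lemma center_obj_pre: "Z \<in> center_obj C \<Longrightarrow> pre_half_braiding C Z"
  unfolding center_obj_iff half_braiding_def pre_half_braiding_def by blast

text \<open>The arrow \<open>c \<rhd> Z \<rhd> m \<rightarrow> Z \<rhd> c \<rhd> m\<close> induced
  by the half-braiding. Its construction uses no coherence, so for a
  \<open>pre_half_braiding\<close>, where only typing and invertibility are required, the axioms of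
  the center can be restated in terms of slides before they are known to hold.\<close>

definition slide ::
  "('p, 'b, 'k, 'o, 'a, 'y) actcat_scheme \<Rightarrow> ('o, 'a) cobj \<Rightarrow> 'o \<Rightarrow> 'p \<Rightarrow> 'b"
where
  "slide M Z c m = MAssoc M (fst Z) c m \<cdot>\<^bsub>M\<^esub> (snd Z c \<unrhd>\<^bsub>M\<^esub> Idn M m) \<cdot>\<^bsub>M\<^esub>
     inv_arr M (MAssoc M c (fst Z) m)"

text \<open>Both bracketings of a triple tensor product map to the bracket-free
  \<open>b \<rhd> c \<rhd> d \<rhd> m\<close>: \<open>MAssocL\<close> starts from
  \<open>(b \<otimes> c) \<otimes> d\<close>, \<open>MAssocR\<close> from
  \<open>b \<otimes> (c \<otimes> d)\<close>.\<close>

definition MAssocL ::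
  "('o, 'a, 'k, 'z) moncat_scheme \<Rightarrow> ('p, 'b, 'k, 'o, 'a, 'y) actcat_scheme \<Rightarrow>
   'o \<Rightarrow> 'o \<Rightarrow> 'o \<Rightarrow> 'p \<Rightarrow> 'b"
where
  "MAssocL C M b c d m = MAssoc M b c (d \<rhd>\<^bsub>M\<^esub> m) \<cdot>\<^bsub>M\<^esub> MAssoc M (b \<otimes>\<^bsub>C\<^esub> c) d m"

definition MAssocR ::
  "('o, 'a, 'k, 'z) moncat_scheme \<Rightarrow> ('p, 'b, 'k, 'o, 'a, 'y) actcat_scheme \<Rightarrow>
   'o \<Rightarrow> 'o \<Rightarrow> 'o \<Rightarrow> 'p \<Rightarrow> 'b"
where
  "MAssocR C M b c d m = (Idn C b \<unrhd>\<^bsub>M\<^esub> MAssoc M c d m) \<cdot>\<^bsub>M\<^esub> MAssoc M b (c \<otimes>\<^bsub>C\<^esub> d) m"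

context module_category
begin

lemma slide_iso [simp]:
  assumes "pre_half_braiding C Z" "c \<in> Obj C" "m \<in> Obj M"
  shows "is_iso M (slide M Z c m)" "slide M Z c m \<in> Arr M"
    "Dom M (slide M Z c m) = c \<diamondop> fst Z \<diamondop> m" "Cod M (slide M Z c m) = fst Z \<diamondop> c \<diamondop> m"
  using assms by (simp_all add: slide_def)

lemma MAssocL_iso [simp]:
  assumes "b \<in> Obj C" "c \<in> Obj C" "d \<in> Obj C" "m \<in> Obj M"
  shows "is_iso M (MAssocL C M b c d m)" "MAssocL C M b c d m \<in> Arr M"
    "Dom M (MAssocL C M b c d m) = ((b \<otimes> c) \<otimes> d) \<diamondop> m"
    "Cod M (MAssocL C M b c d m) = b \<diamondop> c \<diamondop> d \<diamondop> m"
  using assms by (simp_all add: MAssocL_def)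

lemma MAssocR_iso [simp]:
  assumes "b \<in> Obj C" "c \<in> Obj C" "d \<in> Obj C" "m \<in> Obj M"
  shows "is_iso M (MAssocR C M b c d m)" "MAssocR C M b c d m \<in> Arr M"
    "Dom M (MAssocR C M b c d m) = (b \<otimes> (c \<otimes> d)) \<diamondop> m"
    "Cod M (MAssocR C M b c d m) = b \<diamondop> c \<diamondop> d \<diamondop> m"
  using assms by (simp_all add: MAssocR_def)

text \<open>This is the module pentagon read as a rewrite rule: an associator of \<open>C\<close>
  merely exchanges the two maps to the bracket-free action.\<close>

lemma MAssocR_Assoc:
  assumes "b \<in> Obj C" "c \<in> Obj C" "d \<in> Obj C" "m \<in> Obj M"
  shows "MAssocR C M b c d m \<star> (Assoc C b c d \<triangleleft> m) = MAssocL C M b c d m"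
  using assms by (simp add: MAssocR_def MAssocL_def module_pentagon)

lemma Rwhisk_inv:
  assumes "is_iso C f" "m \<in> Obj M"
  shows "(f \<triangleleft> m) \<star> (inv_arr C f \<triangleleft> m) = Idn M (Cod C f \<diamondop> m)"
    "(inv_arr C f \<triangleleft> m) \<star> (f \<triangleleft> m) = Idn M (Dom C f \<diamondop> m)"
  using assms Rwhisk_Comp[of m "inv_arr C f" f] Rwhisk_Comp[of m f "inv_arr C f"] by simp_all

lemma MAssocL_inv_Assoc:
  assumes [simp]: "b \<in> Obj C" "c \<in> Obj C" "d \<in> Obj C" "m \<in> Obj M"
  shows "MAssocL C M b c d m \<star> (inv_arr C (Assoc C b c d) \<triangleleft> m) = MAssocR C M b c d m"
  by (simp add: Rwhisk_inv flip: MAssocR_Assoc)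

lemma slide_MAssoc:
  assumes "pre_half_braiding C Z" "c \<in> Obj C" "m \<in> Obj M"
  shows "slide M Z c m \<star> MAssoc M c (fst Z) m = MAssoc M (fst Z) c m \<star> (snd Z c \<triangleleft> m)"
  using assms by (simp add: slide_def)

text \<open>Since actions nest to the right, an object tensored on the right of a half-braiding is
  absorbed into the module argument of the slide. In \<open>slide_MAssocR\<close> the object on the
  left stays outside as a whiskering.\<close>

lemma slide_MAssocL:
  assumes [simp]: "pre_half_braiding C Z" "c \<in> Obj C" "d \<in> Obj C" "m \<in> Obj M"
  shows "MAssocL C M (fst Z) c d m \<star> ((snd Z c \<boxtimes> Idn C d) \<triangleleft> m) =
    slide M Z c (d \<diamondop> m) \<star> MAssocL C M c (fst Z) d m"
proof -
  have [simp]: "snd Z c \<in> Hom C (c \<otimes> fst Z) (fst Z \<otimes> c)"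
    by (simp add: in_Hom)
  note eqs = MAssoc_nat1[of "snd Z c" "c \<otimes> fst Z" "fst Z \<otimes> c" d m]
  show ?thesis
    by (simp add: MAssocL_def eqs M.Comp_reassoc[OF slide_MAssoc])
qed

lemma slide_MAssocR:
  assumes [simp]: "pre_half_braiding C Z" "b \<in> Obj C" "c \<in> Obj C" "m \<in> Obj M"
  shows "MAssocR C M b (fst Z) c m \<star> ((Idn C b \<boxtimes> snd Z c) \<triangleleft> m) =
    (b \<triangleright> slide M Z c m) \<star> MAssocR C M b c (fst Z) m"
proof -
  have [simp]: "snd Z c \<in> Hom C (c \<otimes> fst Z) (fst Z \<otimes> c)"
    by (simp add: in_Hom)
  have "(b \<triangleright> slide M Z c m) \<star> (b \<triangleright> MAssoc M c (fst Z) m) =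
      (b \<triangleright> MAssoc M (fst Z) c m) \<star> (b \<triangleright> snd Z c \<triangleleft> m)"
    by (simp add: slide_MAssoc flip: Lwhisk_Comp)
  note eqs = M.Comp_reassoc[OF this] MAssoc_nat2[of "snd Z c" "c \<otimes> fst Z" "fst Z \<otimes> c" b m]
  show ?thesis
    by (simp add: MAssocR_def eqs)
qed

text \<open>In the module variable, naturality comes from \<open>MAssoc\<close> and from the
  interchange of \<open>snd Z c\<close> with \<open>u\<close>; naturality of the half-braiding
  concerns the variable \<open>c\<close>.\<close>

lemma slide_natural:
  assumes [simp]: "pre_half_braiding C Z" "c \<in> Obj C" and u: "u \<in> Hom M m n"
  shows "slide M Z c n \<star> (c \<triangleright> fst Z \<triangleright> u) = (fst Z \<triangleright> c \<triangleright> u) \<star> slide M Z c m"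
proof -
  have [simp]: "u \<in> Arr M" "Dom M u = m" "Cod M u = n" "m \<in> Obj M" "n \<in> Obj M"
    "snd Z c \<in> Hom C (c \<otimes> fst Z) (fst Z \<otimes> c)"
    using u M.Dom_in M.Cod_in by (auto simp: in_Hom)
  have "(slide M Z c n \<star> (c \<triangleright> fst Z \<triangleright> u)) \<star> MAssoc M c (fst Z) m =
      slide M Z c n \<star> MAssoc M c (fst Z) n \<star> ((c \<otimes> fst Z) \<triangleright> u)"
    by (simp add: MAssoc_nat3[OF u])
  also have "\<dots> = MAssoc M (fst Z) c n \<star> (snd Z c \<triangleleft> n) \<star> ((c \<otimes> fst Z) \<triangleright> u)"
    by (simp add: M.Comp_reassoc[OF slide_MAssoc])
  also have "\<dots> = MAssoc M (fst Z) c n \<star> ((fst Z \<otimes> c) \<triangleright> u) \<star> (snd Z c \<triangleleft> m)"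
    using u by (simp add: whisk_swap[of _ "c \<otimes> fst Z" "fst Z \<otimes> c"])
  also have "\<dots> = ((fst Z \<triangleright> c \<triangleright> u) \<star> slide M Z c m) \<star> MAssoc M c (fst Z) m"
    by (simp add: M.Comp_reassoc[OF MAssoc_nat3[OF u]] slide_MAssoc)
  finally have "(slide M Z c n \<star> (c \<triangleright> fst Z \<triangleright> u)) \<star> MAssoc M c (fst Z) m =
      ((fst Z \<triangleright> c \<triangleright> u) \<star> slide M Z c m) \<star> MAssoc M c (fst Z) m" .
  then show ?thesis
    by (rule M.iso_cancel_right) simp_all
qed


text \<open>Conjugation by \<open>MAssoc\<close> turns half-braidings into slides and carries
  \<open>f\<close> along. The equivalence is used in both directions: to obtain the law for objects
  of the center, and to verify that an object belongs to the center.\<close>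

lemma slide_natural_iff:
  assumes [simp]: "pre_half_braiding C Z" "m \<in> Obj M" and f: "f \<in> Hom C c d"
  shows "(snd Z d \<cdot> (f \<boxtimes> Idn C (fst Z))) \<triangleleft> m = ((Idn C (fst Z) \<boxtimes> f) \<cdot> snd Z c) \<triangleleft> m \<longleftrightarrow>
    slide M Z d m \<star> (f \<triangleleft> (fst Z \<diamondop> m)) = (fst Z \<triangleright> f \<triangleleft> m) \<star> slide M Z c m"
proof -
  have [simp]: "f \<in> Arr C" "Dom C f = c" "Cod C f = d" "c \<in> Obj C" "d \<in> Obj C"
    using f C.Dom_in C.Cod_in by (auto simp: in_Hom)
  show ?thesis
    by (rule M.iso_square_iff[of "MAssoc M (fst Z) d m" _ _ "MAssoc M c (fst Z) m"])
      (simp_all add: Rwhisk_Comp slide_MAssoc[symmetric] MAssoc_nat1[OF f]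
        M.Comp_reassoc[OF slide_MAssoc[symmetric]] M.Comp_reassoc[OF MAssoc_nat2[OF f]])
qed

text \<open>All three associators on the right disappear, since each of them switches between
  \<open>MAssocL\<close> and \<open>MAssocR\<close> while the half-braidings between them become
  slides. Only the splitting of \<open>c \<otimes> d\<close> by \<open>MAssoc\<close>
  remains.\<close>

lemma slide_hexagon_iff:
  assumes [simp]: "pre_half_braiding C Z" "c \<in> Obj C" "d \<in> Obj C" "m \<in> Obj M"
  shows "snd Z (c \<otimes> d) \<triangleleft> m = (Assoc C (fst Z) c d \<cdot> (snd Z c \<boxtimes> Idn C d) \<cdot>
        inv_arr C (Assoc C c (fst Z) d) \<cdot> (Idn C c \<boxtimes> snd Z d) \<cdot> Assoc C c d (fst Z)) \<triangleleft> m \<longleftrightarrow>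
    (fst Z \<triangleright> MAssoc M c d m) \<star> slide M Z (c \<otimes> d) m =
      slide M Z c (d \<diamondop> m) \<star> (c \<triangleright> slide M Z d m) \<star> MAssoc M c d (fst Z \<diamondop> m)"
proof (rule M.iso_square_iff[of "MAssocR C M (fst Z) c d m" _ _ "MAssoc M (c \<otimes> d) (fst Z) m"])
  show "MAssocR C M (fst Z) c d m \<star> (snd Z (c \<otimes> d) \<triangleleft> m) =
      ((fst Z \<triangleright> MAssoc M c d m) \<star> slide M Z (c \<otimes> d) m) \<star> MAssoc M (c \<otimes> d) (fst Z) m"
    by (simp add: MAssocR_def slide_MAssoc)
  show "MAssocR C M (fst Z) c d m \<star> ((Assoc C (fst Z) c d \<cdot> (snd Z c \<boxtimes> Idn C d) \<cdot>
        inv_arr C (Assoc C c (fst Z) d) \<cdot> (Idn C c \<boxtimes> snd Z d) \<cdot> Assoc C c d (fst Z)) \<triangleleft> m) =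
      (slide M Z c (d \<diamondop> m) \<star> (c \<triangleright> slide M Z d m) \<star> MAssoc M c d (fst Z \<diamondop> m)) \<star>
        MAssoc M (c \<otimes> d) (fst Z) m"
    by (simp add: Rwhisk_Comp MAssocR_Assoc slide_MAssocL slide_MAssocR MAssocL_inv_Assoc
        M.Comp_reassoc[OF MAssocR_Assoc] M.Comp_reassoc[OF slide_MAssocL]
        M.Comp_reassoc[OF MAssocL_inv_Assoc] M.Comp_reassoc[OF slide_MAssocR])
      (simp add: MAssocL_def)
qed simp_all

text \<open>The right unitor becomes \<open>MUnit\<close> by the module triangle, the left unitor by
  \<open>MUnit_MAssoc\<close>.\<close>

lemma slide_unit_iff:
  assumes [simp]: "pre_half_braiding C Z" "m \<in> Obj M"
  shows "(RUnit C (fst Z) \<cdot> snd Z (Unit C)) \<triangleleft> m = LUnit C (fst Z) \<triangleleft> m \<longleftrightarrow>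
    (fst Z \<triangleright> MUnit M m) \<star> slide M Z (Unit C) m = MUnit M (fst Z \<diamondop> m)"
  by (rule M.iso_square_iff[of "Idn M (fst Z \<diamondop> m)" _ _ "MAssoc M (Unit C) (fst Z) m"])
    (simp_all add: Rwhisk_Comp slide_MAssoc MUnit_MAssoc
      flip: module_triangle)

lemma slide_morphism_iff:
  assumes [simp]: "pre_half_braiding C X" "pre_half_braiding C Y" "c \<in> Obj C" "m \<in> Obj M"
    and f: "f \<in> Hom C (fst X) (fst Y)"
  shows "((f \<boxtimes> Idn C c) \<cdot> snd X c) \<triangleleft> m = (snd Y c \<cdot> (Idn C c \<boxtimes> f)) \<triangleleft> m \<longleftrightarrow>
    (f \<triangleleft> (c \<diamondop> m)) \<star> slide M X c m = slide M Y c m \<star> (c \<triangleright> f \<triangleleft> m)"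
proof -
  have [simp]: "f \<in> Arr C" "Dom C f = fst X" "Cod C f = fst Y"
    using f C.Dom_in C.Cod_in by (auto simp: in_Hom)
  show ?thesis
    by (rule M.iso_square_iff[of "MAssoc M (fst Y) c m" _ _ "MAssoc M c (fst X) m"])
      (simp_all add: Rwhisk_Comp slide_MAssoc[symmetric] MAssoc_nat2[OF f]
        M.Comp_reassoc[OF slide_MAssoc[symmetric]] M.Comp_reassoc[OF MAssoc_nat1[OF f]])
qed

text \<open>An object \<open>c\<close> passes the tensor product by passing \<open>X\<close> and
  then, inside the action of \<open>X\<close>, passing \<open>Y\<close>. The associators in
  \<open>center_tensor\<close> are absorbed by \<open>MAssocL\<close> and
  \<open>MAssocR\<close>.\<close>

lemma slide_tensor:
  assumes [simp]: "pre_half_braiding C X" "pre_half_braiding C Y" "c \<in> Obj C" "m \<in> Obj M"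
  shows "MAssoc M (fst X) (fst Y) (c \<diamondop> m) \<star> slide M (center_tensor C X Y) c m =
    (fst X \<triangleright> slide M Y c m) \<star> slide M X c (fst Y \<diamondop> m) \<star> (c \<triangleright> MAssoc M (fst X) (fst Y) m)"
proof -
  let ?XY = "center_tensor C X Y" and ?x = "fst X" and ?y = "fst Y"
  have XY: "fst ?XY = ?x \<otimes> ?y" "snd ?XY c = inv_arr C (Assoc C ?x ?y c) \<cdot>
      (Idn C ?x \<boxtimes> snd Y c) \<cdot> Assoc C ?x c ?y \<cdot> (snd X c \<boxtimes> Idn C ?y) \<cdot> inv_arr C (Assoc C c ?x ?y)"
    by (simp_all add: center_tensor_def split: prod.split)
  have "MAssocL C M ?x ?y c m \<star> (snd ?XY c \<triangleleft> m) =
      (?x \<triangleright> slide M Y c m) \<star> slide M X c (?y \<diamondop> m) \<star> MAssocR C M c ?x ?y m"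
    by (simp add: XY Rwhisk_Comp MAssocL_inv_Assoc slide_MAssocL slide_MAssocR
        M.Comp_reassoc[OF MAssocL_inv_Assoc] M.Comp_reassoc[OF slide_MAssocL]
        M.Comp_reassoc[OF slide_MAssocR] M.Comp_reassoc[OF MAssocR_Assoc])
  then have "(MAssoc M ?x ?y (c \<diamondop> m) \<star> slide M ?XY c m) \<star> MAssoc M c (?x \<otimes> ?y) m =
      ((?x \<triangleright> slide M Y c m) \<star> slide M X c (?y \<diamondop> m) \<star> (c \<triangleright> MAssoc M ?x ?y m)) \<star>
        MAssoc M c (?x \<otimes> ?y) m"
    by (simp add: XY slide_def MAssocL_def MAssocR_def)
  then show ?thesis
    by (rule M.iso_cancel_right) (simp_all add: XY slide_def)
qed

end

text \<open>Naturality, hexagon and unit law in strict form, meaningful over every module category.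
  Over \<open>regular C\<close> they are the coherence conditions of a half-braiding; over
  \<open>M\<close> they govern the action on module functors.\<close>

definition slide_laws ::
  "('o, 'a, 'k, 'z) moncat_scheme \<Rightarrow> ('p, 'b, 'k, 'o, 'a, 'y) actcat_scheme \<Rightarrow> ('o, 'a) cobj \<Rightarrow> bool"
where
  "slide_laws C M Z \<longleftrightarrow>
     (\<forall>c d. \<forall>f\<in>Hom C c d. \<forall>m\<in>Obj M. slide M Z d m \<cdot>\<^bsub>M\<^esub> (f \<unrhd>\<^bsub>M\<^esub> Idn M (fst Z \<rhd>\<^bsub>M\<^esub> m)) =
        (Idn C (fst Z) \<unrhd>\<^bsub>M\<^esub> f \<unrhd>\<^bsub>M\<^esub> Idn M m) \<cdot>\<^bsub>M\<^esub> slide M Z c m) \<and>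
     (\<forall>c\<in>Obj C. \<forall>d\<in>Obj C. \<forall>m\<in>Obj M.
        (Idn C (fst Z) \<unrhd>\<^bsub>M\<^esub> MAssoc M c d m) \<cdot>\<^bsub>M\<^esub> slide M Z (c \<otimes>\<^bsub>C\<^esub> d) m =
        slide M Z c (d \<rhd>\<^bsub>M\<^esub> m) \<cdot>\<^bsub>M\<^esub> (Idn C c \<unrhd>\<^bsub>M\<^esub> slide M Z d m) \<cdot>\<^bsub>M\<^esub> MAssoc M c d (fst Z \<rhd>\<^bsub>M\<^esub> m)) \<and>
     (\<forall>m\<in>Obj M. (Idn C (fst Z) \<unrhd>\<^bsub>M\<^esub> MUnit M m) \<cdot>\<^bsub>M\<^esub> slide M Z (Unit C) m =
        MUnit M (fst Z \<rhd>\<^bsub>M\<^esub> m))"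

lemma fst_center_tensor [simp]: "fst (center_tensor C X Y) = fst X \<otimes>\<^bsub>C\<^esub> fst Y"
  by (simp add: center_tensor_def split: prod.split)

lemma fst_center_unit [simp]: "fst (center_unit C) = Unit C"
  by (simp add: center_unit_def)

lemma (in linear_monoidal_category) pre_half_braiding_center_unit [simp]:
  "pre_half_braiding C (center_unit C)"
  by (simp add: pre_half_braiding_def center_unit_def in_Hom)

lemma (in linear_monoidal_category) pre_half_braiding_center_tensor [simp]:
  assumes "pre_half_braiding C X" "pre_half_braiding C Y"
  shows "pre_half_braiding C (center_tensor C X Y)"
proof -
  obtain x \<sigma> y \<tau> where "X = (x, \<sigma>)" "Y = (y, \<tau>)"
    by (cases X, cases Y)
  moreover from this assms have "x \<in> Obj C" "y \<in> Obj C"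
    "c \<in> Obj C \<Longrightarrow> is_iso C (\<sigma> c)" "c \<in> Obj C \<Longrightarrow> Dom C (\<sigma> c) = c \<otimes> x"
    "c \<in> Obj C \<Longrightarrow> Cod C (\<sigma> c) = x \<otimes> c"
    "c \<in> Obj C \<Longrightarrow> is_iso C (\<tau> c)" "c \<in> Obj C \<Longrightarrow> Dom C (\<tau> c) = c \<otimes> y"
    "c \<in> Obj C \<Longrightarrow> Cod C (\<tau> c) = y \<otimes> c" for c
    by (auto simp: pre_half_braiding_def in_Hom)
  ultimately show ?thesis
    by (simp add: pre_half_braiding_def center_tensor_def in_Hom)
qed

section \<open>From the center to slides and back\<close>

context module_category
begin

lemma slide_laws_center_obj:
  assumes "Z \<in> center_obj C"
  shows "slide_laws C M Z"
proof -
  have [simp]: "pre_half_braiding C Z"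
    using assms by (rule center_obj_pre)
  have hb: "half_braiding C (fst Z) (snd Z)"
    using assms by (simp add: center_obj_iff)
  show ?thesis
    unfolding slide_laws_def
  proof (intro conjI allI ballI)
    fix c d f m assume "f \<in> Hom C c d" "m \<in> Obj M"
    then show "slide M Z d m \<star> (f \<triangleleft> (fst Z \<diamondop> m)) = (fst Z \<triangleright> f \<triangleleft> m) \<star> slide M Z c m"
      using hb by (subst slide_natural_iff[symmetric]) (auto simp: half_braiding_def)
  next
    fix c d m assume "c \<in> Obj C" "d \<in> Obj C" "m \<in> Obj M"
    then show "(fst Z \<triangleright> MAssoc M c d m) \<star> slide M Z (c \<otimes> d) m =
        slide M Z c (d \<diamondop> m) \<star> (c \<triangleright> slide M Z d m) \<star> MAssoc M c d (fst Z \<diamondop> m)"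
      using hb by (subst slide_hexagon_iff[symmetric]) (auto simp: half_braiding_def)
  next
    fix m assume "m \<in> Obj M"
    then show "(fst Z \<triangleright> MUnit M m) \<star> slide M Z (Unit C) m = MUnit M (fst Z \<diamondop> m)"
      using hb by (subst slide_unit_iff[symmetric]) (auto simp: half_braiding_def)
  qed
qed

lemma center_arr_slide:
  assumes "(X, f, Y) \<in> center_arr C" "c \<in> Obj C" "m \<in> Obj M"
  shows "(f \<triangleleft> (c \<diamondop> m)) \<star> slide M X c m = slide M Y c m \<star> (c \<triangleright> f \<triangleleft> m)"
  using assms by (subst slide_morphism_iff[symmetric]) (auto simp: center_arr_def center_obj_pre)

end

context linear_monoidal_category
begin

text \<open>At \<open>m = Unit C\<close> each law is, up to conjugation by associators, the
  corresponding axiom of a half-braiding tensored with the unit, and tensoring with the unit is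
  faithful.\<close>

lemma center_objI:
  assumes pre: "pre_half_braiding C Z" and ext: "snd Z \<in> extensional (Obj C)"
    and laws: "slide_laws C (regular C) Z"
  shows "Z \<in> center_obj C"
proof -
  interpret R: module_category C "regular C"
    by (rule module_category_regular)
  note [simp] = pre
  have "snd Z d \<cdot> (f \<boxtimes> Idn C (fst Z)) = (Idn C (fst Z) \<boxtimes> f) \<cdot> snd Z c" if f: "f \<in> Hom C c d" for c d f
  proof -
    have [simp]: "f \<in> Arr C" "Dom C f = c" "Cod C f = d" "c \<in> Obj C" "d \<in> Obj C"
      using f Dom_in Cod_in by (auto simp: in_Hom)
    have "(snd Z d \<cdot> (f \<boxtimes> Idn C (fst Z))) \<boxtimes> Idn C (Unit C) =
        ((Idn C (fst Z) \<boxtimes> f) \<cdot> snd Z c) \<boxtimes> Idn C (Unit C)"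
      using laws[unfolded slide_laws_def, THEN conjunct1, rule_format, OF f, of "Unit C"]
        R.slide_natural_iff[OF pre _ f, of "Unit C"]
      by simp
    then show ?thesis
      by (rule TArr_Unit_faithful[of _ "c \<otimes> fst Z" "fst Z \<otimes> d", rotated 2]) (simp_all add: in_Hom)
  qed
  moreover have "snd Z (c \<otimes> d) = Assoc C (fst Z) c d \<cdot> (snd Z c \<boxtimes> Idn C d) \<cdot>
      inv_arr C (Assoc C c (fst Z) d) \<cdot> (Idn C c \<boxtimes> snd Z d) \<cdot> Assoc C c d (fst Z)"
    if [simp]: "c \<in> Obj C" "d \<in> Obj C" for c d
  proof (rule TArr_Unit_faithful[of _ "(c \<otimes> d) \<otimes> fst Z" "fst Z \<otimes> c \<otimes> d", rotated 2])
    show "snd Z (c \<otimes> d) \<boxtimes> Idn C (Unit C) =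
        (Assoc C (fst Z) c d \<cdot> (snd Z c \<boxtimes> Idn C d) \<cdot> inv_arr C (Assoc C c (fst Z) d) \<cdot>
          (Idn C c \<boxtimes> snd Z d) \<cdot> Assoc C c d (fst Z)) \<boxtimes> Idn C (Unit C)"
      using laws[unfolded slide_laws_def, THEN conjunct2, THEN conjunct1, rule_format, of c d "Unit C"]
      R.slide_hexagon_iff[OF pre, of c d "Unit C"]
      by simp
  qed (simp_all add: in_Hom)
  moreover have "RUnit C (fst Z) \<cdot> snd Z (Unit C) = LUnit C (fst Z)"
  proof (rule TArr_Unit_faithful[of _ "Unit C \<otimes> fst Z" "fst Z", rotated 2])
    show "(RUnit C (fst Z) \<cdot> snd Z (Unit C)) \<boxtimes> Idn C (Unit C) = LUnit C (fst Z) \<boxtimes> Idn C (Unit C)"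
      using laws[unfolded slide_laws_def, THEN conjunct2, THEN conjunct2, rule_format, of "Unit C"]
      R.slide_unit_iff[OF pre, of "Unit C"]
      by simp
  qed (simp_all add: in_Hom)
  ultimately show ?thesis
    using pre ext unfolding center_obj_iff half_braiding_def pre_half_braiding_def by blast
qed

text \<open>The device of \<open>center_objI\<close> for arrows. The required exchanges with slides
  are supplied for the structural arrows by \<open>slide_Assoc\<close>, \<open>slide_LUnit\<close>,
  \<open>slide_RUnit\<close>, \<open>slide_TArr\<close> and \<open>slide_Braid\<close>.\<close>

lemma center_arrI:
  assumes "X \<in> center_obj C" "Y \<in> center_obj C" and f: "f \<in> Hom C (fst X) (fst Y)"
    and slide: "\<And>c m. c \<in> Obj C \<Longrightarrow> m \<in> Obj C \<Longrightarrow>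
      (f \<boxtimes> Idn C (c \<otimes> m)) \<cdot> slide (regular C) X c m =
      slide (regular C) Y c m \<cdot> (Idn C c \<boxtimes> f \<boxtimes> Idn C m)"
  shows "(X, f, Y) \<in> center_arr C"
proof -
  interpret R: module_category C "regular C"
    by (rule module_category_regular)
  have pre [simp]: "pre_half_braiding C X" "pre_half_braiding C Y"
    using assms(1,2) by (simp_all add: center_obj_pre)
  have [simp]: "f \<in> Arr C" "Dom C f = fst X" "Cod C f = fst Y"
    using f by (auto simp: in_Hom)
  have "(f \<boxtimes> Idn C c) \<cdot> snd X c = snd Y c \<cdot> (Idn C c \<boxtimes> f)" if [simp]: "c \<in> Obj C" for c
  proof (rule TArr_Unit_faithful[of _ "c \<otimes> fst X" "fst Y \<otimes> c", rotated 2])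
    show "((f \<boxtimes> Idn C c) \<cdot> snd X c) \<boxtimes> Idn C (Unit C) =
        (snd Y c \<cdot> (Idn C c \<boxtimes> f)) \<boxtimes> Idn C (Unit C)"
      using slide[of c "Unit C"] R.slide_morphism_iff[OF pre _ _ f, of c "Unit C"]
      by simp
  qed (simp_all add: in_Hom)
  then show ?thesis
    using assms(1-3) by (simp add: center_arr_def)
qed

end

subsection \<open>The monoidal structure of the center\<close>

context module_category
begin

lemma Lwhisk_eq:
  assumes "v \<star> u = w" "c \<in> Obj C" "u \<in> Arr M" "v \<in> Arr M" "Cod M u = Dom M v"
  shows "(c \<triangleright> v) \<star> (c \<triangleright> u) = c \<triangleright> w"
  using assms Lwhisk_Comp[of c u v] by simp

lemma slide_lawsD:
  assumes "slide_laws C M Z"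
  shows "f \<in> Hom C c d \<Longrightarrow> m \<in> Obj M \<Longrightarrow>
      slide M Z d m \<star> (f \<triangleleft> (fst Z \<diamondop> m)) = (fst Z \<triangleright> f \<triangleleft> m) \<star> slide M Z c m"
    and "c \<in> Obj C \<Longrightarrow> d \<in> Obj C \<Longrightarrow> m \<in> Obj M \<Longrightarrow>
      (fst Z \<triangleright> MAssoc M c d m) \<star> slide M Z (c \<otimes> d) m =
      slide M Z c (d \<diamondop> m) \<star> (c \<triangleright> slide M Z d m) \<star> MAssoc M c d (fst Z \<diamondop> m)"
    and "m \<in> Obj M \<Longrightarrow>
      (fst Z \<triangleright> MUnit M m) \<star> slide M Z (Unit C) m = MUnit M (fst Z \<diamondop> m)"
  using assms unfolding slide_laws_def by blast+

text \<open>The half-braiding of the unit consists of two unitors: \<open>MUnit_MAssoc\<close>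
  cancels the inverse of the left one and the module triangle rewrites the right one. So the slide
  is trivial once \<open>Unit C \<rhd> m\<close> is identified with \<open>m\<close>.\<close>

lemma slide_center_unit:
  assumes [simp]: "c \<in> Obj C" "m \<in> Obj M"
  shows "MUnit M (c \<diamondop> m) \<star> slide M (center_unit C) c m = c \<triangleright> MUnit M m"
proof -
  have "(MUnit M (c \<diamondop> m) \<star> slide M (center_unit C) c m) \<star> MAssoc M c (Unit C) m =
      (LUnit C c \<triangleleft> m) \<star> (inv_arr C (LUnit C c) \<triangleleft> m) \<star> (RUnit C c \<triangleleft> m)"
      using slide_MAssoc[of "center_unit C" c m]
    by (simp add: M.Comp_reassoc[OF MUnit_MAssoc])
      (simp add: center_unit_def Rwhisk_Comp)
  also have "\<dots> = (c \<triangleright> MUnit M m) \<star> MAssoc M c (Unit C) m"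
    by (simp add: M.Comp_reassoc[OF Rwhisk_inv(1)] module_triangle)
  finally show ?thesis
    by (rule M.iso_cancel_right) simp_all
qed

text \<open>Each law is compared after composition with the invertible \<open>MUnit\<close>. There
  \<open>slide_center_unit\<close> leaves only interchange and the naturality of
  \<open>MUnit\<close> and \<open>MAssoc\<close>.\<close>

lemma slide_laws_center_unit: "slide_laws C M (center_unit C)"
  unfolding slide_laws_def fst_center_unit
proof (intro conjI allI ballI)
  let ?s = "slide M (center_unit C)" and ?e = "Unit C"
  fix c d f m assume f: "f \<in> Hom C c d" and [simp]: "m \<in> Obj M"
  have [simp]: "f \<in> Arr C" "Dom C f = c" "Cod C f = d" "c \<in> Obj C" "d \<in> Obj C"
    using f C.Dom_in C.Cod_in by (auto simp: in_Hom)
  have "MUnit M (d \<diamondop> m) \<star> (?s d m \<star> (f \<triangleleft> (?e \<diamondop> m))) = (d \<triangleright> MUnit M m) \<star> (f \<triangleleft> (?e \<diamondop> m))"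
    by (simp add: M.Comp_reassoc[OF slide_center_unit])
  also have "\<dots> = (f \<triangleleft> m) \<star> MUnit M (c \<diamondop> m) \<star> ?s c m"
    by (simp add: slide_center_unit whisk_swap[OF f, of _ "?e \<diamondop> m" m] in_Hom)
  also have "\<dots> = MUnit M (d \<diamondop> m) \<star> ((?e \<triangleright> f \<triangleleft> m) \<star> ?s c m)"
    by (simp add: in_Hom M.Comp_reassoc[OF MUnit_nat[of "f \<triangleleft> m" "c \<diamondop> m" "d \<diamondop> m"]])
  finally show "?s d m \<star> (f \<triangleleft> (?e \<diamondop> m)) = (?e \<triangleright> f \<triangleleft> m) \<star> ?s c m"
    by (rule M.iso_cancel_left) simp_all
next
  let ?s = "slide M (center_unit C)" and ?e = "Unit C"
  fix c d m assume [simp]: "c \<in> Obj C" "d \<in> Obj C" "m \<in> Obj M"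
  note nat = MUnit_nat[of "MAssoc M c d m" "(c \<otimes> d) \<diamondop> m" "c \<diamondop> d \<diamondop> m"]
  have "MUnit M (c \<diamondop> d \<diamondop> m) \<star> ((?e \<triangleright> MAssoc M c d m) \<star> ?s (c \<otimes> d) m) =
      MAssoc M c d m \<star> ((c \<otimes> d) \<triangleright> MUnit M m)"
    by (simp add: M.Comp_reassoc[OF nat] slide_center_unit in_Hom)
  also have "\<dots> = (c \<triangleright> d \<triangleright> MUnit M m) \<star> MAssoc M c d (?e \<diamondop> m)"
    by (simp add: MAssoc_nat3[of _ "?e \<diamondop> m" m] in_Hom)
  also have "\<dots> = MUnit M (c \<diamondop> d \<diamondop> m) \<star> (?s c (d \<diamondop> m) \<star> (c \<triangleright> ?s d m) \<star> MAssoc M c d (?e \<diamondop> m))"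
    by (simp add: M.Comp_reassoc[OF slide_center_unit]
        M.Comp_reassoc[OF Lwhisk_eq[OF slide_center_unit]])
  finally show "(?e \<triangleright> MAssoc M c d m) \<star> ?s (c \<otimes> d) m =
      ?s c (d \<diamondop> m) \<star> (c \<triangleright> ?s d m) \<star> MAssoc M c d (?e \<diamondop> m)"
    by (rule M.iso_cancel_left) simp_all
next
  let ?s = "slide M (center_unit C)" and ?e = "Unit C"
  fix m assume [simp]: "m \<in> Obj M"
  note nat = MUnit_nat[of "MUnit M m" "?e \<diamondop> m" m]
  have "MUnit M m \<star> ((?e \<triangleright> MUnit M m) \<star> ?s ?e m) = MUnit M m \<star> MUnit M (?e \<diamondop> m)"
    by (simp add: M.Comp_reassoc[OF nat] slide_center_unit nat in_Hom)
  then show "(?e \<triangleright> MUnit M m) \<star> ?s ?e m = MUnit M (?e \<diamondop> m)"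
    by (rule M.iso_cancel_left) simp_all
qed

text \<open>Composition with the invertible \<open>MAssoc\<close> for \<open>X\<close> and
  \<open>Y\<close> splits the slide of the tensor product into slides of the factors, to which the
  assumed laws apply.\<close>

lemma slide_laws_center_tensor:
  assumes [simp]: "pre_half_braiding C X" "pre_half_braiding C Y"
    and X: "slide_laws C M X" and Y: "slide_laws C M Y"
  shows "slide_laws C M (center_tensor C X Y)"
  unfolding slide_laws_def fst_center_tensor
proof (intro conjI allI ballI)
  let ?s = "slide M (center_tensor C X Y)" and ?x = "fst X" and ?y = "fst Y"
  fix c d f m assume f: "f \<in> Hom C c d" and [simp]: "m \<in> Obj M"
  have [simp]: "f \<in> Arr C" "Dom C f = c" "Cod C f = d" "c \<in> Obj C" "d \<in> Obj C"
    using f C.Dom_in C.Cod_in by (auto simp: in_Hom)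
  have "MAssoc M ?x ?y (d \<diamondop> m) \<star> (?s d m \<star> (f \<triangleleft> ((?x \<otimes> ?y) \<diamondop> m))) =
      (?x \<triangleright> slide M Y d m) \<star> slide M X d (?y \<diamondop> m) \<star> (d \<triangleright> MAssoc M ?x ?y m) \<star>
        (f \<triangleleft> ((?x \<otimes> ?y) \<diamondop> m))"
    by (simp add: M.Comp_reassoc[OF slide_tensor])
  also have "\<dots> = (?x \<triangleright> slide M Y d m) \<star> slide M X d (?y \<diamondop> m) \<star> (f \<triangleleft> (?x \<diamondop> ?y \<diamondop> m)) \<star>
      (c \<triangleright> MAssoc M ?x ?y m)"
    by (simp add: whisk_swap[OF f, of _ "(?x \<otimes> ?y) \<diamondop> m" "?x \<diamondop> ?y \<diamondop> m"] in_Hom)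
  also have "\<dots> = (?x \<triangleright> ?y \<triangleright> f \<triangleleft> m) \<star> (?x \<triangleright> slide M Y c m) \<star> slide M X c (?y \<diamondop> m) \<star>
      (c \<triangleright> MAssoc M ?x ?y m)"
    by (simp add: M.Comp_reassoc[OF slide_lawsD(1)[OF X f]] Lwhisk_Comp
        M.Comp_reassoc[OF Lwhisk_eq[OF slide_lawsD(1)[OF Y f]]])
  also have "\<dots> = (?x \<triangleright> ?y \<triangleright> f \<triangleleft> m) \<star> MAssoc M ?x ?y (c \<diamondop> m) \<star> ?s c m"
    by (simp add: slide_tensor)
  also have "\<dots> = MAssoc M ?x ?y (d \<diamondop> m) \<star> (((?x \<otimes> ?y) \<triangleright> f \<triangleleft> m) \<star> ?s c m)"
    by (simp add: M.Comp_reassoc[OF MAssoc_nat3[of "f \<triangleleft> m" "c \<diamondop> m" "d \<diamondop> m"]] in_Hom)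
  finally show "?s d m \<star> (f \<triangleleft> ((?x \<otimes> ?y) \<diamondop> m)) = ((?x \<otimes> ?y) \<triangleright> f \<triangleleft> m) \<star> ?s c m"
    by (rule M.iso_cancel_left) simp_all
next
  let ?s = "slide M (center_tensor C X Y)" and ?x = "fst X" and ?y = "fst Y"
  fix c d m assume [simp]: "c \<in> Obj C" "d \<in> Obj C" "m \<in> Obj M"
  let ?a = "MAssoc M ?x ?y m"
  have "MAssoc M ?x ?y (c \<diamondop> d \<diamondop> m) \<star> (?s c (d \<diamondop> m) \<star> (c \<triangleright> ?s d m) \<star>
        MAssoc M c d ((?x \<otimes> ?y) \<diamondop> m)) =
      (?x \<triangleright> slide M Y c (d \<diamondop> m)) \<star> slide M X c (?y \<diamondop> d \<diamondop> m) \<star> (c \<triangleright> ?x \<triangleright> slide M Y d m) \<star>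
        (c \<triangleright> slide M X d (?y \<diamondop> m)) \<star> (c \<triangleright> d \<triangleright> ?a) \<star> MAssoc M c d ((?x \<otimes> ?y) \<diamondop> m)"
    by (simp add: M.Comp_reassoc[OF slide_tensor] Lwhisk_Comp
        M.Comp_reassoc[OF Lwhisk_eq[OF slide_tensor]])
  \<comment> \<open>Moving \<open>c\<close> past \<open>X\<close> and moving \<open>d\<close> past
    \<open>Y\<close> take place at different levels of the nesting, so naturality of the slide of
    \<open>X\<close> in the module variable exchanges them.\<close>
  also have "\<dots> = (?x \<triangleright> slide M Y c (d \<diamondop> m)) \<star> (?x \<triangleright> c \<triangleright> slide M Y d m) \<star>
      slide M X c (d \<diamondop> ?y \<diamondop> m) \<star>
        (c \<triangleright> slide M X d (?y \<diamondop> m)) \<star> MAssoc M c d (?x \<diamondop> ?y \<diamondop> m) \<star> ((c \<otimes> d) \<triangleright> ?a)"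
    by (simp add: MAssoc_nat3[of _ "(?x \<otimes> ?y) \<diamondop> m" "?x \<diamondop> ?y \<diamondop> m"] in_Hom
        M.Comp_reassoc[OF slide_natural[of X c "slide M Y d m" "d \<diamondop> ?y \<diamondop> m" "?y \<diamondop> d \<diamondop> m"]])
  also have "\<dots> = (?x \<triangleright> slide M Y c (d \<diamondop> m)) \<star> (?x \<triangleright> c \<triangleright> slide M Y d m) \<star>
      (?x \<triangleright> MAssoc M c d (?y \<diamondop> m)) \<star> slide M X (c \<otimes> d) (?y \<diamondop> m) \<star> ((c \<otimes> d) \<triangleright> ?a)"
    by (simp add: M.Comp_reassoc[OF slide_lawsD(2)[OF X]])
  also have "\<dots> = (?x \<triangleright> (slide M Y c (d \<diamondop> m) \<star> (c \<triangleright> slide M Y d m) \<star>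
      MAssoc M c d (?y \<diamondop> m))) \<star> slide M X (c \<otimes> d) (?y \<diamondop> m) \<star> ((c \<otimes> d) \<triangleright> ?a)"
    by (simp add: Lwhisk_Comp)
  also have "\<dots> = (?x \<triangleright> ?y \<triangleright> MAssoc M c d m) \<star> (?x \<triangleright> slide M Y (c \<otimes> d) m) \<star>
      slide M X (c \<otimes> d) (?y \<diamondop> m) \<star> ((c \<otimes> d) \<triangleright> ?a)"
    by (subst slide_lawsD(2)[OF Y, symmetric]) (simp_all add: Lwhisk_Comp)
  also have "\<dots> = (?x \<triangleright> ?y \<triangleright> MAssoc M c d m) \<star> MAssoc M ?x ?y ((c \<otimes> d) \<diamondop> m) \<star> ?s (c \<otimes> d) m"
    by (simp add: slide_tensor)
  also have "\<dots> = MAssoc M ?x ?y (c \<diamondop> d \<diamondop> m) \<star> (((?x \<otimes> ?y) \<triangleright> MAssoc M c d m) \<star> ?s (c \<otimes> d) m)"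
    by (simp add: in_Hom
        M.Comp_reassoc[OF MAssoc_nat3[of "MAssoc M c d m" "(c \<otimes> d) \<diamondop> m" "c \<diamondop> d \<diamondop> m"]])
  finally have "?s c (d \<diamondop> m) \<star> (c \<triangleright> ?s d m) \<star> MAssoc M c d ((?x \<otimes> ?y) \<diamondop> m) =
      ((?x \<otimes> ?y) \<triangleright> MAssoc M c d m) \<star> ?s (c \<otimes> d) m"
    by (rule M.iso_cancel_left) simp_all
  then show "((?x \<otimes> ?y) \<triangleright> MAssoc M c d m) \<star> ?s (c \<otimes> d) m =
      ?s c (d \<diamondop> m) \<star> (c \<triangleright> ?s d m) \<star> MAssoc M c d ((?x \<otimes> ?y) \<diamondop> m)"
    by simp
next
  let ?s = "slide M (center_tensor C X Y)" and ?x = "fst X" and ?y = "fst Y" and ?e = "Unit C"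
  fix m assume [simp]: "m \<in> Obj M"
  have "MAssoc M ?x ?y m \<star> (((?x \<otimes> ?y) \<triangleright> MUnit M m) \<star> ?s ?e m) =
      (?x \<triangleright> ?y \<triangleright> MUnit M m) \<star> (?x \<triangleright> slide M Y ?e m) \<star> slide M X ?e (?y \<diamondop> m) \<star>
        (?e \<triangleright> MAssoc M ?x ?y m)"
    by (simp add: M.Comp_reassoc[OF MAssoc_nat3[of _ "?e \<diamondop> m" m]] slide_tensor in_Hom)
  also have "\<dots> = MUnit M (?x \<diamondop> ?y \<diamondop> m) \<star> (?e \<triangleright> MAssoc M ?x ?y m)"
    by (simp add: M.Comp_reassoc[OF Lwhisk_eq[OF slide_lawsD(3)[OF Y]]]
        M.Comp_reassoc[OF slide_lawsD(3)[OF X]])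
  also have "\<dots> = MAssoc M ?x ?y m \<star> MUnit M ((?x \<otimes> ?y) \<diamondop> m)"
    by (simp add: MUnit_nat[of _ "(?x \<otimes> ?y) \<diamondop> m" "?x \<diamondop> ?y \<diamondop> m"] in_Hom)
  finally show "((?x \<otimes> ?y) \<triangleright> MUnit M m) \<star> ?s ?e m = MUnit M ((?x \<otimes> ?y) \<diamondop> m)"
    by (rule M.iso_cancel_left) simp_all
qed


text \<open>In the bracket-free action both bracketings yield the same composite \<open>?s\<close>:
  \<open>c\<close> passes \<open>X\<close>, then \<open>Y\<close>, then \<open>Z\<close>.\<close>

lemma slide_Assoc:
  assumes [simp]: "pre_half_braiding C X" "pre_half_braiding C Y" "pre_half_braiding C Z"
    "c \<in> Obj C" "m \<in> Obj M"
  shows "(Assoc C (fst X) (fst Y) (fst Z) \<triangleleft> (c \<diamondop> m)) \<star>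
      slide M (center_tensor C (center_tensor C X Y) Z) c m =
    slide M (center_tensor C X (center_tensor C Y Z)) c m \<star>
      (c \<triangleright> Assoc C (fst X) (fst Y) (fst Z) \<triangleleft> m)"
proof -
  let ?x = "fst X" and ?y = "fst Y" and ?z = "fst Z"
  let ?XY = "center_tensor C X Y" and ?YZ = "center_tensor C Y Z"
  let ?R = "MAssocR C M ?x ?y ?z (c \<diamondop> m)"
  let ?s = "(?x \<triangleright> ?y \<triangleright> slide M Z c m) \<star> (?x \<triangleright> slide M Y c (?z \<diamondop> m)) \<star> slide M X c (?y \<diamondop> ?z \<diamondop> m)"
  note XYZ = slide_tensor[of ?XY Z c m, simplified] slide_tensor[of X ?YZ c m, simplified]
  have "?R \<star> ((Assoc C ?x ?y ?z \<triangleleft> (c \<diamondop> m)) \<star> slide M (center_tensor C ?XY Z) c m) =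
      MAssoc M ?x ?y (?z \<diamondop> c \<diamondop> m) \<star> ((?x \<otimes> ?y) \<triangleright> slide M Z c m) \<star> slide M ?XY c (?z \<diamondop> m) \<star>
        (c \<triangleright> MAssoc M (?x \<otimes> ?y) ?z m)"
    by (simp add: M.Comp_reassoc[OF MAssocR_Assoc] XYZ) (simp add: MAssocL_def XYZ)
  also have "\<dots> = (?x \<triangleright> ?y \<triangleright> slide M Z c m) \<star> MAssoc M ?x ?y (c \<diamondop> ?z \<diamondop> m) \<star>
      slide M ?XY c (?z \<diamondop> m) \<star> (c \<triangleright> MAssoc M (?x \<otimes> ?y) ?z m)"
    by (simp add: in_Hom
        M.Comp_reassoc[OF MAssoc_nat3[of "slide M Z c m" "c \<diamondop> ?z \<diamondop> m" "?z \<diamondop> c \<diamondop> m"]])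
  also have "\<dots> = ?s \<star> (c \<triangleright> MAssocL C M ?x ?y ?z m)"
    by (simp add: M.Comp_reassoc[OF slide_tensor]) (simp add: MAssocL_def Lwhisk_Comp)
  also have "\<dots> = ?s \<star> (c \<triangleright> MAssocR C M ?x ?y ?z m) \<star> (c \<triangleright> Assoc C ?x ?y ?z \<triangleleft> m)"
    by (simp add: Lwhisk_Comp flip: MAssocR_Assoc)
  \<comment> \<open>From here \<open>?s\<close> is reassembled for the other bracketing;
    \<open>MAssoc\<close> of \<open>Y\<close> and \<open>Z\<close> moves through the slide of
    \<open>X\<close> by naturality.\<close>
  also have "\<dots> = (?x \<triangleright> ?y \<triangleright> slide M Z c m) \<star> (?x \<triangleright> slide M Y c (?z \<diamondop> m)) \<star>
      (?x \<triangleright> c \<triangleright> MAssoc M ?y ?z m) \<star> slide M X c ((?y \<otimes> ?z) \<diamondop> m) \<star>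
        (c \<triangleright> MAssoc M ?x (?y \<otimes> ?z) m) \<star> (c \<triangleright> Assoc C ?x ?y ?z \<triangleleft> m)"
    by (simp add: MAssocR_def Lwhisk_Comp in_Hom
        M.Comp_reassoc[OF slide_natural[of X c "MAssoc M ?y ?z m" "(?y \<otimes> ?z) \<diamondop> m" "?y \<diamondop> ?z \<diamondop> m"]])
  also have "\<dots> = (?x \<triangleright> ((?y \<triangleright> slide M Z c m) \<star> slide M Y c (?z \<diamondop> m) \<star>
      (c \<triangleright> MAssoc M ?y ?z m))) \<star> slide M X c ((?y \<otimes> ?z) \<diamondop> m) \<star>
        (c \<triangleright> MAssoc M ?x (?y \<otimes> ?z) m) \<star> (c \<triangleright> Assoc C ?x ?y ?z \<triangleleft> m)"
    by (simp add: Lwhisk_Comp)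
  also have "\<dots> = ?R \<star> (slide M (center_tensor C X ?YZ) c m \<star> (c \<triangleright> Assoc C ?x ?y ?z \<triangleleft> m))"
    by (subst slide_tensor[symmetric])
      (simp_all add: MAssocR_def Lwhisk_Comp XYZ M.Comp_reassoc[OF XYZ(2)])
  finally show ?thesis
    by (rule M.iso_cancel_left) simp_all
qed

text \<open>\<open>LUnit\<close> acts as \<open>MUnit\<close> after \<open>MAssoc\<close>, and
  \<open>MUnit\<close> absorbs the slide of the unit object. For \<open>RUnit\<close> the module
  triangle takes the place of \<open>MUnit_MAssoc\<close>.\<close>

lemma slide_LUnit:
  assumes [simp]: "pre_half_braiding C X" "c \<in> Obj C" "m \<in> Obj M"
  shows "(LUnit C (fst X) \<triangleleft> (c \<diamondop> m)) \<star> slide M (center_tensor C (center_unit C) X) c m =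
    slide M X c m \<star> (c \<triangleright> LUnit C (fst X) \<triangleleft> m)"
proof -
  let ?x = "fst X" and ?e = "Unit C"
  have "(LUnit C ?x \<triangleleft> (c \<diamondop> m)) \<star> slide M (center_tensor C (center_unit C) X) c m =
      MUnit M (?x \<diamondop> c \<diamondop> m) \<star> (?e \<triangleright> slide M X c m) \<star> slide M (center_unit C) c (?x \<diamondop> m) \<star>
        (c \<triangleright> MAssoc M ?e ?x m)"
    using slide_tensor[of "center_unit C" X c m] by (simp flip: MUnit_MAssoc)
  also have "\<dots> = slide M X c m \<star> (c \<triangleright> MUnit M (?x \<diamondop> m)) \<star> (c \<triangleright> MAssoc M ?e ?x m)"
    by (simp add: in_Hom M.Comp_reassoc[OF slide_center_unit]
        M.Comp_reassoc[OF MUnit_nat[of "slide M X c m" "c \<diamondop> ?x \<diamondop> m" "?x \<diamondop> c \<diamondop> m"]])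
  also have "\<dots> = slide M X c m \<star> (c \<triangleright> LUnit C ?x \<triangleleft> m)"
    by (simp add: Lwhisk_Comp flip: MUnit_MAssoc)
  finally show ?thesis .
qed

lemma slide_RUnit:
  assumes [simp]: "pre_half_braiding C X" "c \<in> Obj C" "m \<in> Obj M"
  shows "(RUnit C (fst X) \<triangleleft> (c \<diamondop> m)) \<star> slide M (center_tensor C X (center_unit C)) c m =
    slide M X c m \<star> (c \<triangleright> RUnit C (fst X) \<triangleleft> m)"
proof -
  let ?x = "fst X" and ?e = "Unit C"
  have "(RUnit C ?x \<triangleleft> (c \<diamondop> m)) \<star> slide M (center_tensor C X (center_unit C)) c m =
      (?x \<triangleright> MUnit M (c \<diamondop> m)) \<star> (?x \<triangleright> slide M (center_unit C) c m) \<star> slide M X c (?e \<diamondop> m) \<star>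
        (c \<triangleright> MAssoc M ?x ?e m)"
    using slide_tensor[of X "center_unit C" c m] by (simp flip: module_triangle)
  also have "\<dots> = slide M X c m \<star> (c \<triangleright> ?x \<triangleright> MUnit M m) \<star> (c \<triangleright> MAssoc M ?x ?e m)"
    by (simp add: in_Hom M.Comp_reassoc[OF Lwhisk_eq[OF slide_center_unit]]
        M.Comp_reassoc[OF slide_natural[of X c "MUnit M m" "?e \<diamondop> m" m, symmetric]])
  also have "\<dots> = slide M X c m \<star> (c \<triangleright> RUnit C ?x \<triangleleft> m)"
    by (simp add: Lwhisk_Comp flip: module_triangle)
  finally show ?thesis .
qed

text \<open>The arrows \<open>f\<close> and \<open>g\<close> pass their slides at different levels.
  The exchange for \<open>f\<close> is assumed at all module objects because it is applied at
  \<open>fst Y' \<diamondop> m\<close>, whereas \<open>g\<close> is innermost and meets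
  \<open>m\<close> itself.\<close>

lemma slide_TArr:
  assumes [simp]: "pre_half_braiding C X" "pre_half_braiding C X'" "pre_half_braiding C Y"
      "pre_half_braiding C Y'" "c \<in> Obj C" "m \<in> Obj M"
    and f: "f \<in> Hom C (fst X) (fst X')" and g: "g \<in> Hom C (fst Y) (fst Y')"
    and slide_f: "\<And>m. m \<in> Obj M \<Longrightarrow> (f \<triangleleft> (c \<diamondop> m)) \<star> slide M X c m = slide M X' c m \<star> (c \<triangleright> f \<triangleleft> m)"
    and slide_g: "(g \<triangleleft> (c \<diamondop> m)) \<star> slide M Y c m = slide M Y' c m \<star> (c \<triangleright> g \<triangleleft> m)"
  shows "((f \<boxtimes> g) \<triangleleft> (c \<diamondop> m)) \<star> slide M (center_tensor C X Y) c m =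
    slide M (center_tensor C X' Y') c m \<star> (c \<triangleright> (f \<boxtimes> g) \<triangleleft> m)"
proof -
  let ?x = "fst X" and ?x' = "fst X'" and ?y = "fst Y" and ?y' = "fst Y'"
  have [simp]: "f \<in> Arr C" "Dom C f = ?x" "Cod C f = ?x'" "g \<in> Arr C" "Dom C g = ?y" "Cod C g = ?y'"
    using f g by (auto simp: in_Hom)
  have nat: "MAssoc M ?x' ?y' n \<star> ((f \<boxtimes> g) \<triangleleft> n) =
      (f \<triangleleft> (?y' \<diamondop> n)) \<star> (?x \<triangleright> g \<triangleleft> n) \<star> MAssoc M ?x ?y n" if [simp]: "n \<in> Obj M" for n
    using MAssoc_nat[OF f g, of "Idn M n" n n]
      M.Comp_reassoc[OF whisk_eq_AArr(1)[OF f, of "g \<triangleleft> n" "?y \<diamondop> n" "?y' \<diamondop> n"], of "MAssoc M ?x ?y n"]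
    by (simp add: in_Hom)
  have "MAssoc M ?x' ?y' (c \<diamondop> m) \<star> (((f \<boxtimes> g) \<triangleleft> (c \<diamondop> m)) \<star> slide M (center_tensor C X Y) c m) =
      (f \<triangleleft> (?y' \<diamondop> c \<diamondop> m)) \<star> (?x \<triangleright> g \<triangleleft> (c \<diamondop> m)) \<star> (?x \<triangleright> slide M Y c m) \<star>
        slide M X c (?y \<diamondop> m) \<star> (c \<triangleright> MAssoc M ?x ?y m)"
    by (simp add: M.Comp_reassoc[OF nat] slide_tensor)
  also have "\<dots> = (f \<triangleleft> (?y' \<diamondop> c \<diamondop> m)) \<star> (?x \<triangleright> slide M Y' c m) \<star> (?x \<triangleright> c \<triangleright> g \<triangleleft> m) \<star>
        slide M X c (?y \<diamondop> m) \<star> (c \<triangleright> MAssoc M ?x ?y m)"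
    by (simp add: M.Comp_reassoc[OF Lwhisk_eq[OF slide_g]] Lwhisk_Comp)
  also have "\<dots> = (?x' \<triangleright> slide M Y' c m) \<star> (f \<triangleleft> (c \<diamondop> ?y' \<diamondop> m)) \<star> (?x \<triangleright> c \<triangleright> g \<triangleleft> m) \<star>
        slide M X c (?y \<diamondop> m) \<star> (c \<triangleright> MAssoc M ?x ?y m)"
    by (simp add: in_Hom M.Comp_reassoc[OF
        whisk_swap[OF f, of "slide M Y' c m" "c \<diamondop> ?y' \<diamondop> m" "?y' \<diamondop> c \<diamondop> m"]])
  also have "\<dots> = (?x' \<triangleright> slide M Y' c m) \<star> (f \<triangleleft> (c \<diamondop> ?y' \<diamondop> m)) \<star> slide M X c (?y' \<diamondop> m) \<star>
        (c \<triangleright> ?x \<triangleright> g \<triangleleft> m) \<star> (c \<triangleright> MAssoc M ?x ?y m)"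
    by (simp add: in_Hom M.Comp_reassoc[OF
        slide_natural[of X c "g \<triangleleft> m" "?y \<diamondop> m" "?y' \<diamondop> m", symmetric]])
  also have "\<dots> = (?x' \<triangleright> slide M Y' c m) \<star> slide M X' c (?y' \<diamondop> m) \<star> (c \<triangleright> f \<triangleleft> (?y' \<diamondop> m)) \<star>
        (c \<triangleright> ?x \<triangleright> g \<triangleleft> m) \<star> (c \<triangleright> MAssoc M ?x ?y m)"
    by (simp add: M.Comp_reassoc[OF slide_f])
  also have "\<dots> = (?x' \<triangleright> slide M Y' c m) \<star> slide M X' c (?y' \<diamondop> m) \<star> (c \<triangleright> MAssoc M ?x' ?y' m) \<star>
        (c \<triangleright> (f \<boxtimes> g) \<triangleleft> m)"
    by (simp add: Lwhisk_Comp Lwhisk_eq[OF nat])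
  also have "\<dots> = MAssoc M ?x' ?y' (c \<diamondop> m) \<star>
      (slide M (center_tensor C X' Y') c m \<star> (c \<triangleright> (f \<boxtimes> g) \<triangleleft> m))"
    by (simp add: M.Comp_reassoc[OF slide_tensor])
  finally show ?thesis
    by (rule M.iso_cancel_left) simp_all
qed

text \<open>The Yang--Baxter equation follows from naturality of the half-braiding of \<open>Y\<close> with respect to that of
  \<open>X\<close>, together with its hexagon.\<close>

lemma slide_Yang_Baxter:
  assumes [simp]: "pre_half_braiding C X" "pre_half_braiding C Y" "c \<in> Obj C" "m \<in> Obj M"
    and Y: "slide_laws C M Y"
  shows "slide M Y (fst X) (c \<diamondop> m) \<star> (fst X \<triangleright> slide M Y c m) \<star> slide M X c (fst Y \<diamondop> m) =
    (fst Y \<triangleright> slide M X c m) \<star> slide M Y c (fst X \<diamondop> m) \<star> (c \<triangleright> slide M Y (fst X) m)"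
proof -
  let ?x = "fst X" and ?y = "fst Y"
  have \<sigma>: "snd X c \<in> Hom C (c \<otimes> ?x) (?x \<otimes> c)"
    by (simp add: in_Hom)
  have "((?y \<triangleright> slide M X c m) \<star> slide M Y c (?x \<diamondop> m) \<star> (c \<triangleright> slide M Y ?x m)) \<star>
        MAssoc M c ?x (?y \<diamondop> m) =
      (?y \<triangleright> slide M X c m) \<star> (?y \<triangleright> MAssoc M c ?x m) \<star> slide M Y (c \<otimes> ?x) m"
    by (simp add: slide_lawsD(2)[OF Y])
  also have "\<dots> = (?y \<triangleright> MAssoc M ?x c m) \<star> (?y \<triangleright> snd X c \<triangleleft> m) \<star> slide M Y (c \<otimes> ?x) m"
    by (simp add: M.Comp_reassoc[OF Lwhisk_eq[OF slide_MAssoc]] Lwhisk_Comp)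
  also have "\<dots> = slide M Y ?x (c \<diamondop> m) \<star> (?x \<triangleright> slide M Y c m) \<star> MAssoc M ?x c (?y \<diamondop> m) \<star>
      (snd X c \<triangleleft> (?y \<diamondop> m))"
    by (simp add: M.Comp_reassoc[OF slide_lawsD(2)[OF Y]] flip: slide_lawsD(1)[OF Y \<sigma>])
  also have "\<dots> = (slide M Y ?x (c \<diamondop> m) \<star> (?x \<triangleright> slide M Y c m) \<star> slide M X c (?y \<diamondop> m)) \<star>
      MAssoc M c ?x (?y \<diamondop> m)"
    by (simp add: slide_MAssoc)
  finally have "((?y \<triangleright> slide M X c m) \<star> slide M Y c (?x \<diamondop> m) \<star> (c \<triangleright> slide M Y ?x m)) =
      slide M Y ?x (c \<diamondop> m) \<star> (?x \<triangleright> slide M Y c m) \<star> slide M X c (?y \<diamondop> m)"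
    by (rule M.iso_cancel_right) simp_all
  then show ?thesis
    by simp
qed

text \<open>Under \<open>MAssoc\<close> the braiding becomes the slide of \<open>Y\<close> past the
  object underlying \<open>X\<close>, and each tensor product contributes a pair of slides, so the
  claim reduces to the Yang--Baxter equation.\<close>

lemma slide_Braid:
  assumes [simp]: "pre_half_braiding C X" "pre_half_braiding C Y" "c \<in> Obj C" "m \<in> Obj M"
    and Y: "slide_laws C M Y"
  shows "(snd Y (fst X) \<triangleleft> (c \<diamondop> m)) \<star> slide M (center_tensor C X Y) c m =
    slide M (center_tensor C Y X) c m \<star> (c \<triangleright> snd Y (fst X) \<triangleleft> m)"
proof -
  let ?x = "fst X" and ?y = "fst Y"
  have "MAssoc M ?y ?x (c \<diamondop> m) \<star>
        ((snd Y ?x \<triangleleft> (c \<diamondop> m)) \<star> slide M (center_tensor C X Y) c m) =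
      slide M Y ?x (c \<diamondop> m) \<star> (?x \<triangleright> slide M Y c m) \<star> slide M X c (?y \<diamondop> m) \<star>
        (c \<triangleright> MAssoc M ?x ?y m)"
    by (simp add: M.Comp_reassoc[OF slide_MAssoc[symmetric]] slide_tensor)
  also have "\<dots> = (slide M Y ?x (c \<diamondop> m) \<star> (?x \<triangleright> slide M Y c m) \<star> slide M X c (?y \<diamondop> m)) \<star>
        (c \<triangleright> MAssoc M ?x ?y m)"
    by simp
  also have "\<dots> = (?y \<triangleright> slide M X c m) \<star> slide M Y c (?x \<diamondop> m) \<star> (c \<triangleright> slide M Y ?x m) \<star>
        (c \<triangleright> MAssoc M ?x ?y m)"
    by (subst slide_Yang_Baxter[OF _ _ _ _ Y]) simp_all
  also have "\<dots> = (?y \<triangleright> slide M X c m) \<star> slide M Y c (?x \<diamondop> m) \<star> (c \<triangleright> MAssoc M ?y ?x m) \<star>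
        (c \<triangleright> snd Y ?x \<triangleleft> m)"
    by (simp add: Lwhisk_eq[OF slide_MAssoc] Lwhisk_Comp)
  also have "\<dots> = MAssoc M ?y ?x (c \<diamondop> m) \<star>
      (slide M (center_tensor C Y X) c m \<star> (c \<triangleright> snd Y ?x \<triangleleft> m))"
    by (simp add: M.Comp_reassoc[OF slide_tensor])
  finally show ?thesis
    by (rule M.iso_cancel_left) simp_all
qed

end

section \<open>Arrows of the center and the operations on them\<close>

lemma center_simps [simp]:
  "Obj (center C) = center_obj C" "Arr (center C) = center_arr C"
  "Dom (center C) (X, f, Y) = X" "Cod (center C) (X, f, Y) = Y"
  "Idn (center C) X = (X, Idn C (fst X), X)"
  "Comp (center C) (Y', g, Z) (X, f, Y) = (X, g \<cdot>\<^bsub>C\<^esub> f, Z)"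
  "Plus (center C) (X, f, Y) (X', f', Y') = (X, Plus C f f', Y)"
  "Scal (center C) a (X, f, Y) = (X, Scal C a f, Y)"
  "Zero (center C) X Y = (X, Zero C (fst X) (fst Y), Y)"
  "TObj (center C) = center_tensor C"
  "TArr (center C) (X, f, Y) (X', f', Y') = (center_tensor C X X', f \<boxtimes>\<^bsub>C\<^esub> f', center_tensor C Y Y')"
  "Unit (center C) = center_unit C"
  "Assoc (center C) X Y Z = (center_tensor C (center_tensor C X Y) Z,
     Assoc C (fst X) (fst Y) (fst Z), center_tensor C X (center_tensor C Y Z))"
  "LUnit (center C) X = (center_tensor C (center_unit C) X, LUnit C (fst X), X)"
  "RUnit (center C) X = (center_tensor C X (center_unit C), RUnit C (fst X), X)"
  "Braid (center C) X Y = (center_tensor C X Y, snd Y (fst X), center_tensor C Y X)"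
  by (simp_all add: center_def)

lemma in_Hom_center: "F \<in> Hom (center C) X Y \<longleftrightarrow> (\<exists>f. F = (X, f, Y) \<and> (X, f, Y) \<in> center_arr C)"
  by (cases F) (auto simp: in_Hom)

lemma center_arrD:
  assumes "(X, f, Y) \<in> center_arr C"
  shows "f \<in> Hom C (fst X) (fst Y)" "X \<in> center_obj C" "Y \<in> center_obj C"
  using assms by (simp_all add: center_arr_def)

context linear_category
begin

text \<open>Bilinearity is axiomatised through \<open>Plus\<close> and \<open>Scal\<close>, so facts
  about zero arrows go through the scalar \<open>0 = 1 + (- 1)\<close> and
  \<open>Plus_minus\<close>.\<close>

lemma Scal_zero: "f \<in> Hom C x y \<Longrightarrow> Scal C 0 f = Zero C x y"
  using Scal_add[of f x y 1 "-1"] Scal_one[of f x y] Plus_minus[of f x y] by simp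

lemma Comp_Zero_left: "f \<in> Hom C x y \<Longrightarrow> z \<in> Obj C \<Longrightarrow> Zero C y z \<cdot> f = Zero C x z"
  using Comp_Scal_left[of f x y "Zero C y z" z 0] Zero_in[of y z] Cod_in[of f]
    Scal_zero[of "Zero C y z"] Scal_zero[OF Comp_in[of f x y "Zero C y z" z]]
  by (auto simp: in_Hom)

lemma Comp_Zero_right: "f \<in> Hom C y z \<Longrightarrow> x \<in> Obj C \<Longrightarrow> f \<cdot> Zero C x y = Zero C x z"
  using Comp_Scal_right[of "Zero C x y" x y f z 0] Zero_in[of x y] Dom_in[of f]
    Scal_zero[of "Zero C x y"] Scal_zero[OF Comp_in[of "Zero C x y" x y f z]]
  by (auto simp: in_Hom)

end

section \<open>Closure properties and coherence of the center\<close>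

context linear_monoidal_category
begin

lemma TArr_Zero_left:
  assumes "x \<in> Obj C" "y \<in> Obj C" "f \<in> Hom C x' y'"
  shows "Zero C x y \<boxtimes> f = Zero C (x \<otimes> x') (y \<otimes> y')"
proof -
  have "Zero C x y \<boxtimes> f = Scal C 0 (Zero C x y \<boxtimes> f)"
    using TArr_Scal_left[of "Zero C x y" f 0] Scal_zero[OF Zero_in] Zero_in[of x y] assms
    by (auto simp: in_Hom)
  also have "\<dots> = Zero C (x \<otimes> x') (y \<otimes> y')"
    using TArr_in[OF Zero_in] assms by (intro Scal_zero) auto
  finally show ?thesis .
qed

lemma TArr_Zero_right:
  assumes "x \<in> Obj C" "y \<in> Obj C" "f \<in> Hom C x' y'"
  shows "f \<boxtimes> Zero C x y = Zero C (x' \<otimes> x) (y' \<otimes> y)"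
proof -
  have "f \<boxtimes> Zero C x y = Scal C 0 (f \<boxtimes> Zero C x y)"
    using TArr_Scal_right[of f "Zero C x y" 0] Scal_zero[OF Zero_in] Zero_in[of x y] assms
    by (auto simp: in_Hom)
  also have "\<dots> = Zero C (x' \<otimes> x) (y' \<otimes> y)"
    using TArr_in[OF _ Zero_in] assms by (intro Scal_zero) auto
  finally show ?thesis .
qed

lemma center_objD:
  assumes "Z \<in> center_obj C"
  shows "fst Z \<in> Obj C" "pre_half_braiding C Z"
    "c \<in> Obj C \<Longrightarrow> snd Z c \<in> Hom C (c \<otimes> fst Z) (fst Z \<otimes> c)"
  using center_obj_pre[OF assms] by (simp_all add: in_Hom)

lemma center_unit_in: "center_unit C \<in> center_obj C"
proof -
  interpret R: module_category C "regular C"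
    by (rule module_category_regular)
  show ?thesis
    by (rule center_objI) (simp_all add: R.slide_laws_center_unit, simp add: center_unit_def)
qed

lemma center_tensor_in:
  assumes "X \<in> center_obj C" "Y \<in> center_obj C"
  shows "center_tensor C X Y \<in> center_obj C"
proof -
  interpret R: module_category C "regular C"
    by (rule module_category_regular)
  show ?thesis
  proof (rule center_objI)
    show "snd (center_tensor C X Y) \<in> extensional (Obj C)"
      by (simp add: center_tensor_def split: prod.split)
  qed (use assms in \<open>simp_all add: center_objD R.slide_laws_center_tensor R.slide_laws_center_obj\<close>)
qed

lemma Idn_center_arr: "X \<in> center_obj C \<Longrightarrow> (X, Idn C (fst X), X) \<in> center_arr C"
  using center_objD[of X] by (simp add: center_arr_def in_Hom)

lemma Comp_center_arr:
  assumes "(X, f, Y) \<in> center_arr C" "(Y, g, Z) \<in> center_arr C"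
  shows "(X, g \<cdot> f, Z) \<in> center_arr C"
proof -
  note f = center_arrD[OF assms(1)] and g = center_arrD[OF assms(2)]
  have "((g \<cdot> f) \<boxtimes> Idn C c) \<cdot> snd X c = snd Z c \<cdot> (Idn C c \<boxtimes> (g \<cdot> f))" if [simp]: "c \<in> Obj C" for c
  proof -
    have [simp]: "f \<in> Arr C" "Dom C f = fst X" "Cod C f = fst Y" "g \<in> Arr C" "Dom C g = fst Y"
      "Cod C g = fst Z" "pre_half_braiding C X" "pre_half_braiding C Y" "pre_half_braiding C Z"
      using f g by (auto simp: in_Hom center_obj_pre)
    have sq: "(f \<boxtimes> Idn C c) \<cdot> snd X c = snd Y c \<cdot> (Idn C c \<boxtimes> f)"
      "(g \<boxtimes> Idn C c) \<cdot> snd Y c = snd Z c \<cdot> (Idn C c \<boxtimes> g)"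
      using assms by (simp_all add: center_arr_def)
    show ?thesis
      using TArr_Comp_arr[of f g "Idn C c" "Idn C c"] TArr_Comp_arr[of "Idn C c" "Idn C c" f g]
      by (simp add: sq(1) Comp_reassoc[OF sq(2)])
  qed
  then show ?thesis
    using f g Comp_in by (auto simp: center_arr_def)
qed

lemma Plus_center_arr:
  assumes "(X, f, Y) \<in> center_arr C" "(X, g, Y) \<in> center_arr C"
  shows "(X, Plus C f g, Y) \<in> center_arr C"
proof -
  note f = center_arrD[OF assms(1)] and g = center_arrD[OF assms(2)]
  note X = center_objD[OF f(2)] and Y = center_objD[OF f(3)]
  have "(Plus C f g \<boxtimes> Idn C c) \<cdot> snd X c = snd Y c \<cdot> (Idn C c \<boxtimes> Plus C f g)" if c: "c \<in> Obj C" for c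
    using assms c Comp_Plus_left[OF X(3)[OF c] TArr_in[OF f(1) Idn_in[OF c]] TArr_in[OF g(1) Idn_in[OF c]]]
      Comp_Plus_right[OF TArr_in[OF Idn_in[OF c] f(1)] TArr_in[OF Idn_in[OF c] g(1)] Y(3)[OF c]]
    by (simp add: TArr_Plus_left[OF f(1) g(1) Idn_in] TArr_Plus_right[OF Idn_in f(1) g(1)] center_arr_def)
  then show ?thesis
    using f g by (auto simp: center_arr_def Plus_in)
qed

lemma Scal_center_arr:
  assumes "(X, f, Y) \<in> center_arr C"
  shows "(X, Scal C a f, Y) \<in> center_arr C"
proof -
  note f = center_arrD[OF assms]
  note X = center_objD[OF f(2)] and Y = center_objD[OF f(3)]
  have "(Scal C a f \<boxtimes> Idn C c) \<cdot> snd X c = snd Y c \<cdot> (Idn C c \<boxtimes> Scal C a f)" if c: "c \<in> Obj C" for c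
    using assms c f(1) Comp_Scal_left[OF X(3)[OF c] TArr_in[OF f(1) Idn_in[OF c]]]
      Comp_Scal_right[OF TArr_in[OF Idn_in[OF c] f(1)] Y(3)[OF c]]
    by (simp add: TArr_Scal_left TArr_Scal_right in_Hom center_arr_def)
  then show ?thesis
    using f by (auto simp: center_arr_def Scal_in)
qed

lemma Zero_center_arr:
  assumes "X \<in> center_obj C" "Y \<in> center_obj C"
  shows "(X, Zero C (fst X) (fst Y), Y) \<in> center_arr C"
proof -
  note X = center_objD[OF assms(1)] and Y = center_objD[OF assms(2)]
  have "(Zero C (fst X) (fst Y) \<boxtimes> Idn C c) \<cdot> snd X c = snd Y c \<cdot> (Idn C c \<boxtimes> Zero C (fst X) (fst Y))"
    if c: "c \<in> Obj C" for c
    using X(1) Y(1) c Comp_Zero_left[OF X(3)[OF c]] Comp_Zero_right[OF Y(3)[OF c]]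
    by (simp add: TArr_Zero_left[OF _ _ Idn_in] TArr_Zero_right[OF _ _ Idn_in])
  then show ?thesis
    using assms X(1) Y(1) by (simp add: center_arr_def Zero_in)
qed

text \<open>Composing with the invertible \<open>f \<boxtimes> Idn C c\<close> reduces the square
  for the inverse to the one for \<open>f\<close>. Hence arrows of the center are invertible as soon
  as they are so in \<open>C\<close>, which covers associators and unitors.\<close>

lemma inv_center_arr:
  assumes "(X, f, Y) \<in> center_arr C" "is_iso C f"
  shows "(Y, inv_arr C f, X) \<in> center_arr C"
proof -
  note f = center_arrD[OF assms(1)]
  have "(inv_arr C f \<boxtimes> Idn C c) \<cdot> snd Y c = snd X c \<cdot> (Idn C c \<boxtimes> inv_arr C f)"
    if [simp]: "c \<in> Obj C" for c
  proof -
    have [simp]: "f \<in> Arr C" "Dom C f = fst X" "Cod C f = fst Y" "is_iso C f"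
       "pre_half_braiding C X" "pre_half_braiding C Y"
      using f assms(2) by (auto simp: in_Hom center_obj_pre)
    have sq: "(f \<boxtimes> Idn C c) \<cdot> snd X c = snd Y c \<cdot> (Idn C c \<boxtimes> f)"
      using assms by (simp add: center_arr_def)
    have "(f \<boxtimes> Idn C c) \<cdot> (inv_arr C f \<boxtimes> Idn C c) = Idn C (fst Y \<otimes> c)"
      "(Idn C c \<boxtimes> f) \<cdot> (Idn C c \<boxtimes> inv_arr C f) = Idn C (c \<otimes> fst Y)"
      using TArr_Comp_arr[of "inv_arr C f" f "Idn C c" "Idn C c"]
        TArr_Comp_arr[of "Idn C c" "Idn C c" "inv_arr C f" f] by simp_all
    note eqs = this(2) Comp_reassoc[OF this(1)]
    have "(f \<boxtimes> Idn C c) \<cdot> ((inv_arr C f \<boxtimes> Idn C c) \<cdot> snd Y c) =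
        (f \<boxtimes> Idn C c) \<cdot> (snd X c \<cdot> (Idn C c \<boxtimes> inv_arr C f))"
      by (simp add: Comp_reassoc[OF sq] eqs)
    then show ?thesis
      by (rule iso_cancel_left) simp_all
  qed
  moreover have "inv_arr C f \<in> Hom C (fst Y) (fst X)"
    using f(1) assms(2) by (simp add: in_Hom)
  ultimately show ?thesis
    using f by (simp add: center_arr_def)
qed

lemma is_iso_center:
  assumes "(X, f, Y) \<in> center_arr C" "is_iso C f"
  shows "is_iso (center C) (X, f, Y)"
  unfolding is_iso_def is_inverse_def
  using assms inv_center_arr[OF assms] center_arrD(1)[OF assms(1)]
  by (intro conjI exI[of _ "(Y, inv_arr C f, X)"]) (simp_all add: in_Hom)

lemma Assoc_center_arr:
  assumes "X \<in> center_obj C" "Y \<in> center_obj C" "Z \<in> center_obj C"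
  shows "(center_tensor C (center_tensor C X Y) Z, Assoc C (fst X) (fst Y) (fst Z),
    center_tensor C X (center_tensor C Y Z)) \<in> center_arr C"
proof -
  interpret R: module_category C "regular C"
    by (rule module_category_regular)
  note [simp] = center_objD(1,2)[OF assms(1)]
  note [simp] = center_objD(1,2)[OF assms(2)]
  note [simp] = center_objD(1,2)[OF assms(3)]
  show ?thesis
    using R.slide_Assoc[of X Y Z]
    by (intro center_arrI center_tensor_in center_unit_in assms) (simp_all add: in_Hom)
qed

lemma LUnit_center_arr:
  assumes "X \<in> center_obj C"
  shows "(center_tensor C (center_unit C) X, LUnit C (fst X), X) \<in> center_arr C"
proof -
  interpret R: module_category C "regular C"
    by (rule module_category_regular)
  note [simp] = center_objD(1,2)[OF assms(1)]
  show ?thesis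
    using R.slide_LUnit[of X]
    by (intro center_arrI center_tensor_in center_unit_in assms) (simp_all add: in_Hom)
qed

lemma RUnit_center_arr:
  assumes "X \<in> center_obj C"
  shows "(center_tensor C X (center_unit C), RUnit C (fst X), X) \<in> center_arr C"
proof -
  interpret R: module_category C "regular C"
    by (rule module_category_regular)
  note [simp] = center_objD(1,2)[OF assms(1)]
  show ?thesis
    using R.slide_RUnit[of X]
    by (intro center_arrI center_tensor_in center_unit_in assms) (simp_all add: in_Hom)
qed

lemma Braid_center_arr:
  assumes "X \<in> center_obj C" "Y \<in> center_obj C"
  shows "(center_tensor C X Y, snd Y (fst X), center_tensor C Y X) \<in> center_arr C"
proof -
  interpret R: module_category C "regular C"
    by (rule module_category_regular)
  note [simp] = center_objD(1,2)[OF assms(1)]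
  note [simp] = center_objD(1,2)[OF assms(2)]
  show ?thesis
    using R.slide_Braid[of X Y] R.slide_laws_center_obj[OF assms(2)]
    by (intro center_arrI center_tensor_in center_unit_in assms) (simp_all add: in_Hom)
qed

lemma TArr_center_arr:
  assumes "(X, f, X') \<in> center_arr C" "(Y, g, Y') \<in> center_arr C"
  shows "(center_tensor C X Y, f \<boxtimes> g, center_tensor C X' Y') \<in> center_arr C"
proof -
  interpret R: module_category C "regular C"
    by (rule module_category_regular)
  note f = center_arrD[OF assms(1)] and g = center_arrD[OF assms(2)]
  have pre: "pre_half_braiding C X" "pre_half_braiding C X'" "pre_half_braiding C Y"
      "pre_half_braiding C Y'"
    using f g by (simp_all add: center_objD)
  show ?thesis
    using R.slide_TArr[OF pre _ _ f(1) g(1) R.center_arr_slide[OF assms(1)] R.center_arr_slide[OF assms(2)]]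
      f(1) g(1)
    by (intro center_arrI center_tensor_in f g) (simp_all add: in_Hom)
qed

lemma linear_category_center: "linear_category (center C)"
proof
  fix F G X Y Z a
  assume "F \<in> Hom (center C) X Y"
  then obtain f where F: "F = (X, f, Y)" "(X, f, Y) \<in> center_arr C"
    by (auto simp: in_Hom_center)
  show "Scal (center C) a F \<in> Hom (center C) X Y"
    using F by (simp add: in_Hom_center Scal_center_arr)
  show "G \<cdot>\<^bsub>center C\<^esub> F \<in> Hom (center C) X Z" if "G \<in> Hom (center C) Y Z"
    using that F by (auto simp: in_Hom_center Comp_center_arr)
  show "Plus (center C) F G \<in> Hom (center C) X Y" if "G \<in> Hom (center C) X Y"
    using that F by (auto simp: in_Hom_center Plus_center_arr)
next
  fix F
  assume "F \<in> Arr (center C)"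
  then show "Dom (center C) F \<in> Obj (center C)" "Cod (center C) F \<in> Obj (center C)"
    by (cases F, simp add: center_arrD)+
qed (auto simp: in_Hom_center Idn_center_arr Zero_center_arr dest!: center_arrD(1)
      intro: Comp_assoc Idn_left Idn_right Plus_assoc Plus_commute Plus_Zero Plus_minus Scal_Plus
        Scal_add Scal_mult Scal_one Comp_Plus_left Comp_Plus_right Comp_Scal_left Comp_Scal_right)

text \<open>The coherence equations are inherited from the underlying arrows in \<open>C\<close>.
  The real content is that the structural arrows commute with the half-braidings.\<close>

lemma linear_monoidal_category_center: "linear_monoidal_category (center C)"
proof (intro linear_monoidal_category.intro linear_monoidal_category_axioms.intro
    linear_category_center)
  fix F G X X' Y Y'
  assume "F \<in> Hom (center C) X X'" "G \<in> Hom (center C) Y Y'"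
  then show "F \<boxtimes>\<^bsub>center C\<^esub> G \<in> Hom (center C) (X \<otimes>\<^bsub>center C\<^esub> Y) (X' \<otimes>\<^bsub>center C\<^esub> Y')"
    by (auto simp: in_Hom_center TArr_center_arr)
next
  fix F G a
  assume "F \<in> Arr (center C)" "G \<in> Arr (center C)"
  then show "Scal (center C) a F \<boxtimes>\<^bsub>center C\<^esub> G = Scal (center C) a (F \<boxtimes>\<^bsub>center C\<^esub> G)"
    "F \<boxtimes>\<^bsub>center C\<^esub> Scal (center C) a G = Scal (center C) a (F \<boxtimes>\<^bsub>center C\<^esub> G)"
    by (cases F, cases G, auto simp: center_arr_def in_Hom TArr_Scal_left TArr_Scal_right)+
next
  fix X Y Z
  assume *: "X \<in> Obj (center C)" "Y \<in> Obj (center C)" "Z \<in> Obj (center C)"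
  show "Assoc (center C) X Y Z \<in> Hom (center C) ((X \<otimes>\<^bsub>center C\<^esub> Y) \<otimes>\<^bsub>center C\<^esub> Z)
      (X \<otimes>\<^bsub>center C\<^esub> (Y \<otimes>\<^bsub>center C\<^esub> Z))"
    "is_iso (center C) (Assoc (center C) X Y Z)"
    using * Assoc_center_arr[of X Y Z] by (simp_all add: in_Hom_center is_iso_center center_objD)
next
  fix X
  assume *: "X \<in> Obj (center C)"
  show "LUnit (center C) X \<in> Hom (center C) (Unit (center C) \<otimes>\<^bsub>center C\<^esub> X) X"
    "is_iso (center C) (LUnit (center C) X)"
    using * LUnit_center_arr[of X] by (simp_all add: in_Hom_center is_iso_center center_objD)
  show "RUnit (center C) X \<in> Hom (center C) (X \<otimes>\<^bsub>center C\<^esub> Unit (center C)) X"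
    "is_iso (center C) (RUnit (center C) X)"
    using * RUnit_center_arr[of X] by (simp_all add: in_Hom_center is_iso_center center_objD)
qed (auto simp: in_Hom_center center_tensor_in center_unit_in center_objD(1) pentagon triangle
      dest!: center_arrD(1)
      intro: TArr_Comp TArr_Plus_left TArr_Plus_right Assoc_nat LUnit_nat RUnit_nat)

end

subsection \<open>Inverse half-braidings acting on a module category\<close>

context module_category
begin

lemma Lwhisk_inv:
  assumes "is_iso M u" "c \<in> Obj C"
  shows "(c \<triangleright> u) \<star> (c \<triangleright> inv_arr M u) = Idn M (c \<diamondop> Cod M u)"
    "(c \<triangleright> inv_arr M u) \<star> (c \<triangleright> u) = Idn M (c \<diamondop> Dom M u)"
  using assms Lwhisk_Comp[of c u "inv_arr M u"] Lwhisk_Comp[of c "inv_arr M u" u] by simp_all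

text \<open>The left-hand side is the part of the constraint of \<open>act_modfun\<close> that
  involves the half-braiding. Recognising it as an inverse slide makes the laws of slides available
  for module functors.\<close>

lemma inv_slide:
  assumes [simp]: "pre_half_braiding C Z" "c \<in> Obj C" "m \<in> Obj M"
  shows "MAssoc M c (fst Z) m \<star> (inv_arr C (snd Z c) \<triangleleft> m) \<star> inv_arr M (MAssoc M (fst Z) c m) =
    inv_arr M (slide M Z c m)"
proof -
  have "slide M Z c m \<star> (MAssoc M c (fst Z) m \<star> (inv_arr C (snd Z c) \<triangleleft> m) \<star>
      inv_arr M (MAssoc M (fst Z) c m)) = slide M Z c m \<star> inv_arr M (slide M Z c m)"
    by (simp add: M.Comp_reassoc[OF slide_MAssoc] M.Comp_reassoc[OF Rwhisk_inv(1)])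
  then show ?thesis
    by (rule M.iso_cancel_left) simp_all
qed

text \<open>The arrow \<open>u\<close> passes because \<open>MAssoc\<close> is natural,
  \<open>f\<close> because the half-braiding is. The combined form matches the naturality axiom for
  constraints of module functors.\<close>

lemma slide_natural_AArr:
  assumes [simp]: "pre_half_braiding C Z" and laws: "slide_laws C M Z"
    and f: "f \<in> Hom C c d" and u: "u \<in> Hom M m n"
  shows "inv_arr M (slide M Z d n) \<star> (fst Z \<triangleright> AArr M f u) =
    AArr M f (fst Z \<triangleright> u) \<star> inv_arr M (slide M Z c m)"
proof -
  have [simp]: "f \<in> Arr C" "Dom C f = c" "Cod C f = d" "c \<in> Obj C" "d \<in> Obj C"
    "u \<in> Arr M" "Dom M u = m" "Cod M u = n" "m \<in> Obj M" "n \<in> Obj M"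
    using f u C.Dom_in C.Cod_in M.Dom_in M.Cod_in by (auto simp: in_Hom)
  have "(fst Z \<triangleright> AArr M f u) \<star> slide M Z c m =
      (fst Z \<triangleright> f \<triangleleft> n) \<star> (fst Z \<triangleright> c \<triangleright> u) \<star> slide M Z c m"
    by (simp add: Lwhisk_Comp flip: whisk_eq_AArr(1)[OF f u])
  also have "\<dots> = (fst Z \<triangleright> f \<triangleleft> n) \<star> slide M Z c n \<star> (c \<triangleright> fst Z \<triangleright> u)"
    by (simp add: slide_natural[of Z c u m n] in_Hom)
  also have "\<dots> = slide M Z d n \<star> (f \<triangleleft> (fst Z \<diamondop> n)) \<star> (c \<triangleright> fst Z \<triangleright> u)"
    by (simp add: M.Comp_reassoc[OF slide_lawsD(1)[OF laws f, symmetric]])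
  also have "\<dots> = slide M Z d n \<star> AArr M f (fst Z \<triangleright> u)"
    by (simp add: whisk_eq_AArr(1)[OF f, of _ "fst Z \<diamondop> m" "fst Z \<diamondop> n"] in_Hom)
  finally show ?thesis
    by (rule M.iso_square_inv) simp_all
qed

text \<open>The laws are inverted because a constraint points from \<open>F (c \<rhd> m)\<close> to
  \<open>c \<rhd> F m\<close>, that is, it moves \<open>c\<close> outwards past
  \<open>Z\<close>.\<close>

lemma inv_slide_hexagon:
  assumes [simp]: "pre_half_braiding C Z" "c \<in> Obj C" "d \<in> Obj C" "m \<in> Obj M"
    and laws: "slide_laws C M Z"
  shows "MAssoc M c d (fst Z \<diamondop> m) \<star> inv_arr M (slide M Z (c \<otimes> d) m) =
    (c \<triangleright> inv_arr M (slide M Z d m)) \<star> inv_arr M (slide M Z c (d \<diamondop> m)) \<star>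
      (fst Z \<triangleright> MAssoc M c d m)"
proof -
  have "(MAssoc M c d (fst Z \<diamondop> m) \<star> inv_arr M (slide M Z (c \<otimes> d) m)) \<star> slide M Z (c \<otimes> d) m =
      ((c \<triangleright> inv_arr M (slide M Z d m)) \<star> inv_arr M (slide M Z c (d \<diamondop> m)) \<star>
        (fst Z \<triangleright> MAssoc M c d m)) \<star> slide M Z (c \<otimes> d) m"
    by (simp add: slide_lawsD(2)[OF laws] M.Comp_reassoc[OF Lwhisk_inv(2)])
  then show ?thesis
    by (rule M.iso_cancel_right) simp_all
qed

lemma inv_slide_unit:
  assumes [simp]: "pre_half_braiding C Z" "m \<in> Obj M" and laws: "slide_laws C M Z"
  shows "MUnit M (fst Z \<diamondop> m) \<star> inv_arr M (slide M Z (Unit C) m) = fst Z \<triangleright> MUnit M m"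
  by (simp flip: slide_lawsD(3)[OF laws])

lemma inv_slide_tensor:
  assumes [simp]: "pre_half_braiding C X" "pre_half_braiding C Y" "c \<in> Obj C" "m \<in> Obj M"
  shows "(c \<triangleright> MAssoc M (fst X) (fst Y) m) \<star> inv_arr M (slide M (center_tensor C X Y) c m) =
    inv_arr M (slide M X c (fst Y \<diamondop> m)) \<star> (fst X \<triangleright> inv_arr M (slide M Y c m)) \<star>
      MAssoc M (fst X) (fst Y) (c \<diamondop> m)"
proof -
  let ?s = "slide M (center_tensor C X Y) c m"
  have "((c \<triangleright> MAssoc M (fst X) (fst Y) m) \<star> inv_arr M ?s) \<star> ?s =
    (inv_arr M (slide M X c (fst Y \<diamondop> m)) \<star> (fst X \<triangleright> inv_arr M (slide M Y c m)) \<star>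
      MAssoc M (fst X) (fst Y) (c \<diamondop> m)) \<star> ?s"
    by (simp add: slide_tensor M.Comp_reassoc[OF Lwhisk_inv(2)])
  then show ?thesis
    by (rule M.iso_cancel_right) simp_all
qed

lemma inv_slide_center_unit:
  assumes [simp]: "c \<in> Obj C" "m \<in> Obj M"
  shows "(c \<triangleright> MUnit M m) \<star> inv_arr M (slide M (center_unit C) c m) = MUnit M (c \<diamondop> m)"
  by (simp flip: slide_center_unit)

lemma center_arr_slide_AArr:
  assumes f: "(X, f, Y) \<in> center_arr C" and [simp]: "c \<in> Obj C" and u: "u \<in> Hom M m n"
  shows "inv_arr M (slide M Y c n) \<star> AArr M f (c \<triangleright> u) = (c \<triangleright> AArr M f u) \<star> inv_arr M (slide M X c m)"
proof -
  have [simp]: "f \<in> Arr C" "Dom C f = fst X" "Cod C f = fst Y" "u \<in> Arr M" "Dom M u = m" "Cod M u = n"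
    "m \<in> Obj M" "n \<in> Obj M" "pre_half_braiding C X" "pre_half_braiding C Y"
    and Hom: "f \<in> Hom C (fst X) (fst Y)"
    using center_arrD[OF f] u M.Dom_in M.Cod_in by (auto simp: in_Hom center_obj_pre)
  have "AArr M f (c \<triangleright> u) \<star> slide M X c m =
      (f \<triangleleft> (c \<diamondop> n)) \<star> (fst X \<triangleright> c \<triangleright> u) \<star> slide M X c m"
    by (simp add: in_Hom flip: whisk_eq_AArr(1)[OF Hom, of "c \<triangleright> u" "c \<diamondop> m" "c \<diamondop> n"])
  also have "\<dots> = (f \<triangleleft> (c \<diamondop> n)) \<star> slide M X c n \<star> (c \<triangleright> fst X \<triangleright> u)"
    by (simp add: slide_natural[of X c u m n] in_Hom)
  also have "\<dots> = slide M Y c n \<star> (c \<triangleright> f \<triangleleft> n) \<star> (c \<triangleright> fst X \<triangleright> u)"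
    by (simp add: M.Comp_reassoc[OF center_arr_slide[OF f]])
  also have "\<dots> = slide M Y c n \<star> (c \<triangleright> AArr M f u)"
    by (simp add: Lwhisk_Comp flip: whisk_eq_AArr(1)[OF Hom u])
  finally show ?thesis
    by (rule M.iso_square_inv) simp_all
qed

end

subsection \<open>Module functors\<close>

lemma Rex_simps [simp]:
  "Obj (Rex C M) = rex_obj C M"
  "Dom (Rex C M) (F, \<eta>, G) = F" "Cod (Rex C M) (F, \<eta>, G) = G"
  "Idn (Rex C M) F = (F, \<lambda>m\<in>Obj M. Idn M (FObj F m), F)"
  "Comp (Rex C M) (G', \<theta>, H) (F, \<eta>, G) = (F, \<lambda>m\<in>Obj M. \<theta> m \<cdot>\<^bsub>M\<^esub> \<eta> m, H)"
  "Plus (Rex C M) (F, \<eta>, G) (F', \<theta>, G') = (F, \<lambda>m\<in>Obj M. Plus M (\<eta> m) (\<theta> m), G)"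
  "Scal (Rex C M) a (F, \<eta>, G) = (F, \<lambda>m\<in>Obj M. Scal M a (\<eta> m), G)"
  "Zero (Rex C M) F G = (F, \<lambda>m\<in>Obj M. Zero M (FObj F m) (FObj G m), G)"
  "AObj (Rex C M) = act_modfun C M"
  "AArr (Rex C M) (X, f, Y) (F, \<eta>, G) =
     (act_modfun C M X F, \<lambda>m\<in>Obj M. f \<unrhd>\<^bsub>M\<^esub> \<eta> m, act_modfun C M Y G)"
  "MAssoc (Rex C M) X Y F = (act_modfun C M (center_tensor C X Y) F,
     \<lambda>m\<in>Obj M. MAssoc M (fst X) (fst Y) (FObj F m), act_modfun C M X (act_modfun C M Y F))"
  "MUnit (Rex C M) F = (act_modfun C M (center_unit C) F, \<lambda>m\<in>Obj M. MUnit M (FObj F m), F)"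
  by (simp_all add: Rex_def)

lemma in_Hom_Rex:
  "E \<in> Hom (Rex C M) F G \<longleftrightarrow>
    (\<exists>\<eta>. E = (F, \<eta>, G) \<and> F \<in> rex_obj C M \<and> G \<in> rex_obj C M \<and> module_nat C M F G \<eta>)"
  by (cases E) (auto simp: Hom_def Rex_def)

lemma act_modfun_simps:
  "m \<in> Obj M \<Longrightarrow> FObj (act_modfun C M Z F) m = fst Z \<rhd>\<^bsub>M\<^esub> FObj F m"
  "g \<in> Arr M \<Longrightarrow> FArr (act_modfun C M Z F) g = Idn C (fst Z) \<unrhd>\<^bsub>M\<^esub> FArr F g"
  by (simp_all add: act_modfun_def split: prod.split)

lemma id_modfun_simps:
  "m \<in> Obj M \<Longrightarrow> FObj (id_modfun C M) m = m"
  "g \<in> Arr M \<Longrightarrow> FArr (id_modfun C M) g = g"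
  "c \<in> Obj C \<Longrightarrow> m \<in> Obj M \<Longrightarrow> MConstr (id_modfun C M) (c, m) = Idn M (c \<rhd>\<^bsub>M\<^esub> m)"
  by (simp_all add: id_modfun_def)

lemma module_nat_Hom:
  "module_nat C M F G \<eta> \<Longrightarrow> m \<in> Obj M \<Longrightarrow> \<eta> m \<in> Hom M (FObj F m) (FObj G m)"
  unfolding module_nat_def by blast

lemma module_nat_natural:
  "module_nat C M F G \<eta> \<Longrightarrow> g \<in> Hom M m m' \<Longrightarrow> \<eta> m' \<cdot>\<^bsub>M\<^esub> FArr F g = FArr G g \<cdot>\<^bsub>M\<^esub> \<eta> m"
  unfolding module_nat_def by blast

lemma module_nat_MConstr:
  "module_nat C M F G \<eta> \<Longrightarrow> c \<in> Obj C \<Longrightarrow> m \<in> Obj M \<Longrightarrow>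
    (Idn C c \<unrhd>\<^bsub>M\<^esub> \<eta> m) \<cdot>\<^bsub>M\<^esub> MConstr F (c, m) = MConstr G (c, m) \<cdot>\<^bsub>M\<^esub> \<eta> (c \<rhd>\<^bsub>M\<^esub> m)"
  unfolding module_nat_def by blast

lemma module_nat_extensional: "module_nat C M F G \<eta> \<Longrightarrow> \<eta> \<in> extensional (Obj M)"
  unfolding module_nat_def by blast

lemma rex_obj_functor:
  assumes "F \<in> rex_obj C M"
  shows "m \<in> Obj M \<Longrightarrow> FObj F m \<in> Obj M"
    and "g \<in> Hom M m n \<Longrightarrow> FArr F g \<in> Hom M (FObj F m) (FObj F n)"
    and "m \<in> Obj M \<Longrightarrow> FArr F (Idn M m) = Idn M (FObj F m)"
    and "g \<in> Hom M m n \<Longrightarrow> h \<in> Hom M n p \<Longrightarrow> FArr F (h \<cdot>\<^bsub>M\<^esub> g) = FArr F h \<cdot>\<^bsub>M\<^esub> FArr F g"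
    and "g \<in> Hom M m n \<Longrightarrow> h \<in> Hom M m n \<Longrightarrow> FArr F (Plus M g h) = Plus M (FArr F g) (FArr F h)"
    and "g \<in> Arr M \<Longrightarrow> FArr F (Scal M a g) = Scal M a (FArr F g)"
proof -
  have "linear_functor M M (FObj F) (FArr F)"
    using assms unfolding rex_obj_def module_endofunctor_def by blast
  note F = this[unfolded linear_functor_def]
  show "m \<in> Obj M \<Longrightarrow> FObj F m \<in> Obj M"
    "g \<in> Hom M m n \<Longrightarrow> FArr F g \<in> Hom M (FObj F m) (FObj F n)"
    "m \<in> Obj M \<Longrightarrow> FArr F (Idn M m) = Idn M (FObj F m)"
    "g \<in> Hom M m n \<Longrightarrow> h \<in> Hom M n p \<Longrightarrow> FArr F (h \<cdot>\<^bsub>M\<^esub> g) = FArr F h \<cdot>\<^bsub>M\<^esub> FArr F g"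
    "g \<in> Hom M m n \<Longrightarrow> h \<in> Hom M m n \<Longrightarrow> FArr F (Plus M g h) = Plus M (FArr F g) (FArr F h)"
    "g \<in> Arr M \<Longrightarrow> FArr F (Scal M a g) = Scal M a (FArr F g)"
    using F by blast+
qed

lemma rex_obj_MConstr:
  assumes "F \<in> rex_obj C M"
  shows "c \<in> Obj C \<Longrightarrow> m \<in> Obj M \<Longrightarrow>
      MConstr F (c, m) \<in> Hom M (FObj F (c \<rhd>\<^bsub>M\<^esub> m)) (c \<rhd>\<^bsub>M\<^esub> FObj F m)"
    and "c \<in> Obj C \<Longrightarrow> m \<in> Obj M \<Longrightarrow> is_iso M (MConstr F (c, m))"
    and "f \<in> Hom C c c' \<Longrightarrow> g \<in> Hom M m m' \<Longrightarrow>
      MConstr F (c', m') \<cdot>\<^bsub>M\<^esub> FArr F (f \<unrhd>\<^bsub>M\<^esub> g) = (f \<unrhd>\<^bsub>M\<^esub> FArr F g) \<cdot>\<^bsub>M\<^esub> MConstr F (c, m)"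
    and "c \<in> Obj C \<Longrightarrow> d \<in> Obj C \<Longrightarrow> m \<in> Obj M \<Longrightarrow>
      MAssoc M c d (FObj F m) \<cdot>\<^bsub>M\<^esub> MConstr F (c \<otimes>\<^bsub>C\<^esub> d, m) = (Idn C c \<unrhd>\<^bsub>M\<^esub> MConstr F (d, m)) \<cdot>\<^bsub>M\<^esub>
        MConstr F (c, d \<rhd>\<^bsub>M\<^esub> m) \<cdot>\<^bsub>M\<^esub> FArr F (MAssoc M c d m)"
    and "m \<in> Obj M \<Longrightarrow> MUnit M (FObj F m) \<cdot>\<^bsub>M\<^esub> MConstr F (Unit C, m) = FArr F (MUnit M m)"
  using assms unfolding rex_obj_def module_endofunctor_def by blast+

context finite_module_category
begin

lemma rex_obj_simps [simp]:
  assumes "F \<in> rex_obj C M"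
  shows "m \<in> Obj M \<Longrightarrow> FObj F m \<in> Obj M"
    and "g \<in> Arr M \<Longrightarrow> FArr F g \<in> Arr M"
    and "g \<in> Arr M \<Longrightarrow> Dom M (FArr F g) = FObj F (Dom M g)"
    and "g \<in> Arr M \<Longrightarrow> Cod M (FArr F g) = FObj F (Cod M g)"
    and "c \<in> Obj C \<Longrightarrow> m \<in> Obj M \<Longrightarrow> is_iso M (MConstr F (c, m))"
    and "c \<in> Obj C \<Longrightarrow> m \<in> Obj M \<Longrightarrow> Dom M (MConstr F (c, m)) = FObj F (c \<diamondop> m)"
    and "c \<in> Obj C \<Longrightarrow> m \<in> Obj M \<Longrightarrow> Cod M (MConstr F (c, m)) = c \<diamondop> FObj F m"
  using rex_obj_functor(1,2)[OF assms] rex_obj_MConstr(1,2)[OF assms] by (auto simp: in_Hom)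

text \<open>Regrouping the four factors of the definition exhibits the first three as an inverse
  slide.\<close>

lemma act_modfun_MConstr:
  assumes "pre_half_braiding C Z" "F \<in> rex_obj C M" "c \<in> Obj C" "m \<in> Obj M"
  shows "MConstr (act_modfun C M Z F) (c, m) =
    inv_arr M (slide M Z c (FObj F m)) \<star> (fst Z \<triangleright> MConstr F (c, m))"
proof -
  have "MConstr (act_modfun C M Z F) (c, m) = MAssoc M c (fst Z) (FObj F m) \<star>
      (inv_arr C (snd Z c) \<triangleleft> FObj F m) \<star> inv_arr M (MAssoc M (fst Z) c (FObj F m)) \<star>
      (fst Z \<triangleright> MConstr F (c, m))"
    using assms(3,4) by (simp add: act_modfun_def split: prod.split)
  also have "\<dots> = (MAssoc M c (fst Z) (FObj F m) \<star>
      (inv_arr C (snd Z c) \<triangleleft> FObj F m) \<star> inv_arr M (MAssoc M (fst Z) c (FObj F m))) \<star>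
      (fst Z \<triangleright> MConstr F (c, m))"
    using assms by simp
  finally show ?thesis
    using assms by (simp only: inv_slide rex_obj_simps)
qed

text \<open>The functor is \<open>F\<close> followed by the action of a fixed object, which
  preserves cokernels because the action is right exact in its second variable.\<close>

lemma right_exact_act_modfun:
  assumes F: "F \<in> rex_obj C M" and Z: "fst Z \<in> Obj C"
  shows "right_exact M M (FObj (act_modfun C M Z F)) (FArr (act_modfun C M Z F))"
  unfolding right_exact_def
proof (intro conjI allI impI)
  note [simp] = act_modfun_simps F Z
  note act = right_exact_snd[OF Z, unfolded right_exact_def linear_functor_def]
  show "linear_functor M M (FObj (act_modfun C M Z F)) (FArr (act_modfun C M Z F))"
    unfolding linear_functor_def
  proof (intro conjI allI ballI)
    fix x y z f g assume f: "f \<in> Hom M x y" and g: "g \<in> Hom M y z"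
    then have "g \<star> f \<in> Arr M" "f \<in> Arr M" "g \<in> Arr M"
      using M.Comp_in[OF f g] by (auto simp: in_Hom)
    then show "FArr (act_modfun C M Z F) (g \<star> f) =
        FArr (act_modfun C M Z F) g \<star> FArr (act_modfun C M Z F) f"
      using f g rex_obj_functor(2,4)[OF F] by (simp add: Lwhisk_Comp in_Hom)
  next
    fix x y f g assume f: "f \<in> Hom M x y" and g: "g \<in> Hom M x y"
    then have "Plus M f g \<in> Arr M" "f \<in> Arr M" "g \<in> Arr M"
      using M.Plus_in[OF f g] by (auto simp: in_Hom)
    then show "FArr (act_modfun C M Z F) (Plus M f g) =
        Plus M (FArr (act_modfun C M Z F) f) (FArr (act_modfun C M Z F) g)"
      by (simp add: rex_obj_functor(5)[OF F f g]
          AArr_Plus_right[OF C.Idn_in[OF Z] rex_obj_functor(2)[OF F f] rex_obj_functor(2)[OF F g]])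
  next
    fix a f assume f: "f \<in> Arr M"
    then have "Scal M a f \<in> Arr M"
      using M.Scal_in[of f "Dom M f" "Cod M f" a] by (auto simp: in_Hom)
    with f show "FArr (act_modfun C M Z F) (Scal M a f) = Scal M a (FArr (act_modfun C M Z F) f)"
      by (simp add: rex_obj_functor(6)[OF F f] AArr_Scal_right)
  next
    fix x y f assume f: "f \<in> Hom M x y"
    then have "x \<in> Obj M" "y \<in> Obj M"
      using M.Dom_in M.Cod_in by (auto simp: in_Hom)
    then show "FArr (act_modfun C M Z F) f
        \<in> Hom M (FObj (act_modfun C M Z F) x) (FObj (act_modfun C M Z F) y)"
      using f by (simp add: in_Hom)
  qed (simp_all add: rex_obj_functor(3)[OF F])
  fix f p assume fp: "is_cokernel M f p"
  then have [simp]: "f \<in> Arr M" "p \<in> Arr M"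
    unfolding is_cokernel_def by blast+
  have "is_cokernel M (FArr F f) (FArr F p)"
    using F fp unfolding rex_obj_def right_exact_def by blast
  then have "is_cokernel M (fst Z \<triangleright> FArr F f) (fst Z \<triangleright> FArr F p)"
    using right_exact_snd[OF Z] unfolding right_exact_def by blast
  then show "is_cokernel M (FArr (act_modfun C M Z F) f) (FArr (act_modfun C M Z F) p)"
    by simp
qed

text \<open>The constraint is the constraint of \<open>F\<close> followed by an inverse slide, so
  each constraint axiom combines a law of inverse slides with the same axiom for
  \<open>F\<close>.\<close>

lemma act_modfun_in:
  assumes Z: "Z \<in> center_obj C" and F: "F \<in> rex_obj C M"
  shows "act_modfun C M Z F \<in> rex_obj C M"
proof -
  let ?z = "fst Z"
  have pre [simp]: "pre_half_braiding C Z" and laws: "slide_laws C M Z"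
    using Z by (simp_all add: center_obj_pre slide_laws_center_obj)
  note [simp] = act_modfun_simps act_modfun_MConstr F
  have "module_endofunctor C M (act_modfun C M Z F)"
    unfolding module_endofunctor_def
  proof (intro conjI allI ballI)
    show "FObj (act_modfun C M Z F) \<in> extensional (Obj M)"
      "FArr (act_modfun C M Z F) \<in> extensional (Arr M)"
      "MConstr (act_modfun C M Z F) \<in> extensional (Obj C \<times> Obj M)"
      by (simp_all add: act_modfun_def split: prod.split)
    show "linear_functor M M (FObj (act_modfun C M Z F)) (FArr (act_modfun C M Z F))"
      using right_exact_act_modfun[OF F, of Z] by (simp add: right_exact_def)
  next
    fix c m assume "c \<in> Obj C" "m \<in> Obj M"
    then show "MConstr (act_modfun C M Z F) (c, m)
        \<in> Hom M (FObj (act_modfun C M Z F) (c \<diamondop> m)) (c \<diamondop> FObj (act_modfun C M Z F) m)"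
      "is_iso M (MConstr (act_modfun C M Z F) (c, m))"
      by (simp_all add: in_Hom)
  next
    fix c c' m m' f g assume f: "f \<in> Hom C c c'" and g: "g \<in> Hom M m m'"
    then have [simp]: "f \<in> Arr C" "Dom C f = c" "Cod C f = c'" "c \<in> Obj C" "c' \<in> Obj C"
      "g \<in> Arr M" "Dom M g = m" "Cod M g = m'" "m \<in> Obj M" "m' \<in> Obj M"
      using f g C.Dom_in C.Cod_in M.Dom_in M.Cod_in by (auto simp: in_Hom)
    show "MConstr (act_modfun C M Z F) (c', m') \<star> FArr (act_modfun C M Z F) (AArr M f g) =
        AArr M f (FArr (act_modfun C M Z F) g) \<star> MConstr (act_modfun C M Z F) (c, m)"
      by (simp add: Lwhisk_eq[OF rex_obj_MConstr(3)[OF F f g]] Lwhisk_Comp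
          M.Comp_reassoc[OF slide_natural_AArr[OF pre laws f rex_obj_functor(2)[OF F g]]])
  next
    fix c d m assume [simp]: "c \<in> Obj C" "d \<in> Obj C" "m \<in> Obj M"
    let ?n = "FObj F m" and ?s = "\<lambda>c m. inv_arr M (slide M Z c m)"
    have "MAssoc M c d (?z \<diamondop> ?n) \<star> ?s (c \<otimes> d) ?n \<star> (?z \<triangleright> MConstr F (c \<otimes> d, m)) =
        (c \<triangleright> ?s d ?n) \<star> ?s c (d \<diamondop> ?n) \<star> (?z \<triangleright> c \<triangleright> MConstr F (d, m)) \<star>
          (?z \<triangleright> MConstr F (c, d \<diamondop> m)) \<star> (?z \<triangleright> FArr F (MAssoc M c d m))"
      by (simp add: M.Comp_reassoc[OF inv_slide_hexagon[OF _ _ _ _ laws]]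
          Lwhisk_eq[OF rex_obj_MConstr(4)[OF F]] Lwhisk_Comp)
    \<comment> \<open>Naturality moves the inverse slide across the constraint of \<open>F\<close>
      at \<open>d\<close>, so that slides and constraints pair up into the constraints of the new
      functor.\<close>
    also have "\<dots> = (c \<triangleright> ?s d ?n) \<star> (c \<triangleright> ?z \<triangleright> MConstr F (d, m)) \<star> ?s c (FObj F (d \<diamondop> m)) \<star>
          (?z \<triangleright> MConstr F (c, d \<diamondop> m)) \<star> (?z \<triangleright> FArr F (MAssoc M c d m))"
      by (simp add: M.Comp_reassoc[OF slide_natural_AArr[OF pre laws C.Idn_in rex_obj_MConstr(1)[OF F]]])
    finally show "MAssoc M c d (FObj (act_modfun C M Z F) m) \<star>
          MConstr (act_modfun C M Z F) (c \<otimes> d, m) =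
        (c \<triangleright> MConstr (act_modfun C M Z F) (d, m)) \<star>
          MConstr (act_modfun C M Z F) (c, d \<diamondop> m) \<star> FArr (act_modfun C M Z F) (MAssoc M c d m)"
      by (simp add: Lwhisk_Comp)
  next
    fix m assume [simp]: "m \<in> Obj M"
    show "MUnit M (FObj (act_modfun C M Z F) m) \<star> MConstr (act_modfun C M Z F) (Unit C, m) =
        FArr (act_modfun C M Z F) (MUnit M m)"
      by (simp add: M.Comp_reassoc[OF inv_slide_unit[OF _ _ laws]] Lwhisk_eq[OF rex_obj_MConstr(5)[OF F]])
  qed
  then show ?thesis
    using right_exact_act_modfun[OF F, of Z] by (simp add: rex_obj_def)
qed

lemma id_modfun_in: "id_modfun C M \<in> rex_obj C M"
proof -
  note [simp] = id_modfun_simps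
  have lin: "linear_functor M M (FObj (id_modfun C M)) (FArr (id_modfun C M))"
    unfolding linear_functor_def
  proof (intro conjI allI ballI)
    fix x y f assume f: "f \<in> Hom M x y"
    then show "FArr (id_modfun C M) f \<in> Hom M (FObj (id_modfun C M) x) (FObj (id_modfun C M) y)"
      by (auto simp: in_Hom)
    fix g assume g: "g \<in> Hom M x y"
    show "FArr (id_modfun C M) (Plus M f g) = Plus M (FArr (id_modfun C M) f) (FArr (id_modfun C M) g)"
      using f g M.Plus_in[OF f g] by (simp add: in_Hom)
  next
    fix x y z f g assume f: "f \<in> Hom M x y" and g: "g \<in> Hom M y z"
    then show "FArr (id_modfun C M) (g \<star> f) = FArr (id_modfun C M) g \<star> FArr (id_modfun C M) f"
      by (simp add: in_Hom)
  next
    fix a f assume f: "f \<in> Arr M"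
    then show "FArr (id_modfun C M) (Scal M a f) = Scal M a (FArr (id_modfun C M) f)"
      using M.Scal_in[of f "Dom M f" "Cod M f" a] by (simp add: in_Hom)
  qed simp_all
  moreover have "right_exact M M (FObj (id_modfun C M)) (FArr (id_modfun C M))"
    unfolding right_exact_def
  proof (intro conjI allI impI lin)
    fix f p assume fp: "is_cokernel M f p"
    then have "f \<in> Arr M" "p \<in> Arr M"
      unfolding is_cokernel_def by blast+
    with fp show "is_cokernel M (FArr (id_modfun C M) f) (FArr (id_modfun C M) p)"
      by simp
  qed
  moreover have "module_endofunctor C M (id_modfun C M)"
    unfolding module_endofunctor_def
  proof (intro conjI allI ballI lin)
    show "FObj (id_modfun C M) \<in> extensional (Obj M)"
      "FArr (id_modfun C M) \<in> extensional (Arr M)"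
      "MConstr (id_modfun C M) \<in> extensional (Obj C \<times> Obj M)"
      by (simp_all add: id_modfun_def)
  next
    fix c c' m m' f g assume "f \<in> Hom C c c'" "g \<in> Hom M m m'"
    then have "f \<in> Arr C" "Dom C f = c" "Cod C f = c'" "c \<in> Obj C" "c' \<in> Obj C"
      "g \<in> Arr M" "Dom M g = m" "Cod M g = m'" "m \<in> Obj M" "m' \<in> Obj M"
      using C.Dom_in C.Cod_in M.Dom_in M.Cod_in by (auto simp: in_Hom)
    then show "MConstr (id_modfun C M) (c', m') \<star> FArr (id_modfun C M) (AArr M f g) =
        AArr M f (FArr (id_modfun C M) g) \<star> MConstr (id_modfun C M) (c, m)"
      by simp
  qed (simp_all add: in_Hom)
  ultimately show ?thesis
    by (simp add: rex_obj_def)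
qed

end

text \<open>Transformations are extensional, so agreement on objects is equality. This settles laws
  such as the unit laws of \<open>Rex C M\<close>, whose composition restricts its result to the
  objects.\<close>

lemma restrict_eq_module_nat:
  assumes "module_nat C M F G \<eta>" "\<And>m. m \<in> Obj M \<Longrightarrow> f m = \<eta> m"
  shows "restrict f (Obj M) = \<eta>"
  using assms module_nat_extensional[OF assms(1)] by (auto intro: extensionalityI)

lemma Arr_Rex: "(F, \<eta>, G) \<in> Arr (Rex C M) \<longleftrightarrow>
    F \<in> rex_obj C M \<and> G \<in> rex_obj C M \<and> module_nat C M F G \<eta>"
  by (simp add: Rex_def)

subsection \<open>The category of module functors\<close>

context finite_module_category
begin

lemma module_nat_simps:
  assumes "module_nat C M F G \<eta>" "m \<in> Obj M"
  shows "\<eta> m \<in> Arr M" "Dom M (\<eta> m) = FObj F m" "Cod M (\<eta> m) = FObj G m"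
  using module_nat_Hom[OF assms] by (simp_all add: in_Hom)

lemma module_natI:
  assumes "\<And>m. m \<in> Obj M \<Longrightarrow> \<eta> m \<in> Hom M (FObj F m) (FObj G m)"
    and "\<And>m n g. g \<in> Hom M m n \<Longrightarrow> m \<in> Obj M \<Longrightarrow> n \<in> Obj M \<Longrightarrow> \<eta> n \<star> FArr F g = FArr G g \<star> \<eta> m"
    and "\<And>c m. c \<in> Obj C \<Longrightarrow> m \<in> Obj M \<Longrightarrow>
      (c \<triangleright> \<eta> m) \<star> MConstr F (c, m) = MConstr G (c, m) \<star> \<eta> (c \<diamondop> m)"
  shows "module_nat C M F G (\<lambda>m\<in>Obj M. \<eta> m)"
  unfolding module_nat_def
proof (intro conjI allI ballI)
  fix m n g assume g: "g \<in> Hom M m n"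
  then have "m \<in> Obj M" "n \<in> Obj M"
    using M.Dom_in M.Cod_in by (auto simp: in_Hom)
  then show "(\<lambda>m\<in>Obj M. \<eta> m) n \<star> FArr F g = FArr G g \<star> (\<lambda>m\<in>Obj M. \<eta> m) m"
    using assms(2)[OF g] by simp
qed (use assms(1,3) in simp_all)

lemma module_nat_Idn:
  assumes [simp]: "F \<in> rex_obj C M"
  shows "module_nat C M F F (\<lambda>m\<in>Obj M. Idn M (FObj F m))"
  by (rule module_natI) (auto simp: in_Hom)

lemma module_nat_Comp:
  assumes [simp]: "F \<in> rex_obj C M" "G \<in> rex_obj C M" "H \<in> rex_obj C M"
    and \<eta>: "module_nat C M F G \<eta>" and \<theta>: "module_nat C M G H \<theta>"
  shows "module_nat C M F H (\<lambda>m\<in>Obj M. \<theta> m \<star> \<eta> m)"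
proof (rule module_natI)
  note [simp] = module_nat_simps[OF \<eta>] module_nat_simps[OF \<theta>]
  fix m n g assume g: "g \<in> Hom M m n" and [simp]: "m \<in> Obj M" "n \<in> Obj M"
  then have [simp]: "g \<in> Arr M" "Dom M g = m" "Cod M g = n"
    by (auto simp: in_Hom)
  show "(\<theta> n \<star> \<eta> n) \<star> FArr F g = FArr H g \<star> \<theta> m \<star> \<eta> m"
    by (simp add: module_nat_natural[OF \<eta> g] M.Comp_reassoc[OF module_nat_natural[OF \<theta> g]])
next
  note [simp] = module_nat_simps[OF \<eta>] module_nat_simps[OF \<theta>]
  fix c m assume [simp]: "c \<in> Obj C" "m \<in> Obj M"
  show "(c \<triangleright> (\<theta> m \<star> \<eta> m)) \<star> MConstr F (c, m) = MConstr H (c, m) \<star> \<theta> (c \<diamondop> m) \<star> \<eta> (c \<diamondop> m)"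
    by (simp add: Lwhisk_Comp module_nat_MConstr[OF \<eta>] M.Comp_reassoc[OF module_nat_MConstr[OF \<theta>]])
qed (simp add: in_Hom module_nat_simps[OF \<eta>] module_nat_simps[OF \<theta>])

lemma module_nat_Plus:
  assumes F: "F \<in> rex_obj C M" and G: "G \<in> rex_obj C M"
    and \<eta>: "module_nat C M F G \<eta>" and \<theta>: "module_nat C M F G \<theta>"
  shows "module_nat C M F G (\<lambda>m\<in>Obj M. Plus M (\<eta> m) (\<theta> m))"
proof (rule module_natI)
  note Hom = module_nat_Hom[OF \<eta>] module_nat_Hom[OF \<theta>]
  show "Plus M (\<eta> m) (\<theta> m) \<in> Hom M (FObj F m) (FObj G m)" if "m \<in> Obj M" for m
    using that by (intro M.Plus_in Hom)
  show "Plus M (\<eta> n) (\<theta> n) \<star> FArr F g = FArr G g \<star> Plus M (\<eta> m) (\<theta> m)"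
    if g: "g \<in> Hom M m n" and m: "m \<in> Obj M" and n: "n \<in> Obj M" for m n g
    using M.Comp_Plus_left[OF rex_obj_functor(2)[OF F g] Hom[OF n]]
      M.Comp_Plus_right[OF Hom[OF m] rex_obj_functor(2)[OF G g]]
    by (simp add: module_nat_natural[OF \<eta> g] module_nat_natural[OF \<theta> g])
  show "(c \<triangleright> Plus M (\<eta> m) (\<theta> m)) \<star> MConstr F (c, m) =
      MConstr G (c, m) \<star> Plus M (\<eta> (c \<diamondop> m)) (\<theta> (c \<diamondop> m))"
    if c: "c \<in> Obj C" and m: "m \<in> Obj M" for c m
    using M.Comp_Plus_left[OF rex_obj_MConstr(1)[OF F c m] AArr_in[OF C.Idn_in[OF c] Hom(1)[OF m]]
        AArr_in[OF C.Idn_in[OF c] Hom(2)[OF m]]]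
      M.Comp_Plus_right[OF Hom[OF AObj_in[OF c m]] rex_obj_MConstr(1)[OF G c m]]
    by (simp add: module_nat_MConstr[OF \<eta> c m] module_nat_MConstr[OF \<theta> c m]
        AArr_Plus_right[OF C.Idn_in[OF c] Hom[OF m]])
qed

lemma module_nat_Scal:
  assumes F: "F \<in> rex_obj C M" and G: "G \<in> rex_obj C M" and \<eta>: "module_nat C M F G \<eta>"
  shows "module_nat C M F G (\<lambda>m\<in>Obj M. Scal M a (\<eta> m))"
proof (rule module_natI)
  note Hom = module_nat_Hom[OF \<eta>]
  show "Scal M a (\<eta> m) \<in> Hom M (FObj F m) (FObj G m)" if "m \<in> Obj M" for m
    using that by (intro M.Scal_in Hom)
  show "Scal M a (\<eta> n) \<star> FArr F g = FArr G g \<star> Scal M a (\<eta> m)"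
    if g: "g \<in> Hom M m n" and m: "m \<in> Obj M" and n: "n \<in> Obj M" for m n g
    using M.Comp_Scal_left[OF rex_obj_functor(2)[OF F g] Hom[OF n]]
      M.Comp_Scal_right[OF Hom[OF m] rex_obj_functor(2)[OF G g]]
    by (simp add: module_nat_natural[OF \<eta> g])
  show "(c \<triangleright> Scal M a (\<eta> m)) \<star> MConstr F (c, m) = MConstr G (c, m) \<star> Scal M a (\<eta> (c \<diamondop> m))"
    if c: "c \<in> Obj C" and m: "m \<in> Obj M" for c m
    using M.Comp_Scal_left[OF rex_obj_MConstr(1)[OF F c m] AArr_in[OF C.Idn_in[OF c] Hom[OF m]]]
      M.Comp_Scal_right[OF Hom[OF AObj_in[OF c m]] rex_obj_MConstr(1)[OF G c m]]
      AArr_Scal_right[of "Idn C c" "\<eta> m" a] c m module_nat_simps[OF \<eta>]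
    by (simp add: module_nat_MConstr[OF \<eta> c m])
qed

lemma module_nat_Zero:
  assumes F: "F \<in> rex_obj C M" and G: "G \<in> rex_obj C M"
  shows "module_nat C M F G (\<lambda>m\<in>Obj M. Zero M (FObj F m) (FObj G m))"
proof (rule module_natI)
  show "Zero M (FObj F m) (FObj G m) \<in> Hom M (FObj F m) (FObj G m)" if "m \<in> Obj M" for m
    using that F G by (intro M.Zero_in) simp_all
  show "Zero M (FObj F n) (FObj G n) \<star> FArr F g = FArr G g \<star> Zero M (FObj F m) (FObj G m)"
    if g: "g \<in> Hom M m n" and "m \<in> Obj M" "n \<in> Obj M" for m n g
    using that F G
    by (simp add: M.Comp_Zero_left[OF rex_obj_functor(2)[OF F g]]
        M.Comp_Zero_right[OF rex_obj_functor(2)[OF G g]])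
  show "(c \<triangleright> Zero M (FObj F m) (FObj G m)) \<star> MConstr F (c, m) =
      MConstr G (c, m) \<star> Zero M (FObj F (c \<diamondop> m)) (FObj G (c \<diamondop> m))"
    if c: "c \<in> Obj C" and m: "m \<in> Obj M" for c m
  proof -
    let ?z = "Zero M (FObj F m) (FObj G m)"
    have z: "?z \<in> Hom M (FObj F m) (FObj G m)"
      using F G m by (intro M.Zero_in) simp_all
    \<comment> \<open>The zero arrow is written as zero times itself, because the action is
      specified on sums and scalar multiples.\<close>
    have "c \<triangleright> ?z = c \<triangleright> Scal M 0 ?z"
      by (simp add: M.Scal_zero[OF z])
    also have "\<dots> = Zero M (c \<diamondop> FObj F m) (c \<diamondop> FObj G m)"
      using z c M.Scal_zero[OF AArr_in[OF C.Idn_in[OF c] z]]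
      by (subst AArr_Scal_right) (simp_all add: in_Hom)
    finally show ?thesis
      using F G c m M.Comp_Zero_left[OF rex_obj_MConstr(1)[OF F c m]]
        M.Comp_Zero_right[OF rex_obj_MConstr(1)[OF G c m]]
      by simp
  qed
qed

lemma linear_category_Rex: "linear_category (Rex C M)"
proof
  fix E E' F G H a
  assume "E \<in> Hom (Rex C M) F G"
  then obtain \<eta> where E: "E = (F, \<eta>, G)" "F \<in> rex_obj C M" "G \<in> rex_obj C M"
    "module_nat C M F G \<eta>"
    by (auto simp: in_Hom_Rex)
  show "Comp (Rex C M) (Idn (Rex C M) G) E = E" "Comp (Rex C M) E (Idn (Rex C M) F) = E"
    "Plus (Rex C M) E (Zero (Rex C M) F G) = E" "Scal (Rex C M) 1 E = E"
    using E(1-3) module_nat_simps[OF E(4)] M.Plus_Zero[OF module_nat_Hom[OF E(4)]]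
      M.Scal_one[OF module_nat_Hom[OF E(4)]]
    by (simp_all add: restrict_eq_module_nat[OF E(4)])
  show "Scal (Rex C M) a E \<in> Hom (Rex C M) F G"
    using E by (simp add: in_Hom_Rex module_nat_Scal)
  show "Comp (Rex C M) E' E \<in> Hom (Rex C M) F H" if "E' \<in> Hom (Rex C M) G H"
    using that E module_nat_Comp[of F G H \<eta>] by (auto simp: in_Hom_Rex)
  show "Plus (Rex C M) E E' \<in> Hom (Rex C M) F G" if "E' \<in> Hom (Rex C M) F G"
    using that E by (auto simp: in_Hom_Rex module_nat_Plus)
next
  fix E
  assume "E \<in> Arr (Rex C M)"
  then show "Dom (Rex C M) E \<in> Obj (Rex C M)" "Cod (Rex C M) E \<in> Obj (Rex C M)"
    by (cases E, simp add: Arr_Rex)+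
qed ((auto simp: in_Hom_Rex module_nat_Idn module_nat_Zero intro!: restrict_ext),
    ((drule (1) module_nat_Hom)+, (rule M.Comp_assoc M.Plus_assoc M.Plus_commute M.Plus_minus
      M.Scal_Plus M.Scal_add M.Scal_mult M.Comp_Plus_left M.Comp_Plus_right M.Comp_Scal_left
      M.Comp_Scal_right; assumption))+)

text \<open>Cancelling the components of \<open>\<eta>\<close> shows that the inverse components
  again satisfy naturality and the module condition.\<close>

lemma is_iso_Rex:
  assumes [simp]: "F \<in> rex_obj C M" "G \<in> rex_obj C M" and \<eta>: "module_nat C M F G \<eta>"
    and iso: "\<And>m. m \<in> Obj M \<Longrightarrow> is_iso M (\<eta> m)"
  shows "is_iso (Rex C M) (F, \<eta>, G)"
proof -
  note [simp] = module_nat_simps[OF \<eta>] iso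
  have "module_nat C M G F (\<lambda>m\<in>Obj M. inv_arr M (\<eta> m))"
  proof (rule module_natI)
    fix m n g assume g: "g \<in> Hom M m n" and [simp]: "m \<in> Obj M" "n \<in> Obj M"
    then have [simp]: "g \<in> Arr M" "Dom M g = m" "Cod M g = n"
      by (auto simp: in_Hom)
    show "inv_arr M (\<eta> n) \<star> FArr G g = FArr F g \<star> inv_arr M (\<eta> m)"
      by (rule M.iso_square_inv[OF module_nat_natural[OF \<eta> g, symmetric]]) simp_all
  next
    fix c m assume [simp]: "c \<in> Obj C" "m \<in> Obj M"
    have "(c \<triangleright> \<eta> m) \<star> ((c \<triangleright> inv_arr M (\<eta> m)) \<star> MConstr G (c, m)) =
        (c \<triangleright> \<eta> m) \<star> (MConstr F (c, m) \<star> inv_arr M (\<eta> (c \<diamondop> m)))"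
      by (simp add: M.Comp_reassoc[OF module_nat_MConstr[OF \<eta>]] M.Comp_reassoc[OF Lwhisk_inv(1)])
    then show "(c \<triangleright> inv_arr M (\<eta> m)) \<star> MConstr G (c, m) = MConstr F (c, m) \<star> inv_arr M (\<eta> (c \<diamondop> m))"
      by (rule M.iso_cancel_left) simp_all
  qed (simp add: in_Hom)
  then show ?thesis
    unfolding is_iso_def is_inverse_def using \<eta>
    by (intro conjI exI[of _ "(G, \<lambda>m\<in>Obj M. inv_arr M (\<eta> m), F)"])
      (auto simp: Arr_Rex in_Hom_Rex intro!: restrict_ext)
qed

lemma module_nat_AArr:
  assumes f: "(X, f, Y) \<in> center_arr C" and F [simp]: "F \<in> rex_obj C M" and G [simp]: "G \<in> rex_obj C M"
    and \<eta>: "module_nat C M F G \<eta>"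
  shows "module_nat C M (act_modfun C M X F) (act_modfun C M Y G) (\<lambda>m\<in>Obj M. AArr M f (\<eta> m))"
proof (rule module_natI)
  note [simp] = module_nat_simps[OF \<eta>] act_modfun_simps act_modfun_MConstr
  have [simp]: "f \<in> Arr C" "Dom C f = fst X" "Cod C f = fst Y" "pre_half_braiding C X"
     "pre_half_braiding C Y"
    using center_arrD[OF f] by (auto simp: in_Hom center_obj_pre)
  show "AArr M f (\<eta> m) \<in> Hom M (FObj (act_modfun C M X F) m) (FObj (act_modfun C M Y G) m)"
    if "m \<in> Obj M" for m
    using that by (simp add: in_Hom)
  show "AArr M f (\<eta> n) \<star> FArr (act_modfun C M X F) g = FArr (act_modfun C M Y G) g \<star> AArr M f (\<eta> m)"
    if g: "g \<in> Hom M m n" and [simp]: "m \<in> Obj M" "n \<in> Obj M" for m n g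
  proof -
    have [simp]: "g \<in> Arr M" "Dom M g = m" "Cod M g = n"
      using g by (auto simp: in_Hom)
    show ?thesis
      using AArr_Comp_arr[of "Idn C (fst X)" f "FArr F g" "\<eta> n"]
        AArr_Comp_arr[of f "Idn C (fst Y)" "\<eta> m" "FArr G g"]
      by (simp add: module_nat_natural[OF \<eta> g])
  qed
  show "(c \<triangleright> AArr M f (\<eta> m)) \<star> MConstr (act_modfun C M X F) (c, m) =
      MConstr (act_modfun C M Y G) (c, m) \<star> AArr M f (\<eta> (c \<diamondop> m))"
    if [simp]: "c \<in> Obj C" "m \<in> Obj M" for c m
  proof -
    have "(c \<triangleright> AArr M f (\<eta> m)) \<star> MConstr (act_modfun C M X F) (c, m) =
        inv_arr M (slide M Y c (FObj G m)) \<star> AArr M f (c \<triangleright> \<eta> m) \<star> (fst X \<triangleright> MConstr F (c, m))"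
      by (simp add: M.Comp_reassoc[OF center_arr_slide_AArr[OF f _ module_nat_Hom[OF \<eta>], symmetric]])
    also have "AArr M f (c \<triangleright> \<eta> m) \<star> (fst X \<triangleright> MConstr F (c, m)) =
        (fst Y \<triangleright> MConstr G (c, m)) \<star> AArr M f (\<eta> (c \<diamondop> m))"
      using AArr_Comp_arr[of "Idn C (fst X)" f "MConstr F (c, m)" "c \<triangleright> \<eta> m"]
        AArr_Comp_arr[of f "Idn C (fst Y)" "\<eta> (c \<diamondop> m)" "MConstr G (c, m)"]
      by (simp add: module_nat_MConstr[OF \<eta>])
    finally show ?thesis
      by simp
  qed
qed

text \<open>The constraint of the iterated action moves \<open>c\<close> out past \<open>Y\<close>
  and then past \<open>X\<close>. By \<open>inv_slide_tensor\<close> the half-braiding of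
  \<open>center_tensor C X Y\<close> does the same; naturality of \<open>MAssoc\<close> takes care
  of the constraint of \<open>F\<close>.\<close>

lemma module_nat_MAssoc:
  assumes X: "X \<in> center_obj C" and Y: "Y \<in> center_obj C" and F [simp]: "F \<in> rex_obj C M"
  shows "module_nat C M (act_modfun C M (center_tensor C X Y) F)
    (act_modfun C M X (act_modfun C M Y F)) (\<lambda>m\<in>Obj M. MAssoc M (fst X) (fst Y) (FObj F m))"
proof (rule module_natI)
  have [simp]: "pre_half_braiding C X" "pre_half_braiding C Y" "act_modfun C M Y F \<in> rex_obj C M"
    using X Y by (auto simp: center_obj_pre act_modfun_in)
  note [simp] = act_modfun_simps act_modfun_MConstr
  show "MAssoc M (fst X) (fst Y) (FObj F m) \<in> Hom M (FObj (act_modfun C M (center_tensor C X Y) F) m)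
      (FObj (act_modfun C M X (act_modfun C M Y F)) m)" if "m \<in> Obj M" for m
    using that by (simp add: in_Hom)
  show "MAssoc M (fst X) (fst Y) (FObj F n) \<star> FArr (act_modfun C M (center_tensor C X Y) F) g =
      FArr (act_modfun C M X (act_modfun C M Y F)) g \<star> MAssoc M (fst X) (fst Y) (FObj F m)"
    if g: "g \<in> Hom M m n" and [simp]: "m \<in> Obj M" "n \<in> Obj M" for m n g
    using g by (simp add: in_Hom MAssoc_nat3[OF rex_obj_functor(2)[OF F g]])
  show "(c \<triangleright> MAssoc M (fst X) (fst Y) (FObj F m)) \<star>
        MConstr (act_modfun C M (center_tensor C X Y) F) (c, m) =
      MConstr (act_modfun C M X (act_modfun C M Y F)) (c, m) \<star>
        MAssoc M (fst X) (fst Y) (FObj F (c \<diamondop> m))"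
    if [simp]: "c \<in> Obj C" "m \<in> Obj M" for c m
    by (simp add: Lwhisk_Comp M.Comp_reassoc[OF inv_slide_tensor] MAssoc_nat3[OF rex_obj_MConstr(1)[OF F]])
qed

lemma module_nat_MUnit:
  assumes F [simp]: "F \<in> rex_obj C M"
  shows "module_nat C M (act_modfun C M (center_unit C) F) F (\<lambda>m\<in>Obj M. MUnit M (FObj F m))"
proof (rule module_natI)
  note [simp] = act_modfun_simps act_modfun_MConstr
  show "MUnit M (FObj F m) \<in> Hom M (FObj (act_modfun C M (center_unit C) F) m) (FObj F m)"
    if "m \<in> Obj M" for m
    using that by (simp add: in_Hom)
  show "MUnit M (FObj F n) \<star> FArr (act_modfun C M (center_unit C) F) g = FArr F g \<star> MUnit M (FObj F m)"
    if g: "g \<in> Hom M m n" and [simp]: "m \<in> Obj M" "n \<in> Obj M" for m n g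
    using g by (simp add: in_Hom MUnit_nat[OF rex_obj_functor(2)[OF F g]])
  show "(c \<triangleright> MUnit M (FObj F m)) \<star> MConstr (act_modfun C M (center_unit C) F) (c, m) =
      MConstr F (c, m) \<star> MUnit M (FObj F (c \<diamondop> m))"
    if [simp]: "c \<in> Obj C" "m \<in> Obj M" for c m
    by (simp add: M.Comp_reassoc[OF inv_slide_center_unit] MUnit_nat[OF rex_obj_MConstr(1)[OF F]])
qed

text \<open>Arrows of \<open>Rex C M\<close> are families of components, so coherence is that of
  \<open>M\<close> at the objects \<open>FObj F m\<close>. The preceding lemmas ensure that the
  structural families are module transformations.\<close>

lemma module_category_Rex: "module_category (center C) (Rex C M)"
proof (intro module_category.intro module_category_axioms.intro C.linear_monoidal_category_center
    linear_category_Rex)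
  fix c E X Y F G a
  assume "c \<in> Hom (center C) X Y" "E \<in> Hom (Rex C M) F G"
  then show "AArr (Rex C M) c E \<in> Hom (Rex C M) (AObj (Rex C M) X F) (AObj (Rex C M) Y G)"
    by (auto simp: in_Hom_Rex in_Hom_center module_nat_AArr act_modfun_in center_arrD)
next
  fix c E a
  assume "c \<in> Arr (center C)" "E \<in> Arr (Rex C M)"
  then obtain X f Y F \<eta> G where cE: "c = (X, f, Y)" "(X, f, Y) \<in> center_arr C" "E = (F, \<eta>, G)"
    "module_nat C M F G \<eta>"
    by (cases c, cases E) (auto simp: Arr_Rex)
  have "f \<in> Arr C"
    using center_arrD(1)[OF cE(2)] by (simp add: in_Hom)
  with cE show "AArr (Rex C M) (Scal (center C) a c) E = Scal (Rex C M) a (AArr (Rex C M) c E)"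
    "AArr (Rex C M) c (Scal (Rex C M) a E) = Scal (Rex C M) a (AArr (Rex C M) c E)"
    using module_nat_simps(1)[OF cE(4)]
    by (auto simp: AArr_Scal_left AArr_Scal_right intro!: restrict_ext)
next
  fix X Y F
  assume "X \<in> Obj (center C)" "Y \<in> Obj (center C)" "F \<in> Obj (Rex C M)"
  then show "MAssoc (Rex C M) X Y F \<in>
      Hom (Rex C M) (AObj (Rex C M) (X \<otimes>\<^bsub>center C\<^esub> Y) F) (AObj (Rex C M) X (AObj (Rex C M) Y F))"
    "is_iso (Rex C M) (MAssoc (Rex C M) X Y F)"
    by (auto simp: in_Hom_Rex module_nat_MAssoc act_modfun_in C.center_tensor_in C.center_objD
        intro!: is_iso_Rex)
next
  fix F
  assume "F \<in> Obj (Rex C M)"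
  then show "MUnit (Rex C M) F \<in> Hom (Rex C M) (AObj (Rex C M) (Unit (center C)) F) F"
    "is_iso (Rex C M) (MUnit (Rex C M) F)"
    by (auto simp: in_Hom_Rex module_nat_MUnit act_modfun_in C.center_unit_in intro!: is_iso_Rex)
next
  fix X Y Z F
  assume "X \<in> Obj (center C)" "Y \<in> Obj (center C)" "Z \<in> Obj (center C)" "F \<in> Obj (Rex C M)"
  then have "X \<in> center_obj C" "Y \<in> center_obj C" "Z \<in> center_obj C" and F: "F \<in> rex_obj C M"
    by simp_all
  note XYZ = this(1-3)[THEN C.center_objD(1)]
  show "Comp (Rex C M) (AArr (Rex C M) (Idn (center C) X) (MAssoc (Rex C M) Y Z F))
      (Comp (Rex C M) (MAssoc (Rex C M) X (Y \<otimes>\<^bsub>center C\<^esub> Z) F)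
        (AArr (Rex C M) (Assoc (center C) X Y Z) (Idn (Rex C M) F))) =
    Comp (Rex C M) (MAssoc (Rex C M) X Y (AObj (Rex C M) Z F))
      (MAssoc (Rex C M) (X \<otimes>\<^bsub>center C\<^esub> Y) Z F)"
    using XYZ F module_pentagon[OF XYZ] by (auto simp: act_modfun_simps intro!: restrict_ext)
qed ((auto simp: in_Hom_Rex in_Hom_center act_modfun_in act_modfun_simps module_triangle dest: C.center_objD(1) dest!: center_arrD(1) intro!: restrict_ext),
    ((drule (1) module_nat_Hom)+, (rule AArr_Comp AArr_Plus_left AArr_Plus_right MAssoc_nat
      MUnit_nat; assumption))+)

end

subsection \<open>Internal endomorphism algebras\<close>

context module_category
begin

text \<open>The Yoneda argument: naturality of \<open>\<Phi>\<close> at \<open>g\<close>, applied to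
  the identity of \<open>h\<close>, expresses \<open>\<Phi>\<close> through the evaluation.\<close>

lemma internal_hom_eval:
  assumes "is_internal_hom C M m n h \<Phi>" "m \<in> Obj M"
  shows "h \<in> Obj C" "internal_ev C h \<Phi> \<in> Hom M (h \<diamondop> m) n"
    and "g \<in> Hom C x h \<Longrightarrow> \<Phi> x g = internal_ev C h \<Phi> \<star> (g \<triangleleft> m)"
proof -
  have h: "h \<in> Obj C"
    and bij: "bij_betw (\<Phi> x) (Hom C x h) (Hom M (x \<diamondop> m) n)" if "x \<in> Obj C" for x
    using assms(1) that unfolding is_internal_hom_def by blast+
  have nat: "\<Phi> x (g \<cdot> f) = \<Phi> y g \<star> (f \<triangleleft> m)" if "f \<in> Hom C x y" "g \<in> Hom C y h" for f g x y
    using assms(1) that unfolding is_internal_hom_def by blast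
  show "h \<in> Obj C"
    using assms(1) unfolding is_internal_hom_def by blast
  then show "internal_ev C h \<Phi> \<in> Hom M (h \<diamondop> m) n"
    unfolding internal_ev_def using C.Idn_in by (intro bij_betwE[OF bij, rule_format])
  show "\<Phi> x g = internal_ev C h \<Phi> \<star> (g \<triangleleft> m)" if g: "g \<in> Hom C x h"
    using nat[OF g C.Idn_in] \<open>h \<in> Obj C\<close> C.Idn_left[OF g] by (simp add: internal_ev_def)
qed

lemma internal_hom_eqI:
  assumes h: "is_internal_hom C M m n h \<Phi>" "m \<in> Obj M"
    and g: "g \<in> Hom C x h" "g' \<in> Hom C x h"
    and eq: "internal_ev C h \<Phi> \<star> (g \<triangleleft> m) = internal_ev C h \<Phi> \<star> (g' \<triangleleft> m)"
  shows "g = g'"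
proof -
  have "x \<in> Obj C"
    using g(1) C.Dom_in by (auto simp: in_Hom)
  then have "inj_on (\<Phi> x) (Hom C x h)"
    using h(1) bij_betw_imp_inj_on unfolding is_internal_hom_def by blast
  then show ?thesis
    using g eq internal_hom_eval(3)[OF h] by (metis inj_onD)
qed

lemma internal_hom_inv_into:
  assumes h: "is_internal_hom C M m n h \<Phi>" "m \<in> Obj M" and x: "x \<in> Obj C" and k: "k \<in> Hom M (x \<diamondop> m) n"
  shows "inv_into (Hom C x h) (\<Phi> x) k \<in> Hom C x h"
    and "internal_ev C h \<Phi> \<star> (inv_into (Hom C x h) (\<Phi> x) k \<triangleleft> m) = k"
proof -
  have "k \<in> \<Phi> x ` Hom C x h"
    using h(1) x k bij_betw_imp_surj_on unfolding is_internal_hom_def by blast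
  then show "inv_into (Hom C x h) (\<Phi> x) k \<in> Hom C x h"
    "internal_ev C h \<Phi> \<star> (inv_into (Hom C x h) (\<Phi> x) k \<triangleleft> m) = k"
    using internal_hom_eval(3)[OF h] by (metis inv_into_into, metis inv_into_into f_inv_into_f)
qed

text \<open>Bijectivity of \<open>\<Phi>\<close> replaces the definitions by \<open>inv_into\<close>
  with characterising equations: evaluating a product is evaluating twice, and evaluating the unit
  is \<open>MUnit\<close>.\<close>

lemma
  assumes h: "is_internal_hom C M m m A \<Phi>" "m \<in> Obj M"
  shows internal_mult: "internal_mult C M m A \<Phi> \<in> Hom C (A \<otimes> A) A"
      "internal_ev C A \<Phi> \<star> (internal_mult C M m A \<Phi> \<triangleleft> m) =
        internal_ev C A \<Phi> \<star> (A \<triangleright> internal_ev C A \<Phi>) \<star> MAssoc M A A m"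
    and internal_unit: "internal_unit C M m A \<Phi> \<in> Hom C (Unit C) A"
      "internal_ev C A \<Phi> \<star> (internal_unit C M m A \<Phi> \<triangleleft> m) = MUnit M m"
proof -
  have "A \<in> Obj C" "internal_ev C A \<Phi> \<star> (A \<triangleright> internal_ev C A \<Phi>) \<star> MAssoc M A A m \<in> Hom M ((A \<otimes> A) \<diamondop> m) m"
    "MUnit M m \<in> Hom M (Unit C \<diamondop> m) m"
    using internal_hom_eval(1,2)[OF h] h(2) by (simp_all add: in_Hom)
  then show "internal_mult C M m A \<Phi> \<in> Hom C (A \<otimes> A) A"
      "internal_ev C A \<Phi> \<star> (internal_mult C M m A \<Phi> \<triangleleft> m) =
        internal_ev C A \<Phi> \<star> (A \<triangleright> internal_ev C A \<Phi>) \<star> MAssoc M A A m"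
      "internal_unit C M m A \<Phi> \<in> Hom C (Unit C) A"
      "internal_ev C A \<Phi> \<star> (internal_unit C M m A \<Phi> \<triangleleft> m) = MUnit M m"
    unfolding internal_mult_def internal_unit_def using internal_hom_inv_into[OF h] by simp_all
qed

text \<open>Evaluation behaves like an action of \<open>A\<close> on \<open>m\<close>, and arrows
  into \<open>A\<close> are tested by evaluating. Both sides of associativity then become a
  threefold evaluation, related by the module pentagon; the unit laws come from
  \<open>MUnit_MAssoc\<close> and the module triangle.\<close>

theorem internal_end_is_algebra:
  assumes h: "is_internal_hom C M m m A \<Phi>" "m \<in> Obj M"
  shows "is_algebra C A (internal_mult C M m A \<Phi>) (internal_unit C M m A \<Phi>)"
proof -
  define e \<mu> \<eta> where "e = internal_ev C A \<Phi>" and "\<mu> = internal_mult C M m A \<Phi>"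
    and "\<eta> = internal_unit C M m A \<Phi>"
  have e: "e \<in> Hom M (A \<diamondop> m) m" and \<mu>: "\<mu> \<in> Hom C (A \<otimes> A) A" and \<eta>: "\<eta> \<in> Hom C (Unit C) A"
    and e\<mu>: "e \<star> (\<mu> \<triangleleft> m) = e \<star> (A \<triangleright> e) \<star> MAssoc M A A m" and e\<eta>: "e \<star> (\<eta> \<triangleleft> m) = MUnit M m"
    and [simp]: "A \<in> Obj C" "m \<in> Obj M"
    using internal_hom_eval(1,2)[OF h] internal_mult[OF h] internal_unit[OF h] h(2)
    by (simp_all add: e_def \<mu>_def \<eta>_def)
  have [simp]: "e \<in> Arr M" "Dom M e = A \<diamondop> m" "Cod M e = m" "\<mu> \<in> Arr C" "Dom C \<mu> = A \<otimes> A" "Cod C \<mu> = A"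
    "\<eta> \<in> Arr C" "Dom C \<eta> = Unit C" "Cod C \<eta> = A"
    using e \<mu> \<eta> by (auto simp: in_Hom)
  have eqI: "g = g'" if "e \<star> (g \<triangleleft> m) = e \<star> (g' \<triangleleft> m)" "g \<in> Hom C x A" "g' \<in> Hom C x A" for g g' x
    using internal_hom_eqI[OF h that(2,3)] that(1) by (simp add: e_def)
  note e\<mu>' = M.Comp_reassoc[OF e\<mu>] and e\<eta>' = M.Comp_reassoc[OF e\<eta>]
  have "\<mu> \<cdot> (\<mu> \<boxtimes> Idn C A) = \<mu> \<cdot> (Idn C A \<boxtimes> \<mu>) \<cdot> Assoc C A A A"
  proof (rule eqI)
    have "e \<star> ((\<mu> \<cdot> (\<mu> \<boxtimes> Idn C A)) \<triangleleft> m) =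
        e \<star> (A \<triangleright> e) \<star> (\<mu> \<triangleleft> (A \<diamondop> m)) \<star> MAssoc M (A \<otimes> A) A m"
      by (simp add: Rwhisk_Comp e\<mu>' MAssoc_nat1[OF \<mu>])
    \<comment> \<open>Interchange: evaluating the innermost copy of \<open>A\<close> commutes with
      multiplying the outer two.\<close>
    also have "\<dots> = e \<star> (\<mu> \<triangleleft> m) \<star> ((A \<otimes> A) \<triangleright> e) \<star> MAssoc M (A \<otimes> A) A m"
      by (simp add: M.Comp_reassoc[OF whisk_swap[OF \<mu> e, symmetric]])
    also have "\<dots> = e \<star> (A \<triangleright> e) \<star> (A \<triangleright> A \<triangleright> e) \<star> MAssoc M A A (A \<diamondop> m) \<star> MAssoc M (A \<otimes> A) A m"
      by (simp add: e\<mu>' M.Comp_reassoc[OF MAssoc_nat3[OF e]])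
    \<comment> \<open>The module pentagon rebrackets the three copies of \<open>A\<close>; the inner
      double evaluation is collected so that it can be replaced by \<open>\<mu>\<close>.\<close>
    also have "\<dots> = e \<star> (A \<triangleright> (e \<star> (A \<triangleright> e) \<star> MAssoc M A A m)) \<star> MAssoc M A (A \<otimes> A) m \<star>
        (Assoc C A A A \<triangleleft> m)"
      by (simp add: Lwhisk_Comp flip: module_pentagon)
    also have "\<dots> = e \<star> (A \<triangleright> e) \<star> (A \<triangleright> \<mu> \<triangleleft> m) \<star> MAssoc M A (A \<otimes> A) m \<star> (Assoc C A A A \<triangleleft> m)"
      by (simp add: Lwhisk_Comp flip: e\<mu>)
    also have "\<dots> = e \<star> ((\<mu> \<cdot> (Idn C A \<boxtimes> \<mu>) \<cdot> Assoc C A A A) \<triangleleft> m)"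
      by (simp add: Rwhisk_Comp e\<mu>' M.Comp_reassoc[OF MAssoc_nat2[OF \<mu>]])
    finally show "e \<star> ((\<mu> \<cdot> (\<mu> \<boxtimes> Idn C A)) \<triangleleft> m) =
        e \<star> ((\<mu> \<cdot> (Idn C A \<boxtimes> \<mu>) \<cdot> Assoc C A A A) \<triangleleft> m)" .
  qed (simp_all add: in_Hom)
  moreover have "\<mu> \<cdot> (\<eta> \<boxtimes> Idn C A) = LUnit C A"
  proof (rule eqI)
    have "e \<star> ((\<mu> \<cdot> (\<eta> \<boxtimes> Idn C A)) \<triangleleft> m) = e \<star> (A \<triangleright> e) \<star> (\<eta> \<triangleleft> (A \<diamondop> m)) \<star> MAssoc M (Unit C) A m"
      by (simp add: Rwhisk_Comp e\<mu>' MAssoc_nat1[OF \<eta>])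
    also have "\<dots> = e \<star> (\<eta> \<triangleleft> m) \<star> (Unit C \<triangleright> e) \<star> MAssoc M (Unit C) A m"
      by (simp add: M.Comp_reassoc[OF whisk_swap[OF \<eta> e, symmetric]])
    also have "\<dots> = e \<star> MUnit M (A \<diamondop> m) \<star> MAssoc M (Unit C) A m"
      by (simp add: e\<eta>' M.Comp_reassoc[OF MUnit_nat[OF e]])
    finally show "e \<star> ((\<mu> \<cdot> (\<eta> \<boxtimes> Idn C A)) \<triangleleft> m) = e \<star> (LUnit C A \<triangleleft> m)"
      by (simp add: MUnit_MAssoc)
  qed (simp_all add: in_Hom)
  moreover have "\<mu> \<cdot> (Idn C A \<boxtimes> \<eta>) = RUnit C A"
  proof (rule eqI)
    have "e \<star> ((\<mu> \<cdot> (Idn C A \<boxtimes> \<eta>)) \<triangleleft> m) = e \<star> (A \<triangleright> (e \<star> (\<eta> \<triangleleft> m))) \<star> MAssoc M A (Unit C) m"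
      by (simp add: Rwhisk_Comp Lwhisk_Comp e\<mu>' MAssoc_nat2[OF \<eta>])
    then show "e \<star> ((\<mu> \<cdot> (Idn C A \<boxtimes> \<eta>)) \<triangleleft> m) = e \<star> (RUnit C A \<triangleleft> m)"
      by (simp add: e\<eta> module_triangle)
  qed (simp_all add: in_Hom)
  ultimately show ?thesis
    using \<mu> \<eta> unfolding is_algebra_def \<mu>_def[symmetric] \<eta>_def[symmetric] by simp
qed

end

section \<open>Braided commutativity for the identity functor\<close>

lemma (in finite_module_category) braided_absorb:
  assumes Z: "Z \<in> center_obj C" and [simp]: "m \<in> Obj M"
    and e: "module_nat C M (act_modfun C M Z (id_modfun C M)) (id_modfun C M) e"
  shows "e m \<star> (fst Z \<triangleright> e m) \<star> slide M Z (fst Z) m = e m \<star> (fst Z \<triangleright> e m)"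
proof -
  let ?z = "fst Z"
  have [simp]: "pre_half_braiding C Z" "id_modfun C M \<in> rex_obj C M"
    using Z by (simp_all add: center_obj_pre id_modfun_in)
  note [simp] = act_modfun_simps act_modfun_MConstr id_modfun_simps module_nat_simps[OF e]
  have "e m \<in> Hom M (?z \<diamondop> m) m"
    by (simp add: in_Hom)
  \<comment> \<open>The identity functor sends \<open>e m\<close> to itself, so naturality of
    \<open>e\<close> at its own component involves nothing but components of \<open>e\<close> and
    the action.\<close>
  from module_nat_natural[OF e this] have nat: "e m \<star> (?z \<triangleright> e m) = e m \<star> e (?z \<diamondop> m)"
    by simp
  \<comment> \<open>The module condition at \<open>c = ?z\<close>: the constraint of the identity
    functor is trivial and that of the source is the inverse slide, so the slide itself appears
    after composing back.\<close>
  have "(?z \<triangleright> e m) \<star> inv_arr M (slide M Z ?z m) = e (?z \<diamondop> m)"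
    using module_nat_MConstr[OF e, of ?z m] by simp
  then have "e (?z \<diamondop> m) \<star> slide M Z ?z m = ?z \<triangleright> e m"
    by (simp flip: \<open>(?z \<triangleright> e m) \<star> inv_arr M (slide M Z ?z m) = e (?z \<diamondop> m)\<close>)
  then show ?thesis
    using M.Comp_reassoc[OF nat, of "slide M Z ?z m"] nat by simp
qed

text \<open>An internal Hom is determined only up to isomorphism, so it enters as an arbitrary
  representing pair \<open>A\<close>, \<open>\<Phi>\<close>. The algebra axioms come from
  \<open>internal_end_is_algebra\<close>, which leaves the identity with the braiding.\<close>

theorem corollary33:
  fixes C :: "('o, 'a, 'k::alg_closed_field) moncat"
    and M :: "('p, 'b, 'k, 'o, 'a) actcat"
    and A :: "'o \<times> ('o \<Rightarrow> 'a)"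
  assumes "finite_tensor_category C"
    and "finite_module_category C M"
    and "is_internal_hom (center C) (Rex C M) (id_modfun C M) (id_modfun C M) A \<Phi>"
  shows "braided_commutative_algebra (center C) A
           (internal_mult (center C) (Rex C M) (id_modfun C M) A \<Phi>)
           (internal_unit (center C) (Rex C M) (id_modfun C M) A \<Phi>)"
proof -
  interpret M: finite_module_category C M
    by (fact assms(2))
  interpret R: module_category "center C" "Rex C M"
    by (rule M.module_category_Rex)
  let ?I = "id_modfun C M" and ?a = "fst A"
  let ?\<mu> = "internal_mult (center C) (Rex C M) ?I A \<Phi>" and ?ev = "internal_ev (center C) A \<Phi>"
  have I: "?I \<in> Obj (Rex C M)"
    by (simp add: M.id_modfun_in)
  note h = assms(3) I
  have A: "A \<in> center_obj C"
    using R.internal_hom_eval(1)[OF h] by simp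
  then have [simp]: "?a \<in> Obj C" "pre_half_braiding C A"
    by (simp_all add: M.C.center_objD)
  obtain e where ev: "?ev = (act_modfun C M A ?I, e, ?I)"
    and e: "module_nat C M (act_modfun C M A ?I) ?I e"
    using R.internal_hom_eval(2)[OF h] by (auto simp: in_Hom_Rex)
  note [simp] = act_modfun_simps id_modfun_simps M.module_nat_simps[OF e]
  let ?\<beta> = "Braid (center C) A A"
  have \<beta>: "?\<beta> \<in> Hom (center C) (center_tensor C A A) (center_tensor C A A)"
    using M.C.Braid_center_arr[OF A A] by (simp add: in_Hom_center)
  have "Comp (center C) ?\<mu> ?\<beta> = ?\<mu>"
  proof (rule R.internal_hom_eqI[OF h])
    show "?\<mu> \<in> Hom (center C) (center_tensor C A A) A"
      using R.internal_mult(1)[OF h] by simp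
    then show "Comp (center C) ?\<mu> ?\<beta> \<in> Hom (center C) (center_tensor C A A) A"
      by (rule R.C.Comp_in[OF \<beta>])
    \<comment> \<open>The twofold evaluation that characterises the multiplication; it remains to
      see that \<open>?E\<close> absorbs the braiding.\<close>
    let ?E = "Comp (Rex C M) ?ev (Comp (Rex C M) (AArr (Rex C M) (Idn (center C) A) ?ev)
      (MAssoc (Rex C M) A A ?I))"
    have "Comp (Rex C M) ?ev (AArr (Rex C M) (Comp (center C) ?\<mu> ?\<beta>) (Idn (Rex C M) ?I)) =
        Comp (Rex C M) (Comp (Rex C M) ?ev (AArr (Rex C M) ?\<mu> (Idn (Rex C M) ?I)))
          (AArr (Rex C M) ?\<beta> (Idn (Rex C M) ?I))"
      using R.Rwhisk_Comp[of ?I ?\<beta> ?\<mu>] I \<beta> R.internal_mult(1)[OF h]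
        R.M.Comp_assoc[OF R.AArr_in[OF \<beta> R.M.Idn_in[OF I]]
          R.AArr_in[OF R.internal_mult(1)[OF h, unfolded center_simps] R.M.Idn_in[OF I]]
          R.internal_hom_eval(2)[OF h]]
      unfolding in_Hom by (simp del: center_simps Rex_simps add: center_simps(10))
    also have "\<dots> = Comp (Rex C M) ?E (AArr (Rex C M) ?\<beta> (Idn (Rex C M) ?I))"
      by (simp only: R.internal_mult(2)[OF h])
    also have "\<dots> = ?E"
    proof -
      \<comment> \<open>On components, \<open>MAssoc\<close> turns the half-braiding of
        \<open>A\<close> at its own underlying object into the slide that
        \<open>braided_absorb\<close> removes.\<close>
      have "(e m \<cdot>\<^bsub>M\<^esub> (Idn C ?a \<unrhd>\<^bsub>M\<^esub> e m) \<cdot>\<^bsub>M\<^esub> MAssoc M ?a ?a m) \<cdot>\<^bsub>M\<^esub> (snd A ?a \<unrhd>\<^bsub>M\<^esub> Idn M m) =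
          e m \<cdot>\<^bsub>M\<^esub> (Idn C ?a \<unrhd>\<^bsub>M\<^esub> e m) \<cdot>\<^bsub>M\<^esub> MAssoc M ?a ?a m" if [simp]: "m \<in> Obj M" for m
      proof -
        have "(e m \<cdot>\<^bsub>M\<^esub> (Idn C ?a \<unrhd>\<^bsub>M\<^esub> e m) \<cdot>\<^bsub>M\<^esub> MAssoc M ?a ?a m) \<cdot>\<^bsub>M\<^esub> (snd A ?a \<unrhd>\<^bsub>M\<^esub> Idn M m) =
            (e m \<cdot>\<^bsub>M\<^esub> (Idn C ?a \<unrhd>\<^bsub>M\<^esub> e m) \<cdot>\<^bsub>M\<^esub> slide M A ?a m) \<cdot>\<^bsub>M\<^esub> MAssoc M ?a ?a m"
          by (simp add: M.slide_MAssoc)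
        then show ?thesis
          by (simp only: M.braided_absorb[OF A that e]) simp
      qed
      then show ?thesis
        unfolding ev by (auto intro!: restrict_ext)
    qed
    finally show "Comp (Rex C M) ?ev (AArr (Rex C M) (Comp (center C) ?\<mu> ?\<beta>) (Idn (Rex C M) ?I)) =
        Comp (Rex C M) ?ev (AArr (Rex C M) ?\<mu> (Idn (Rex C M) ?I))"
      by (simp only: R.internal_mult(2)[OF h])
  qed
  then show ?thesis
    using R.internal_end_is_algebra[OF h] by (simp add: braided_commutative_algebra_def)
qed

end
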